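(* Let $M$ be an $m\times n$ binary matrix that is a $(2,* )$-matrix or a $( *,2)$-matrix, and let $d\ge0$ be an integer. Deciding whether there is a set of at most $d$ $1$-entries of $M$ whose flipping to $0$ yields a matrix with the simultaneous consecutive ones property can be done in time $O^*(6^d)$. Moreover, the optimization problem of finding a minimum number of such $1$-entries on $(2,* )$-matrices or $( *,2)$-matrices admits a polynomial-time approximation algorithm with factor six.
   Context: A binary matrix has the consecutive ones property (C1P) for rows if its columns can be permuted so that in every row the $1$-entries occur consecutively; it has the C1P for columns if its rows can be permuted so that in every column the $1$-entries occur consecutively. It has the simultaneous consecutive ones property (SC1P) if it has both. A $(2,* )$-matrix has at most two ones in each column; a $( *,2)$-matrix has at most two ones in each row. $O^*(f(d))$ denotes $f(d)\cdot N^{O(1)}$ where $N$ is the input size. *)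

theory Defs
  imports "Jordan_Normal_Form.Matrix" "HOL-Combinatorics.Permutations"
begin

section \<open>Binary matrices and the simultaneous consecutive ones property\<close>

text \<open>A binary matrix is a \<^typ>\<open>bool mat\<close>, where \<^term>\<open>True\<close> stands for the entry 1.\<close>

definition ones :: "bool mat \<Rightarrow> (nat \<times> nat) set" where
  "ones M = {(i, j). i < dim_row M \<and> j < dim_col M \<and> M $$ (i, j)}"

definition two_star :: "bool mat \<Rightarrow> bool" where
  "two_star M \<longleftrightarrow> (\<forall>j<dim_col M. card {i. i < dim_row M \<and> M $$ (i, j)} \<le> 2)"

definition star_two :: "bool mat \<Rightarrow> bool" where
  "star_two M \<longleftrightarrow> (\<forall>i<dim_row M. card {j. j < dim_col M \<and> M $$ (i, j)} \<le> 2)"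

definition consecutive_ones :: "bool vec \<Rightarrow> bool" where
  "consecutive_ones v \<longleftrightarrow>
     (\<forall>a b c. a < b \<and> b < c \<and> c < dim_vec v \<and> v $ a \<and> v $ c \<longrightarrow> v $ b)"

definition permute_cols :: "(nat \<Rightarrow> nat) \<Rightarrow> bool mat \<Rightarrow> bool mat" where
  "permute_cols \<pi> M = mat (dim_row M) (dim_col M) (\<lambda>(i, j). M $$ (i, \<pi> j))"

definition permute_rows :: "(nat \<Rightarrow> nat) \<Rightarrow> bool mat \<Rightarrow> bool mat" where
  "permute_rows \<pi> M = mat (dim_row M) (dim_col M) (\<lambda>(i, j). M $$ (\<pi> i, j))"

definition C1P_rows :: "bool mat \<Rightarrow> bool" where
  "C1P_rows M \<longleftrightarrow> (\<exists>\<pi>. \<pi> permutes {..<dim_col M} \<and>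
     (\<forall>i<dim_row M. consecutive_ones (row (permute_cols \<pi> M) i)))"

definition C1P_cols :: "bool mat \<Rightarrow> bool" where
  "C1P_cols M \<longleftrightarrow> (\<exists>\<pi>. \<pi> permutes {..<dim_row M} \<and>
     (\<forall>j<dim_col M. consecutive_ones (col (permute_rows \<pi> M) j)))"

definition SC1P :: "bool mat \<Rightarrow> bool" where
  "SC1P M \<longleftrightarrow> C1P_rows M \<and> C1P_cols M"

definition flip_to_zero :: "bool mat \<Rightarrow> (nat \<times> nat) set \<Rightarrow> bool mat" where
  "flip_to_zero M F = mat (dim_row M) (dim_col M) (\<lambda>(i, j). M $$ (i, j) \<and> (i, j) \<notin> F)"

definition SC1P_solution :: "bool mat \<Rightarrow> (nat \<times> nat) set \<Rightarrow> bool" where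
  "SC1P_solution M F \<longleftrightarrow> F \<subseteq> ones M \<and> SC1P (flip_to_zero M F)"

definition SC1P_opt :: "bool mat \<Rightarrow> nat" where
  "SC1P_opt M = (LEAST k. \<exists>F. SC1P_solution M F \<and> card F = k)"


section \<open>Model of computation\<close>

text \<open>
  Algorithms are programs of a first-order, call-by-value functional language whose data are
  binary trees (pure LISP, as in Jones, \<open>Computability and Complexity from a Programming
  Perspective\<close>).  Every evaluation step costs one time unit.  Each step allocates or
  follows at most one pointer, or copies a number of pointers that is bounded in terms of the
  program alone.  Hence a RAM simulates a fixed program with constant overhead per step, so that
  \<^item> running times of the form \<open>f(d) * N^O(1)\<close> in this model are such running times on a RAM, and
  \<^item> polynomial time in this model is the usual polynomial time.
\<close>

datatype sexp = SNil | SCons sexp sexp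

fun shd :: "sexp \<Rightarrow> sexp" where
  "shd SNil = SNil"
| "shd (SCons a b) = a"

fun stl :: "sexp \<Rightarrow> sexp" where
  "stl SNil = SNil"
| "stl (SCons a b) = b"

fun nodes :: "sexp \<Rightarrow> nat" where
  "nodes SNil = 1"
| "nodes (SCons a b) = 1 + nodes a + nodes b"

text \<open>
  Variables are de Bruijn indices into the environment.  A program is the list of the bodies of its
  functions; \<open>Call f es\<close> evaluates the body of function \<open>f\<close> in the environment consisting of
  the values of \<open>es\<close>.
\<close>

datatype expr =
    Var nat
  | Nil_e
  | Cons_e expr expr
  | Hd expr
  | Tl expr
  | If_e expr expr expr
  | Let_e expr expr
  | Call nat "expr list"

type_synonym program = "expr list"

text \<open>\<open>eval P env e v t\<close>: in environment \<open>env\<close>, the expression \<open>e\<close> evaluates to \<open>v\<close> in \<open>t\<close> steps.\<close>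

inductive eval :: "program \<Rightarrow> sexp list \<Rightarrow> expr \<Rightarrow> sexp \<Rightarrow> nat \<Rightarrow> bool"
  and evals :: "program \<Rightarrow> sexp list \<Rightarrow> expr list \<Rightarrow> sexp list \<Rightarrow> nat \<Rightarrow> bool"
  for P :: program
where
  eval_Var: "i < length env \<Longrightarrow> eval P env (Var i) (env ! i) 1"
| eval_Nil: "eval P env Nil_e SNil 1"
| eval_Cons: "eval P env e1 v1 t1 \<Longrightarrow> eval P env e2 v2 t2 \<Longrightarrow>
    eval P env (Cons_e e1 e2) (SCons v1 v2) (1 + t1 + t2)"
| eval_Hd: "eval P env e v t \<Longrightarrow> eval P env (Hd e) (shd v) (1 + t)"
| eval_Tl: "eval P env e v t \<Longrightarrow> eval P env (Tl e) (stl v) (1 + t)"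
| eval_If_true: "eval P env b u t1 \<Longrightarrow> u \<noteq> SNil \<Longrightarrow> eval P env e1 v t2 \<Longrightarrow>
    eval P env (If_e b e1 e2) v (1 + t1 + t2)"
| eval_If_false: "eval P env b SNil t1 \<Longrightarrow> eval P env e2 v t2 \<Longrightarrow>
    eval P env (If_e b e1 e2) v (1 + t1 + t2)"
| eval_Let: "eval P env e1 u t1 \<Longrightarrow> eval P (u # env) e2 v t2 \<Longrightarrow>
    eval P env (Let_e e1 e2) v (1 + t1 + t2)"
| eval_Call: "f < length P \<Longrightarrow> evals P env es vs t1 \<Longrightarrow> eval P vs (P ! f) v t2 \<Longrightarrow>
    eval P env (Call f es) v (1 + t1 + t2)"
| evals_Nil: "evals P env [] [] 0"
| evals_Cons: "eval P env e v t1 \<Longrightarrow> evals P env es vs t2 \<Longrightarrow>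
    evals P env (e # es) (v # vs) (t1 + t2)"

inductive_cases eval_elims:
  "eval P env (Var i) v t"
  "eval P env Nil_e v t"
  "eval P env (Cons_e e1 e2) v t"
  "eval P env (Hd e) v t"
  "eval P env (Tl e) v t"
  "eval P env (If_e b e1 e2) v t"
  "eval P env (Let_e e1 e2) v t"
  "eval P env (Call f es) v t"
  "evals P env [] vs t"
  "evals P env (e # es) vs t"

lemma eval_deterministic:
  "eval P env e v t \<Longrightarrow> eval P env e v' t' \<Longrightarrow> v' = v \<and> t' = t"
  "evals P env es vs t \<Longrightarrow> evals P env es vs' t' \<Longrightarrow> vs' = vs \<and> t' = t"
proof (induction arbitrary: v' t' and vs' t' rule: eval_evals.inducts)
  case eval_Var
  from eval_Var.prems show ?case by (rule eval_elims) simp_all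
next
  case eval_Nil
  from eval_Nil.prems show ?case by (rule eval_elims) simp_all
next
  case eval_Cons
  from eval_Cons.prems show ?case
    by (rule eval_elims) (auto dest!: eval_Cons.IH(2,4))
next
  case eval_Hd
  from eval_Hd.prems show ?case
    by (rule eval_elims) (auto dest!: eval_Hd.IH(2))
next
  case eval_Tl
  from eval_Tl.prems show ?case
    by (rule eval_elims) (auto dest!: eval_Tl.IH(2))
next
  case eval_If_true
  from eval_If_true.prems show ?case
    by (rule eval_elims) (auto dest!: eval_If_true.IH(2,4) simp: eval_If_true.hyps)
next
  case eval_If_false
  from eval_If_false.prems show ?case
    by (rule eval_elims) (auto dest!: eval_If_false.IH(2,4))
next
  case eval_Let
  from eval_Let.prems show ?case
    by (rule eval_elims) (auto dest!: eval_Let.IH(2,4))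
next
  case eval_Call
  from eval_Call.prems show ?case
    by (rule eval_elims) (auto dest!: eval_Call.IH(3,5))
next
  case evals_Nil
  from evals_Nil.prems show ?case by (rule eval_elims) simp_all
next
  case evals_Cons
  from evals_Cons.prems show ?case
    by (rule eval_elims) (auto dest!: evals_Cons.IH(2,4))
qed

text \<open>Execution starts with function 0 applied to the input.\<close>

definition outputs_within :: "program \<Rightarrow> sexp \<Rightarrow> sexp \<Rightarrow> nat \<Rightarrow> bool" where
  "outputs_within P x y T \<longleftrightarrow> (\<exists>t\<le>T. eval P [x] (Call 0 [Var 0]) y t)"


section \<open>Encoding of inputs and outputs\<close>

fun enc_bool :: "bool \<Rightarrow> sexp" where
  "enc_bool False = SNil"
| "enc_bool True = SCons SNil SNil"

fun enc_list :: "('a \<Rightarrow> sexp) \<Rightarrow> 'a list \<Rightarrow> sexp" where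
  "enc_list f [] = SNil"
| "enc_list f (x # xs) = SCons (f x) (enc_list f xs)"

text \<open>Binary representation, least significant bit first.\<close>

fun bits :: "nat \<Rightarrow> bool list" where
  "bits n = (if n = 0 then [] else odd n # bits (n div 2))"

declare bits.simps [simp del]

definition enc_nat :: "nat \<Rightarrow> sexp" where
  "enc_nat n = enc_list enc_bool (bits n)"

definition enc_mat :: "bool mat \<Rightarrow> sexp" where
  "enc_mat M = SCons (enc_nat (dim_row M)) (SCons (enc_nat (dim_col M))
     (enc_list (enc_list enc_bool) (mat_to_list M)))"

definition enc_instance :: "bool mat \<Rightarrow> nat \<Rightarrow> sexp" where
  "enc_instance M d = SCons (enc_mat M) (enc_nat d)"

text \<open>A set of positions of an \<open>m \<times> n\<close> matrix is output as its characteristic matrix.\<close>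

definition enc_positions :: "nat \<Rightarrow> nat \<Rightarrow> (nat \<times> nat) set \<Rightarrow> sexp" where
  "enc_positions m n F = enc_mat (mat m n (\<lambda>p. p \<in> F))"

end

theory Submission
  imports Defs "HOL-Library.More_List"
begin

text \<open>
  Transposing if necessary, let every row contain at most two ones.  A row with two ones is an edge
  between two columns.  The matrix has the SC1P iff these edges form, up to parallel copies, a
  disjoint union of paths: then the columns can be arranged along the paths, and the rows along with
  them.  Flipping an entry of a row amounts to deleting its edge, so the task is to delete as few
  edges as possible such that paths remain.

  Three pairwise non-parallel edges with a common end (a claw) force the deletion of one of them.
  Branching over the three choices takes \<open>3 ^ d\<close> leaves; deleting all three edges, with all their
  six ones, costs at most six times the optimum.  Without claws, the distinct edges form paths and
  cycles, and a maximum spanning forest with respect to the multiplicities deletes from every cycle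
  an edge of smallest multiplicity, which is optimal.

  Running times are obtained compositionally: the functions computable in polynomial time, with
  results of polynomial size, are closed under composition, case distinction and iteration over
  lists.
\<close>

section \<open>Polynomial-time functions\<close>

text \<open>The greedy choice is exact only because no claw is left: when each vertex has at most
  two distinct neighbours, a rejected edge joins the two ends of a path and closes it to a cycle
  that no further edge leaves. Hence each rejected edge has a cycle of its own; some edge of that
  cycle must go with all its copies, at no smaller cost, and these costs add up. Copies stand or
  fall together, because one surviving copy forces the same adjacency as all of them.

  The depth of the branching raises a problem of encoding. The budget \<open>d\<close> arrives in
  binary, whereas a guess has one symbol per deletion and its length is counted in unary, which may
  be exponential in the input. Since no solution needs more deletions than there are items,
  \<open>d\<close> is capped at their number while it is decoded. As for the base 6 of the running
  time, only 3 stems from the choices; the rest absorbs the overhead of the nodes of the search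
  tree.\<close>

class encodable =
  fixes enc :: "'a \<Rightarrow> sexp"

instantiation bool :: encodable
begin
definition "enc = enc_bool"
instance ..
end

instantiation unit :: encodable
begin
definition "enc (u :: unit) = SNil"
instance ..
end

instantiation prod :: (encodable, encodable) encodable
begin
definition "enc p = SCons (enc (fst p)) (enc (snd p))"
instance ..
end

instantiation list :: (encodable) encodable
begin
definition "enc = enc_list enc"
instance ..
end

text \<open>Natural numbers are encoded in unary; binary numbers enter as their lists of bits.\<close>

instantiation nat :: encodable
begin
definition "enc n = enc (replicate n ())"
instance ..
end

abbreviation size_of :: "'a::encodable \<Rightarrow> nat" where
  "size_of x \<equiv> nodes (enc x)"

lemma enc_Pair [simp]: "enc (a, b) = SCons (enc a) (enc b)"
  by (simp add: enc_prod_def)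

lemma enc_list_Nil [simp]: "enc [] = SNil"
  by (simp add: enc_list_def)

lemma enc_list_Cons [simp]: "enc (x # xs) = SCons (enc x) (enc xs)"
  by (simp add: enc_list_def)

lemma enc_unit [simp]: "enc (u :: unit) = SNil"
  by (simp add: enc_unit_def)

lemma enc_True [simp]: "enc True = SCons SNil SNil"
  by (simp add: enc_bool_def)

lemma enc_False [simp]: "enc False = SNil"
  by (simp add: enc_bool_def)

lemma enc_0 [simp]: "enc (0 :: nat) = SNil"
  by (simp add: enc_nat_def)

lemma enc_Suc [simp]: "enc (Suc n) = SCons SNil (enc n)"
  by (simp add: enc_nat_def)

lemma enc_list_eq_SNil_iff [simp]: "enc (xs :: 'a::encodable list) = SNil \<longleftrightarrow> xs = []"
  by (cases xs) auto

lemma enc_bool_eq_SNil_iff [simp]: "enc b = SNil \<longleftrightarrow> \<not> b"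
  by (cases b) auto

lemma enc_nat_eq_SNil_iff [simp]: "enc (n :: nat) = SNil \<longleftrightarrow> n = 0"
  by (cases n) auto

lemma nodes_pos [simp]: "0 < nodes s"
  by (cases s) auto

lemma size_of_ge_1 [simp]: "Suc 0 \<le> nodes s"
  by (cases s) auto

lemma size_of_nat [simp]: "size_of (n :: nat) = 2 * n + 1"
  by (induction n) auto

lemma length_less_size_of: "length xs < size_of xs"
  by (induction xs) auto

lemma size_of_mem: "x \<in> set xs \<Longrightarrow> size_of x < size_of xs"
  by (induction xs) auto

lemma size_of_list_le: "(\<And>x. x \<in> set xs \<Longrightarrow> size_of x \<le> b) \<Longrightarrow> size_of xs \<le> 1 + length xs * (1 + b)"
  by (induction xs) force+

lemma size_of_drop: "size_of (drop n xs) \<le> size_of xs"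
  by (induction xs arbitrary: n) (auto simp: drop_Cons split: nat.splits intro: le_SucI trans_le_add2)

lemma size_of_append: "size_of (xs @ ys) \<le> size_of xs + size_of ys"
  by (induction xs) auto

lemma size_of_filter: "size_of (filter Q xs) \<le> size_of xs"
  by (induction xs) auto


subsection \<open>Polynomial bounds\<close>

definition poly_bounded :: "('a::encodable \<Rightarrow> nat) \<Rightarrow> bool" where
  "poly_bounded T \<longleftrightarrow> (\<exists>c k. \<forall>x. T x \<le> c * size_of x ^ k)"

lemma poly_bounded_mono: "poly_bounded T \<Longrightarrow> (\<And>x. S x \<le> T x) \<Longrightarrow> poly_bounded S"
  unfolding poly_bounded_def by (meson order_trans)

lemma poly_bounded_const: "poly_bounded (\<lambda>x. c)"
  unfolding poly_bounded_def by (rule exI[of _ c], rule exI[of _ 0]) auto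

lemma poly_bounded_size: "poly_bounded size_of"
  unfolding poly_bounded_def by (rule exI[of _ 1], rule exI[of _ 1]) auto

lemma poly_bounded_add:
  assumes "poly_bounded S" "poly_bounded T" shows "poly_bounded (\<lambda>x. S x + T x)"
proof -
  obtain c k where S: "\<And>x. S x \<le> c * size_of x ^ k" using assms(1) unfolding poly_bounded_def by blast
  obtain d l where T: "\<And>x. T x \<le> d * size_of x ^ l" using assms(2) unfolding poly_bounded_def by blast
  \<comment> \<open>Sizes are at least 1, so raising both exponents to \<open>k + l\<close> only
    weakens the two bounds.\<close>
  have "S x + T x \<le> (c + d) * size_of x ^ (k + l)" for x
  proof -
    have "S x \<le> c * size_of x ^ (k + l)"
      by (rule order_trans[OF S]) (auto intro: power_increasing)
    moreover have "T x \<le> d * size_of x ^ (k + l)"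
      by (rule order_trans[OF T]) (auto intro: power_increasing)
    ultimately show ?thesis by (simp add: distrib_right)
  qed
  then show ?thesis unfolding poly_bounded_def by blast
qed

lemma poly_bounded_mult:
  assumes "poly_bounded S" "poly_bounded T" shows "poly_bounded (\<lambda>x. S x * T x)"
proof -
  obtain c k where S: "\<And>x. S x \<le> c * size_of x ^ k" using assms(1) unfolding poly_bounded_def by blast
  obtain d l where T: "\<And>x. T x \<le> d * size_of x ^ l" using assms(2) unfolding poly_bounded_def by blast
  have "S x * T x \<le> (c * d) * size_of x ^ (k + l)" for x
    using mult_mono[OF S T, of x x] by (simp add: power_add mult_ac)
  then show ?thesis unfolding poly_bounded_def by blast
qed

lemma poly_bounded_power: "poly_bounded T \<Longrightarrow> poly_bounded (\<lambda>x. T x ^ k)"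
  by (induction k) (auto intro: poly_bounded_const poly_bounded_mult)

lemma poly_bounded_Suc: "poly_bounded T \<Longrightarrow> poly_bounded (\<lambda>x. Suc (T x))"
  using poly_bounded_add[OF poly_bounded_const[of 1]] by simp

lemmas poly_bounded_intros =
  poly_bounded_const poly_bounded_size poly_bounded_add poly_bounded_mult poly_bounded_power
  poly_bounded_Suc


subsection \<open>Linking of programs\<close>

fun relocate :: "nat \<Rightarrow> expr \<Rightarrow> expr" where
  "relocate n (Var i) = Var i"
| "relocate n Nil_e = Nil_e"
| "relocate n (Cons_e a b) = Cons_e (relocate n a) (relocate n b)"
| "relocate n (Hd a) = Hd (relocate n a)"
| "relocate n (Tl a) = Tl (relocate n a)"
| "relocate n (If_e a b c) = If_e (relocate n a) (relocate n b) (relocate n c)"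
| "relocate n (Let_e a b) = Let_e (relocate n a) (relocate n b)"
| "relocate n (Call f es) = Call (n + f) (map (relocate n) es)"

text \<open>Behind \<open>Q\<close>, function \<open>f\<close> of \<open>P\<close> sits at index
  \<open>length Q + f\<close>, which is where the relocated calls point. Nothing else changes, hence
  the same number of steps.\<close>

lemma eval_relocate:
  "eval P env e v t \<Longrightarrow>
     eval (Q @ map (relocate (length Q)) P) env (relocate (length Q) e) v t"
  "evals P env es vs t \<Longrightarrow>
     evals (Q @ map (relocate (length Q)) P) env (map (relocate (length Q)) es) vs t"
proof (induction rule: eval_evals.inducts)
  case (eval_Call f env es vs t1 v t2)
  then show ?case
    by (auto intro!: eval_evals.eval_Call[simplified] simp: nth_append)
qed (auto intro: eval_evals.intros[simplified])

lemma eval_append_program: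
  "eval P env e v t \<Longrightarrow> eval (P @ Q) env e v t"
  "evals P env es vs t \<Longrightarrow> evals (P @ Q) env es vs t"
proof (induction rule: eval_evals.inducts)
  case (eval_Call f env es vs t1 v t2)
  then show ?case
    by (auto intro!: eval_evals.eval_Call[simplified] simp: nth_append)
qed (auto intro: eval_evals.intros[simplified])

text \<open>De Bruijn indices count from the front, so values appended at the end are never reached.
  Code written for a one-element environment can therefore be reused below a
  \<open>Let_e\<close>.\<close>

lemma eval_append_env:
  "eval P env e v t \<Longrightarrow> eval P (env @ env') e v t"
  "evals P env es vs t \<Longrightarrow> evals P (env @ env') es vs t"
proof (induction rule: eval_evals.inducts)
  case (eval_Var i env)
  then show ?case
    using eval_evals.eval_Var[of i "env @ env'"] by (simp add: nth_append)
qed (auto intro: eval_evals.intros[simplified])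

text \<open>\<open>eval\<close> counts steps exactly; working with an upper bound lets the costs of
  subexpressions be relaxed before they are combined.\<close>

definition runs :: "program \<Rightarrow> sexp list \<Rightarrow> expr \<Rightarrow> sexp \<Rightarrow> nat \<Rightarrow> bool" where
  "runs P env e v T \<longleftrightarrow> (\<exists>t\<le>T. eval P env e v t)"

lemma runs_mono: "runs P env e v T \<Longrightarrow> T \<le> T' \<Longrightarrow> runs P env e v T'"
  unfolding runs_def by (meson order_trans)

lemma runs_append_env: "runs P env e v T \<Longrightarrow> runs P (env @ env') e v T"
  unfolding runs_def using eval_append_env(1) by blast

lemma runs_Var: "i < length env \<Longrightarrow> runs P env (Var i) (env ! i) 1"
  unfolding runs_def using eval_Var by blast

lemma runs_Nil: "runs P env Nil_e SNil 1"
  unfolding runs_def using eval_Nil by blast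

lemma runs_Cons: "runs P env a u S \<Longrightarrow> runs P env b v T \<Longrightarrow> runs P env (Cons_e a b) (SCons u v) (1 + S + T)"
  unfolding runs_def by (meson eval_Cons add_mono order_refl)

lemma runs_Hd: "runs P env a u S \<Longrightarrow> runs P env (Hd a) (shd u) (1 + S)"
  unfolding runs_def by (meson eval_Hd add_mono order_refl)

lemma runs_Tl: "runs P env a u S \<Longrightarrow> runs P env (Tl a) (stl u) (1 + S)"
  unfolding runs_def by (meson eval_Tl add_mono order_refl)

lemma runs_Let: "runs P env a u S \<Longrightarrow> runs P (u # env) b v T \<Longrightarrow> runs P env (Let_e a b) v (1 + S + T)"
  unfolding runs_def by (meson eval_Let add_mono order_refl)

lemma runs_If_true:
  "runs P env a u R \<Longrightarrow> u \<noteq> SNil \<Longrightarrow> runs P env b v S \<Longrightarrow> runs P env (If_e a b c) v (1 + R + S)"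
  unfolding runs_def by (meson eval_If_true add_mono order_refl)

lemma runs_If_false:
  "runs P env a SNil R \<Longrightarrow> runs P env c v T \<Longrightarrow> runs P env (If_e a b c) v (1 + R + T)"
  unfolding runs_def by (meson eval_If_false add_mono order_refl)

lemma runs_Call1:
  assumes "f < length P" "runs P env a u S" "runs P [u] (P ! f) v T"
  shows "runs P env (Call f [a]) v (1 + S + T)"
proof -
  obtain s t where s: "s \<le> S" "eval P env a u s" and t: "t \<le> T" "eval P [u] (P ! f) v t"
    using assms unfolding runs_def by blast
  have "evals P env [a] [u] (s + 0)"
    by (intro evals_Cons evals_Nil s)
  then have "eval P env (Call f [a]) v (1 + (s + 0) + t)"
    using assms(1) t(2) by (intro eval_Call)
  moreover have "1 + (s + 0) + t \<le> 1 + S + T" using s t by linarith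
  ultimately show ?thesis unfolding runs_def by blast
qed

lemma runs_Call3:
  assumes "f < length P" "runs P env a u S1" "runs P env b v S2" "runs P env c w S3"
    and "runs P [u, v, w] (P ! f) r T"
  shows "runs P env (Call f [a, b, c]) r (1 + S1 + S2 + S3 + T)"
proof -
  obtain s1 s2 s3 t where s: "s1 \<le> S1" "eval P env a u s1" "s2 \<le> S2" "eval P env b v s2"
      "s3 \<le> S3" "eval P env c w s3" and t: "t \<le> T" "eval P [u, v, w] (P ! f) r t"
    using assms unfolding runs_def by blast
  have "evals P env [a, b, c] [u, v, w] (s1 + (s2 + (s3 + 0)))"
    by (intro evals_Cons evals_Nil s)
  then have "eval P env (Call f [a, b, c]) r (1 + (s1 + (s2 + (s3 + 0))) + t)"
    using assms(1) t(2) by (intro eval_Call)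
  moreover have "1 + (s1 + (s2 + (s3 + 0))) + t \<le> 1 + S1 + S2 + S3 + T"
    using s t by linarith
  ultimately show ?thesis unfolding runs_def by blast
qed


subsection \<open>Closure properties\<close>

definition computes :: "program \<Rightarrow> expr \<Rightarrow> ('a::encodable \<Rightarrow> 'b::encodable) \<Rightarrow> bool" where
  "computes P e f \<longleftrightarrow> (\<exists>T. poly_bounded T \<and> (\<forall>x. runs P [enc x] e (enc (f x)) (T x)))"

text \<open>
  Values are trees, but they are shared in memory, so their size may be exponential in the running
  time.  The size of the result therefore has to be bounded separately.
\<close>

definition ptime :: "('a::encodable \<Rightarrow> 'b::encodable) \<Rightarrow> bool" where
  "ptime f \<longleftrightarrow> (\<exists>P e. computes P e f) \<and> poly_bounded (\<lambda>x. size_of (f x))"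

lemma computes_relocate:
  "computes P e f \<Longrightarrow> computes (Q @ map (relocate (length Q)) P) (relocate (length Q) e) f"
  unfolding computes_def runs_def using eval_relocate(1) by meson

lemma computes_append: "computes P e f \<Longrightarrow> computes (P @ Q) e f"
  unfolding computes_def runs_def using eval_append_program(1) by meson

lemma ptimeE:
  assumes "ptime f" obtains P e where "computes P e f" "poly_bounded (\<lambda>x. size_of (f x))"
  using assms unfolding ptime_def by blast

lemma ptimeI: "computes P e f \<Longrightarrow> poly_bounded (\<lambda>x. size_of (f x)) \<Longrightarrow> ptime f"
  unfolding ptime_def by blast

lemma computesE:
  assumes "computes P e f" obtains T where "poly_bounded T" "\<And>x. runs P [enc x] e (enc (f x)) (T x)"
  using assms unfolding computes_def by blast

lemma computesI: "(\<And>x. runs P [enc x] e (enc (f x)) (T x)) \<Longrightarrow> poly_bounded T \<Longrightarrow> computes P e f"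
  unfolding computes_def by blast

text \<open>One program is appended to the other with its calls relocated; both expressions then
  refer to a single program and keep their running times.\<close>

lemma ptime_link2:
  assumes "ptime f" "ptime g"
  obtains P a b where "computes P a f" "computes P b g"
  using assms by (meson ptimeE computes_relocate computes_append)

lemma ptime_link3:
  assumes "ptime f" "ptime g" "ptime h"
  obtains P a b c where "computes P a f" "computes P b g" "computes P c h"
  using assms by (meson ptime_link2 ptimeE computes_relocate computes_append)

lemma ptime_size: "ptime f \<Longrightarrow> poly_bounded (\<lambda>x. size_of (f x))"
  unfolding ptime_def by blast

text \<open>This is where bounding the size of results pays off: the second function of a
  composition is charged in terms of the size of \<open>f x\<close>, which has to be polynomial in
  that of \<open>x\<close>.\<close>

lemma poly_bounded_comp:
  assumes "poly_bounded T" "poly_bounded (\<lambda>x. size_of (f x))"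
  shows "poly_bounded (\<lambda>x. T (f x))"
proof -
  obtain c k where T: "\<And>x. T x \<le> c * size_of x ^ k" using assms(1) unfolding poly_bounded_def by blast
  have "poly_bounded (\<lambda>x. c * size_of (f x) ^ k)"
    by (intro poly_bounded_intros assms)
  then show ?thesis by (rule poly_bounded_mono) (rule T)
qed

lemma ptime_id: "ptime (\<lambda>x. x)"
proof (rule ptimeI)
  show "computes [] (Var 0) (\<lambda>x. x)"
    by (rule computesI[OF _ poly_bounded_const]) (use runs_Var[of 0 "[_]"] in simp)
qed (rule poly_bounded_size)

fun quote_expr :: "sexp \<Rightarrow> expr" where
  "quote_expr SNil = Nil_e"
| "quote_expr (SCons a b) = Cons_e (quote_expr a) (quote_expr b)"

lemma runs_quote: "runs P env (quote_expr s) s (nodes s)"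
  by (induction s) (use runs_Nil runs_Cons in fastforce)+

lemma ptime_const: "ptime (\<lambda>x. c)"
  by (rule ptimeI[of "[]" "quote_expr (enc c)"], rule computesI[OF _ poly_bounded_const])
     (auto intro: runs_quote poly_bounded_const)

lemma ptime_comp:
  assumes "ptime g" "ptime f" shows "ptime (\<lambda>x. g (f x))"
proof -
  obtain P a b where P: "computes P a f" "computes P b g"
    using ptime_link2[OF assms(2,1)] by blast
  obtain S where S: "poly_bounded S" "\<And>x. runs P [enc x] a (enc (f x)) (S x)"
    using computesE[OF P(1)] by blast
  obtain T where T: "poly_bounded T" "\<And>x. runs P [enc x] b (enc (g x)) (T x)"
    using computesE[OF P(2)] by blast
  have "computes P (Let_e a b) (\<lambda>x. g (f x))"
  proof (rule computesI)
    show "runs P [enc x] (Let_e a b) (enc (g (f x))) (1 + S x + T (f x))" for x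
      using runs_append_env[OF T(2)[of "f x"], of "[enc x]"] by (intro runs_Let[OF S(2)]) simp
    show "poly_bounded (\<lambda>x. 1 + S x + T (f x))"
      by (intro poly_bounded_intros S(1) poly_bounded_comp[OF T(1)] ptime_size assms)
  qed
  moreover have "poly_bounded (\<lambda>x. size_of (g (f x)))"
    by (rule poly_bounded_comp[OF ptime_size[OF assms(1)] ptime_size[OF assms(2)]])
  ultimately show ?thesis by (rule ptimeI)
qed

lemma ptime_Pair:
  assumes "ptime f" "ptime g" shows "ptime (\<lambda>x. (f x, g x))"
proof -
  obtain P a b where P: "computes P a f" "computes P b g"
    using ptime_link2[OF assms] by blast
  obtain S where S: "poly_bounded S" "\<And>x. runs P [enc x] a (enc (f x)) (S x)"
    using computesE[OF P(1)] by blast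
  obtain T where T: "poly_bounded T" "\<And>x. runs P [enc x] b (enc (g x)) (T x)"
    using computesE[OF P(2)] by blast
  have "computes P (Cons_e a b) (\<lambda>x. (f x, g x))"
    by (rule computesI, unfold enc_Pair, rule runs_Cons[OF S(2) T(2)]) (intro poly_bounded_intros S T)
  moreover have "poly_bounded (\<lambda>x. size_of (f x, g x))"
    by (simp, intro poly_bounded_intros ptime_size assms)
  ultimately show ?thesis by (rule ptimeI)
qed

lemma ptime_comp2:
  assumes "ptime (\<lambda>z. h (fst z) (snd z))" "ptime f" "ptime g"
  shows "ptime (\<lambda>x. h (f x) (g x))"
  using ptime_comp[OF assms(1) ptime_Pair[OF assms(2,3)]] by simp

text \<open>Programs see only encodings. Types with coinciding encodings can thus be exchanged: a
  nonempty list and the pair of its head and tail, a number and a list of units.\<close>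

lemma ptime_recode:
  assumes "\<And>x. enc (g x) = enc (f x)" "ptime f" shows "ptime g"
  using assms unfolding ptime_def computes_def by simp

lemma ptime_Cons:
  assumes "ptime f" "ptime g" shows "ptime (\<lambda>x. f x # g x)"
  by (rule ptime_recode[OF _ ptime_Pair[OF assms]]) simp

lemma runs_Var0: "runs P [s] (Var 0) s 1"
  using runs_Var[of 0 "[s]" P] by simp

lemma ptime_hd_sexp:
  assumes "\<And>x. enc (f x) = shd (enc x)" shows "ptime f"
proof (rule ptimeI)
  show "computes [] (Hd (Var 0)) f"
    by (rule computesI, unfold assms, rule runs_Hd[OF runs_Var0], rule poly_bounded_const)
  have "nodes (shd s) \<le> nodes s" for s by (cases s) auto
  then show "poly_bounded (\<lambda>x. size_of (f x))"
    by (intro poly_bounded_mono[OF poly_bounded_size]) (simp add: assms)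
qed

lemma ptime_tl_sexp:
  assumes "\<And>x. enc (f x) = stl (enc x)" shows "ptime f"
proof (rule ptimeI)
  show "computes [] (Tl (Var 0)) f"
    by (rule computesI, unfold assms, rule runs_Tl[OF runs_Var0], rule poly_bounded_const)
  have "nodes (stl s) \<le> nodes s" for s by (cases s) auto
  then show "poly_bounded (\<lambda>x. size_of (f x))"
    by (intro poly_bounded_mono[OF poly_bounded_size]) (simp add: assms)
qed

lemma ptime_fst: "ptime f \<Longrightarrow> ptime (\<lambda>x. fst (f x))"
  by (rule ptime_comp[OF ptime_hd_sexp]) (auto simp: enc_prod_def)

lemma ptime_snd: "ptime f \<Longrightarrow> ptime (\<lambda>x. snd (f x))"
  by (rule ptime_comp[OF ptime_tl_sexp]) (auto simp: enc_prod_def)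

lemma ptime_tl: 
  assumes "ptime f" shows "ptime (\<lambda>x. tl (f x))"
  by (rule ptime_comp[OF ptime_tl_sexp assms]) (auto simp: tl_def split: list.split)

lemma ptime_if:
  assumes "ptime b" "ptime f" "ptime g" shows "ptime (\<lambda>x. if b x then f x else g x)"
proof -
  obtain P p q r where P: "computes P p b" "computes P q f" "computes P r g"
    using ptime_link3[OF assms] by blast
  obtain R where R: "poly_bounded R" "\<And>x. runs P [enc x] p (enc (b x)) (R x)"
    using computesE[OF P(1)] by blast
  obtain S where S: "poly_bounded S" "\<And>x. runs P [enc x] q (enc (f x)) (S x)"
    using computesE[OF P(2)] by blast
  obtain T where T: "poly_bounded T" "\<And>x. runs P [enc x] r (enc (g x)) (T x)"
    using computesE[OF P(3)] by blast
  have "computes P (If_e p q r) (\<lambda>x. if b x then f x else g x)"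
  proof (rule computesI)
    show "poly_bounded (\<lambda>x. 1 + R x + (S x + T x))"
      by (intro poly_bounded_intros R S T)
    show "runs P [enc x] (If_e p q r) (enc (if b x then f x else g x)) (1 + R x + (S x + T x))" for x
    proof (cases "b x")
      case True
      then have "runs P [enc x] (If_e p q r) (enc (f x)) (1 + R x + S x)"
        by (intro runs_If_true[OF R(2) _ S(2)]) simp
      then show ?thesis using True by (auto elim: runs_mono)
    next
      case False
      then have "runs P [enc x] (If_e p q r) (enc (g x)) (1 + R x + T x)"
        using R(2)[of x] by (intro runs_If_false[OF _ T(2)]) simp
      then show ?thesis using False by (auto elim: runs_mono)
    qed
  qed
  moreover have "poly_bounded (\<lambda>x. size_of (if b x then f x else g x))"
    by (rule poly_bounded_mono[OF poly_bounded_add[OF ptime_size[OF assms(2)] ptime_size[OF assms(3)]]]) simp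
  ultimately show ?thesis by (rule ptimeI)
qed

lemma ptime_case_list:
  assumes "ptime l" "ptime f" "ptime (\<lambda>z. g (fst z) (fst (snd z)) (snd (snd z)))"
  shows "ptime (\<lambda>x. case l x of [] \<Rightarrow> f x | y # ys \<Rightarrow> g x y ys)"
proof -
  obtain P p q r where P: "computes P p l" "computes P q f"
      "computes P r (\<lambda>z. g (fst z) (fst (snd z)) (snd (snd z)))"
    using ptime_link3[OF assms] by blast
  obtain R where R: "poly_bounded R" "\<And>x. runs P [enc x] p (enc (l x)) (R x)"
    using computesE[OF P(1)] by blast
  obtain S where S: "poly_bounded S" "\<And>x. runs P [enc x] q (enc (f x)) (S x)"
    using computesE[OF P(2)] by blast
  obtain T where T: "poly_bounded T"
      "\<And>z. runs P [enc z] r (enc (g (fst z) (fst (snd z)) (snd (snd z)))) (T z)"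
    using computesE[OF P(3)] by blast
  obtain c k where ck: "\<And>z. T z \<le> c * size_of z ^ k"
    using T(1) unfolding poly_bounded_def by blast
  obtain c' k' where ck': "\<And>z. size_of (g (fst z) (fst (snd z)) (snd (snd z))) \<le> c' * size_of z ^ k'"
    using ptime_size[OF assms(3)] unfolding poly_bounded_def by blast
  \<comment> \<open>A nonempty list is encoded like the pair of its head and tail, so consing
    \<open>enc x\<close> onto \<open>enc (l x)\<close> already yields the encoding of
    \<open>(x, y, ys)\<close>. The price is that \<open>p\<close> is evaluated twice.\<close>
  let ?e = "If_e p (Let_e (Cons_e (Var 0) p) r) q"
  let ?B = "\<lambda>x. c * (1 + size_of x + size_of (l x)) ^ k"
  have "computes P ?e (\<lambda>x. case l x of [] \<Rightarrow> f x | y # ys \<Rightarrow> g x y ys)"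
  proof (rule computesI)
    show "poly_bounded (\<lambda>x. 1 + R x + (S x + (1 + (1 + 1 + R x) + ?B x)))"
      by (intro poly_bounded_intros R S ptime_size assms)
    show "runs P [enc x] ?e (enc (case l x of [] \<Rightarrow> f x | y # ys \<Rightarrow> g x y ys))
            (1 + R x + (S x + (1 + (1 + 1 + R x) + ?B x)))" for x
    proof (cases "l x")
      case Nil
      then have "runs P [enc x] ?e (enc (f x)) (1 + R x + S x)"
        using R(2)[of x] by (intro runs_If_false[OF _ S(2)]) simp
      then show ?thesis using Nil by (auto elim: runs_mono)
    next
      case (Cons y ys)
      have "runs P ([enc (x, y, ys)] @ [enc x]) r (enc (g x y ys)) (T (x, y, ys))"
        using runs_append_env[OF T(2)[of "(x, y, ys)"]] by simp
      then have "runs P ([enc (x, y, ys)] @ [enc x]) r (enc (g x y ys)) (?B x)"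
        by (rule runs_mono) (use ck[of "(x, y, ys)"] Cons in simp)
      then have "runs P [enc x] (Let_e (Cons_e (Var 0) p) r) (enc (g x y ys)) (1 + (1 + 1 + R x) + ?B x)"
        using R(2)[of x] Cons by (intro runs_Let[OF runs_Cons[OF runs_Var0]]) auto
      then have "runs P [enc x] ?e (enc (g x y ys)) (1 + R x + (1 + (1 + 1 + R x) + ?B x))"
        using Cons by (intro runs_If_true[OF R(2)]) auto
      then show ?thesis by (rule runs_mono[where v = "enc (g x y ys)", of P "[enc x]", THEN back_subst[of "\<lambda>v. runs P [enc x] ?e v _"]])
          (auto simp: Cons)
    qed
  qed
  moreover have "poly_bounded (\<lambda>x. size_of (case l x of [] \<Rightarrow> f x | y # ys \<Rightarrow> g x y ys))"
  proof (rule poly_bounded_mono)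
    show "poly_bounded (\<lambda>x. size_of (f x) + c' * (1 + size_of x + size_of (l x)) ^ k')"
      by (intro poly_bounded_intros ptime_size assms)
    show "size_of (case l x of [] \<Rightarrow> f x | y # ys \<Rightarrow> g x y ys) \<le>
        size_of (f x) + c' * (1 + size_of x + size_of (l x)) ^ k'" for x
    proof (cases "l x")
      case (Cons y ys)
      then show ?thesis using ck'[of "(x, y, ys)"] by (simp add: le_add2 trans_le_add2)
    qed simp
  qed
  ultimately show ?thesis by (rule ptimeI)
qed

text \<open>A polynomial step could still double the accumulator every time. The bound
  \<open>B\<close> on the accumulator after each prefix excludes this and gives all iterations a
  common polynomial cost.\<close>

lemma ptime_foldl:
  assumes "ptime i" "ptime l" "ptime (\<lambda>z. g (fst z) (fst (snd z)) (snd (snd z)))"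
    and "poly_bounded B"
    and B: "\<And>x n. n \<le> length (l x) \<Longrightarrow> size_of (foldl (g x) (i x) (take n (l x))) \<le> B x"
  shows "ptime (\<lambda>x. foldl (g x) (i x) (l x))"
proof -
  obtain P p q r where P: "computes P p i" "computes P q l"
      "computes P r (\<lambda>z. g (fst z) (fst (snd z)) (snd (snd z)))"
    using ptime_link3[OF assms(1-3)] by blast
  let ?n = "length P"
  \<comment> \<open>\<open>Var 0\<close> is the context \<open>x\<close>, \<open>Var 1\<close> the accumulator and \<open>Var 2\<close> the rest of the list.\<close>
  define body where "body = If_e (Var 2) (Call ?n [Var 0,
     Let_e (Cons_e (Var 0) (Cons_e (Var 1) (Hd (Var 2)))) r, Tl (Var 2)]) (Var 1)"
  define Q where "Q = P @ [body]"
  have Q: "computes Q p i" "computes Q q l"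
      "computes Q r (\<lambda>z. g (fst z) (fst (snd z)) (snd (snd z)))"
    unfolding Q_def using P by (auto intro: computes_append)
  obtain R where R: "poly_bounded R" "\<And>x. runs Q [enc x] p (enc (i x)) (R x)"
    using computesE[OF Q(1)] by blast
  obtain S where S: "poly_bounded S" "\<And>x. runs Q [enc x] q (enc (l x)) (S x)"
    using computesE[OF Q(2)] by blast
  obtain T where T: "poly_bounded T"
      "\<And>z. runs Q [enc z] r (enc (g (fst z) (fst (snd z)) (snd (snd z)))) (T z)"
    using computesE[OF Q(3)] by blast
  obtain c k where ck: "\<And>z. T z \<le> c * size_of z ^ k"
    using T(1) unfolding poly_bounded_def by blast
  \<comment> \<open>The power bounds the cost of \<open>g\<close> on the triple of context,
    accumulator and list element, whose two pair nodes account for the 2; the 20 generously covers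
    the fixed steps of one iteration.\<close>
  define W where "W x = c * (2 + size_of x + B x + size_of (l x)) ^ k + 20" for x
  have W: "poly_bounded W"
    unfolding W_def by (intro poly_bounded_intros assms(4) ptime_size assms(2))
  have nth: "Q ! ?n = body" and n: "?n < length Q"
    unfolding Q_def by auto
  have step: "runs Q [enc x, enc a, enc ys] body (enc (foldl (g x) a ys)) (W x * (1 + length ys))"
    if "\<And>m. m \<le> length ys \<Longrightarrow> size_of (foldl (g x) a (take m ys)) \<le> B x" "size_of ys \<le> size_of (l x)"
    for x a ys
    using that
  proof (induction ys arbitrary: a)
    case Nil
    let ?env = "[enc x, enc a, SNil]"
    have "runs Q ?env body (enc a) (1 + 1 + 1)"
      unfolding body_def
      using runs_Var[of 2 ?env Q] runs_Var[of 1 ?env Q]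
      by (intro runs_If_false) (simp_all add: numeral_2_eq_2)
    then show ?case by (simp, rule runs_mono) (simp add: W_def)
  next
    case (Cons y ys)
    let ?env = "[enc x, enc a, enc (y # ys)]"
    have v: "runs Q ?env (Var 0) (enc x) 1" "runs Q ?env (Var 1) (enc a) 1"
        "runs Q ?env (Var 2) (enc (y # ys)) 1"
      using runs_Var[of 0 ?env Q] runs_Var[of 1 ?env Q] runs_Var[of 2 ?env Q]
      by (simp_all add: numeral_2_eq_2)
    have a: "size_of a \<le> B x" using Cons.prems(1)[of 0] by simp
    have "runs Q [enc (x, a, y)] r (enc (g x a y)) (T (x, a, y))"
      using T(2)[of "(x, a, y)"] by simp
    then have "runs Q [enc (x, a, y)] r (enc (g x a y)) (c * (2 + size_of x + B x + size_of (l x)) ^ k)"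
    proof (rule runs_mono)
      have "size_of (x, a, y) \<le> 2 + size_of x + B x + size_of (l x)"
        using a Cons.prems(2) by simp
      then show "T (x, a, y) \<le> c * (2 + size_of x + B x + size_of (l x)) ^ k"
        by (intro order_trans[OF ck] mult_left_mono power_mono) auto
    qed
    note ry = runs_append_env[OF this, of ?env]
    have "runs Q ?env (Hd (Var 2)) (enc y) (1 + 1)"
      using runs_Hd[OF v(3)] by (simp only: enc_list_Cons shd.simps)
    then have arg: "runs Q ?env (Cons_e (Var 0) (Cons_e (Var 1) (Hd (Var 2)))) (enc (x, a, y))
        (1 + 1 + (1 + 1 + (1 + 1)))"
      unfolding enc_Pair by (intro runs_Cons v)
    have r: "runs Q ?env (Let_e (Cons_e (Var 0) (Cons_e (Var 1) (Hd (Var 2)))) r) (enc (g x a y))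
        (1 + (1 + 1 + (1 + 1 + (1 + 1))) + c * (2 + size_of x + B x + size_of (l x)) ^ k)"
      using runs_Let[OF arg] ry by simp
    have IH: "runs Q [enc x, enc (g x a y), enc ys] (Q ! ?n) (enc (foldl (g x) (g x a y) ys))
        (W x * (1 + length ys))"
      unfolding nth using Cons.prems(1)[of "Suc _"] Cons.prems(2) by (intro Cons.IH) auto
    have "runs Q ?env body (enc (foldl (g x) a (y # ys))) (1 + 1 +
        (1 + 1 + (1 + (1 + 1 + (1 + 1 + (1 + 1))) + c * (2 + size_of x + B x + size_of (l x)) ^ k) +
         (1 + 1) + W x * (1 + length ys)))"
      unfolding body_def using runs_Tl[OF v(3)] IH
      by (intro runs_If_true[OF v(3)] runs_Call3[OF n v(1) r]) auto
    then show ?case by (rule runs_mono) (simp add: W_def)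
  qed
  have "computes Q (Call ?n [Var 0, p, q]) (\<lambda>x. foldl (g x) (i x) (l x))"
  proof (rule computesI)
    show "poly_bounded (\<lambda>x. 1 + 1 + R x + S x + W x * (1 + size_of (l x)))"
      by (intro poly_bounded_intros R S W ptime_size assms)
    fix x
    have "runs Q [enc x] (Call ?n [Var 0, p, q]) (enc (foldl (g x) (i x) (l x)))
        (1 + 1 + R x + S x + W x * (1 + length (l x)))"
      using step[of "l x" x "i x"] B[of _ x]
      by (intro runs_Call3[OF n runs_Var0 R(2) S(2)]) (simp add: nth)
    then show "runs Q [enc x] (Call ?n [Var 0, p, q]) (enc (foldl (g x) (i x) (l x)))
        (1 + 1 + R x + S x + W x * (1 + size_of (l x)))"
      by (rule runs_mono) (use length_less_size_of[of "l x"] in simp)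
  qed
  moreover have "poly_bounded (\<lambda>x. size_of (foldl (g x) (i x) (l x)))"
  proof (rule poly_bounded_mono[OF assms(4)])
    show "size_of (foldl (g x) (i x) (l x)) \<le> B x" for x
      using B[of "length (l x)" x] by simp
  qed
  ultimately show ?thesis by (rule ptimeI)
qed


subsection \<open>Lists and numbers\<close>

lemma ptime_Nil_iff: "ptime l \<Longrightarrow> ptime (\<lambda>x. l x = [])"
  by (rule ptime_recode[OF _ ptime_case_list[of l "\<lambda>x. True" "\<lambda>x y ys. False"]])
     (auto split: list.split intro: ptime_const)

lemma ptime_not: "ptime b \<Longrightarrow> ptime (\<lambda>x. \<not> b x)"
  by (rule ptime_recode[OF _ ptime_if[of b "\<lambda>x. False" "\<lambda>x. True"]]) (auto intro: ptime_const)

lemma ptime_conj: "ptime b \<Longrightarrow> ptime c \<Longrightarrow> ptime (\<lambda>x. b x \<and> c x)"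
  by (rule ptime_recode[OF _ ptime_if[of b c "\<lambda>x. False"]]) (auto intro: ptime_const)

lemma ptime_disj: "ptime b \<Longrightarrow> ptime c \<Longrightarrow> ptime (\<lambda>x. b x \<or> c x)"
  by (rule ptime_recode[OF _ ptime_if[of b "\<lambda>x. True" c]]) (auto intro: ptime_const)

lemma ptime_rev:
  assumes "ptime l" shows "ptime (\<lambda>x. rev (l x))"
proof -
  have *: "foldl (\<lambda>a e. e # a) a ys = rev ys @ a" for a ys :: "'b list"
    by (induction ys arbitrary: a) auto
  have s: "size_of (rev ys) = size_of ys" for ys :: "'b list"
  proof -
    have "size_of (ys @ [y]) = size_of ys + 1 + size_of y" for y and ys :: "'b list"
      by (induction ys) auto
    then show ?thesis by (induction ys) auto
  qed
  have t: "size_of (take n ys) \<le> size_of ys" for n and ys :: "'b list"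
    by (induction ys arbitrary: n) (auto simp: take_Cons split: nat.splits)
  have "ptime (\<lambda>x. foldl (\<lambda>a e. e # a) [] (l x))"
    by (rule ptime_foldl[where B = "\<lambda>x. size_of (l x)"])
       (auto simp: * s t intro!: assms ptime_const ptime_Cons ptime_fst ptime_snd ptime_id ptime_size)
  then show ?thesis by (simp add: *)
qed

lemma ptime_map:
  assumes "ptime l" "ptime (\<lambda>z. g (fst z) (snd z))"
  shows "ptime (\<lambda>x. map (g x) (l x))"
proof -
  have *: "foldl (\<lambda>a e. g x e # a) a ys = rev (map (g x) ys) @ a" for x a ys
    by (induction ys arbitrary: a) auto
  obtain c k where ck: "\<And>z. size_of (g (fst z) (snd z)) \<le> c * size_of z ^ k"
    using ptime_size[OF assms(2)] unfolding poly_bounded_def by blast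
  let ?b = "\<lambda>x. c * (1 + size_of x + size_of (l x)) ^ k"
  have "ptime (\<lambda>x. foldl (\<lambda>a e. g x e # a) [] (l x))"
  proof (rule ptime_foldl[where B = "\<lambda>x. 1 + size_of (l x) * (1 + ?b x)"])
    show "ptime (\<lambda>z. g (fst z) (snd (snd z)) # fst (snd z))"
      by (intro ptime_comp2[OF assms(2)] ptime_Cons ptime_fst ptime_snd ptime_id)
    show "poly_bounded (\<lambda>x. 1 + size_of (l x) * (1 + ?b x))"
      by (intro poly_bounded_intros ptime_size assms)
    fix x n
    let ?ys = "foldl (\<lambda>a e. g x e # a) [] (take n (l x))"
    have "size_of y \<le> ?b x" if y: "y \<in> set ?ys" for y
    proof -
      obtain e where e: "e \<in> set (l x)" "y = g x e"
        using y by (auto simp: * dest: in_set_takeD)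
      have "size_of (x, e) \<le> 1 + size_of x + size_of (l x)"
        using size_of_mem[OF e(1)] by simp
      then have "c * size_of (x, e) ^ k \<le> ?b x"
        by (intro mult_left_mono power_mono) auto
      moreover have "size_of y \<le> c * size_of (x, e) ^ k"
        using ck[of "(x, e)"] e(2) by (simp only: fst_conv snd_conv)
      ultimately show ?thesis by (rule order_trans[rotated])
    qed
    then have "size_of ?ys \<le> 1 + length ?ys * (1 + ?b x)"
      by (rule size_of_list_le)
    also have "\<dots> \<le> 1 + size_of (l x) * (1 + ?b x)"
      using length_less_size_of[of "l x"] by (intro add_mono mult_right_mono) (auto simp: *)
    finally show "size_of ?ys \<le> 1 + size_of (l x) * (1 + ?b x)" .
  qed (auto intro: assms ptime_const)
  from ptime_rev[OF this] show ?thesis by (simp add: *)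
qed

lemma ptime_filter:
  assumes "ptime l" "ptime (\<lambda>z. Q (fst z) (snd z))"
  shows "ptime (\<lambda>x. filter (Q x) (l x))"
proof -
  have *: "foldl (\<lambda>a e. if Q x e then e # a else a) a ys = rev (filter (Q x) ys) @ a" for x a ys
    by (induction ys arbitrary: a) auto
  have "ptime (\<lambda>x. foldl (\<lambda>a e. if Q x e then e # a else a) [] (l x))"
  proof (rule ptime_foldl[where B = "\<lambda>x. 1 + size_of (l x) * (1 + size_of (l x))"])
    show "ptime (\<lambda>z. if Q (fst z) (snd (snd z)) then snd (snd z) # fst (snd z) else fst (snd z))"
      by (intro ptime_comp2[OF assms(2)] ptime_if ptime_Cons ptime_fst ptime_snd ptime_id)
    show "poly_bounded (\<lambda>x. 1 + size_of (l x) * (1 + size_of (l x)))"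
      by (intro poly_bounded_intros ptime_size assms)
    fix x n
    let ?ys = "foldl (\<lambda>a e. if Q x e then e # a else a) [] (take n (l x))"
    have "size_of y \<le> size_of (l x)" if y: "y \<in> set ?ys" for y
      using y size_of_mem[of y "l x"] by (auto simp: * dest: in_set_takeD)
    then have "size_of ?ys \<le> 1 + length ?ys * (1 + size_of (l x))"
      by (rule size_of_list_le)
    also have "\<dots> \<le> 1 + size_of (l x) * (1 + size_of (l x))"
    proof (intro add_mono mult_right_mono)
      show "length ?ys \<le> size_of (l x)"
        using length_filter_le[of "Q x" "take n (l x)"] length_less_size_of[of "l x"] by (simp add: *)
    qed simp_all
    finally show "size_of ?ys \<le> 1 + size_of (l x) * (1 + size_of (l x))" .
  qed (auto intro: assms ptime_const)
  from ptime_rev[OF this] show ?thesis by (simp add: *)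
qed

lemma ptime_append:
  assumes "ptime f" "ptime g" shows "ptime (\<lambda>x. f x @ g x)"
proof -
  have *: "foldl (\<lambda>a e. e # a) a ys = rev ys @ a" for a ys :: "'b list"
    by (induction ys arbitrary: a) auto
  have s: "size_of (rev (take n (rev ys)) @ zs) \<le> size_of ys + size_of zs" for n and ys zs :: "'b list"
    using size_of_append[of "rev (take n (rev ys))" zs] size_of_drop[of "length ys - n" ys]
    by (simp add: take_rev)
  have "ptime (\<lambda>x. foldl (\<lambda>a e. e # a) (g x) (rev (f x)))"
    by (rule ptime_foldl[where B = "\<lambda>x. size_of (f x) + size_of (g x)"])
       (auto simp: * s intro!: assms ptime_rev ptime_Cons ptime_fst ptime_snd ptime_id ptime_size
          poly_bounded_add)
  then show ?thesis by (simp add: *)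
qed

lemma ptime_concat:
  assumes "ptime l" shows "ptime (\<lambda>x. concat (l x))"
proof -
  have *: "foldl (\<lambda>a e. a @ e) a ys = a @ concat ys" for a :: "'b list" and ys
    by (induction ys arbitrary: a) auto
  have t: "size_of (concat (take n ys)) \<le> size_of ys" for n and ys :: "'b list list"
  proof (induction ys arbitrary: n)
    case (Cons y ys)
    show ?case
    proof (cases n)
      case (Suc m)
      then show ?thesis using Cons.IH[of m] size_of_append[of y "concat (take m ys)"] by simp
    qed simp
  qed simp
  have "ptime (\<lambda>x. foldl (\<lambda>a e. a @ e) [] (l x))"
    by (rule ptime_foldl[where B = "\<lambda>x. size_of (l x)"])
       (auto simp: * t intro!: assms ptime_const ptime_append ptime_fst ptime_snd ptime_id ptime_size)
  then show ?thesis by (simp add: *)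
qed

lemma ptime_bex:
  assumes "ptime l" "ptime (\<lambda>z. Q (fst z) (snd z))"
  shows "ptime (\<lambda>x. \<exists>e\<in>set (l x). Q x e)"
  by (rule ptime_recode[OF _ ptime_not[OF ptime_Nil_iff[OF ptime_filter[OF assms]]]])
     (simp add: filter_empty_conv)

lemma ptime_ball:
  assumes "ptime l" "ptime (\<lambda>z. Q (fst z) (snd z))"
  shows "ptime (\<lambda>x. \<forall>e\<in>set (l x). Q x e)"
  using ptime_not[OF ptime_bex[OF assms(1) ptime_not[OF assms(2)]]] by simp

lemma ptime_length: "ptime l \<Longrightarrow> ptime (\<lambda>x. length (l x))"
  by (rule ptime_recode[OF _ ptime_map[of l "\<lambda>x e. ()"]])
     (auto simp: enc_nat_def map_replicate_const intro: ptime_const)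

lemma ptime_replicate_unit: "ptime n \<Longrightarrow> ptime (\<lambda>x. replicate (n x) ())"
  by (rule ptime_recode[of _ n]) (auto simp: enc_nat_def)

text \<open>A unary counter is a list of units, so a counted loop is a fold that ignores the list
  elements.\<close>

lemma ptime_funpow:
  fixes i :: "'a::encodable \<Rightarrow> 'b::encodable" and g :: "'a \<Rightarrow> 'b \<Rightarrow> 'b"
  assumes "ptime n" "ptime i" "ptime (\<lambda>z. g (fst z) (snd z))" "poly_bounded B"
    and B: "\<And>x m. m \<le> n x \<Longrightarrow> size_of ((g x ^^ m) (i x)) \<le> B x"
  shows "ptime (\<lambda>x. (g x ^^ n x) (i x))"
proof -
  have *: "foldl (\<lambda>a _. f a) a (replicate m ()) = (f ^^ m) a" for f :: "'b \<Rightarrow> 'b" and a m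
    by (induction m arbitrary: a) (auto simp: funpow_swap1)
  have "ptime (\<lambda>x. foldl (\<lambda>a _. g x a) (i x) (replicate (n x) ()))"
    by (rule ptime_foldl[where B = B])
       (auto simp: * B intro!: ptime_replicate_unit assms ptime_comp2[OF assms(3)] ptime_fst ptime_snd ptime_id)
  then show ?thesis by (simp add: *)
qed

lemma ptime_Suc: "ptime n \<Longrightarrow> ptime (\<lambda>x. Suc (n x))"
  by (rule ptime_recode[OF _ ptime_Cons[of "\<lambda>x. ()" "\<lambda>x. replicate (n x) ()"]])
     (auto simp: enc_nat_def intro: ptime_const ptime_replicate_unit)

text \<open>In unary, subtraction removes list cells, and \<open>tl [] = []\<close> matches its
  truncation at 0. Comparison of numbers is then a test for 0.\<close>

lemma ptime_diff:
  assumes "ptime m" "ptime n" shows "ptime (\<lambda>x. m x - n x :: nat)"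
proof -
  have *: "((\<lambda>l. tl l) ^^ n) (replicate m ()) = replicate (m - n) ()" for m n :: nat
    by (induction n) auto
  have "ptime (\<lambda>x. ((\<lambda>l. tl l) ^^ n x) (replicate (m x) ()))"
    by (rule ptime_funpow[where B = "\<lambda>x. size_of (m x)"])
       (auto simp: * enc_nat_def[symmetric] simp del: size_of_nat
         intro!: assms ptime_replicate_unit ptime_tl ptime_fst ptime_snd ptime_id ptime_size, auto)
  then show ?thesis by (rule ptime_recode[rotated]) (simp add: * enc_nat_def)
qed

lemma ptime_add: "ptime m \<Longrightarrow> ptime n \<Longrightarrow> ptime (\<lambda>x. m x + n x :: nat)"
  by (rule ptime_recode[OF _ ptime_append[of "\<lambda>x. replicate (m x) ()" "\<lambda>x. replicate (n x) ()"]])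
     (auto simp: enc_nat_def replicate_add intro: ptime_replicate_unit)

lemma ptime_eq_0: "ptime n \<Longrightarrow> ptime (\<lambda>x. n x = (0 :: nat))"
  by (rule ptime_recode[OF _ ptime_Nil_iff[OF ptime_replicate_unit[of n]]]) simp_all

lemma ptime_le: "ptime m \<Longrightarrow> ptime n \<Longrightarrow> ptime (\<lambda>x. m x \<le> (n x :: nat))"
  using ptime_eq_0[OF ptime_diff[of m n]] by simp

lemma ptime_eq_nat: "ptime m \<Longrightarrow> ptime n \<Longrightarrow> ptime (\<lambda>x. m x = (n x :: nat))"
  using ptime_conj[OF ptime_le[of m n] ptime_le[of n m]] by (simp add: eq_iff)

lemma ptime_upt:
  assumes "ptime n" shows "ptime (\<lambda>x. [0..<n x])"
proof -
  let ?g = "\<lambda>l. length l # l"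
  have *: "(?g ^^ m) [] = rev [0..<m]" for m :: nat
    by (induction m) auto
  have "ptime (\<lambda>x. (?g ^^ n x) [])"
  proof (rule ptime_funpow[where B = "\<lambda>x. 1 + size_of (n x) * (1 + size_of (n x))"])
    show "poly_bounded (\<lambda>x. 1 + size_of (n x) * (1 + size_of (n x)))"
      by (intro poly_bounded_intros ptime_size assms)
    fix x m assume m: "m \<le> n x"
    have "size_of (rev [0..<m]) \<le> 1 + length (rev [0..<m]) * (1 + size_of (n x))"
      using m by (intro size_of_list_le) auto
    also have "\<dots> \<le> 1 + size_of (n x) * (1 + size_of (n x))"
      using m by (intro add_mono mult_right_mono) auto
    finally show "size_of ((?g ^^ m) []) \<le> 1 + size_of (n x) * (1 + size_of (n x))"
      by (simp only: *)
  qed (intro assms ptime_const ptime_Cons ptime_length ptime_snd ptime_id)+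
  then show ?thesis using ptime_rev[of "\<lambda>x. (?g ^^ n x) []"] by (simp add: *)
qed

lemma ptime_drop:
  assumes "ptime n" "ptime l" shows "ptime (\<lambda>x. drop (n x) (l x))"
proof -
  have *: "((\<lambda>l. tl l) ^^ n) ys = drop n ys" for n and ys :: "'b list"
    by (induction n) (auto simp: drop_Suc tl_drop)
  have "ptime (\<lambda>x. ((\<lambda>l. tl l) ^^ n x) (l x))"
    by (rule ptime_funpow[where B = "\<lambda>x. size_of (l x)"])
       (auto simp: * size_of_drop intro!: assms ptime_tl ptime_snd ptime_id ptime_size)
  then show ?thesis by (simp add: *)
qed

text \<open>A program must compute the function on every argument, but \<open>!\<close> has no
  specified value beyond the end of a list; a default makes the lookup computable.\<close>

lemma ptime_nth_default:
  assumes "ptime l" "ptime n" shows "ptime (\<lambda>x. nth_default d (l x) (n x))"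
proof -
  have *: "(case drop n ys of [] \<Rightarrow> d | y # _ \<Rightarrow> y) = nth_default d ys n" for n ys
    by (auto simp: nth_default_def split: list.split)
       (metis Cons_nth_drop_Suc list.inject)
  have "ptime (\<lambda>x. case drop (n x) (l x) of [] \<Rightarrow> d | y # _ \<Rightarrow> y)"
    by (intro ptime_case_list ptime_drop assms ptime_const ptime_fst ptime_snd ptime_id)
  then show ?thesis by (simp add: *)
qed

lemmas ptime_intros =
  ptime_id ptime_const ptime_Pair ptime_fst ptime_snd ptime_Cons ptime_if ptime_case_list
  ptime_not ptime_conj ptime_disj ptime_Nil_iff ptime_rev ptime_map ptime_filter ptime_append
  ptime_concat ptime_bex ptime_ball ptime_length ptime_Suc ptime_diff ptime_add ptime_eq_0
  ptime_le ptime_eq_nat ptime_upt ptime_nth_default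


subsection \<open>Exhaustive search over guesses\<close>

definition ternary_strings :: "nat \<Rightarrow> nat list set" where
  "ternary_strings n = {w. length w = n \<and> set w \<subseteq> {0, 1, 2}}"

text \<open>The last symbol is split off because the search pushes each new symbol onto the front of
  the guess: the symbols \<open>u\<close> still open precede the symbols \<open>w\<close> already
  chosen.\<close>

lemma ternary_strings_append_Suc:
  "(\<exists>u\<in>ternary_strings (Suc n). Q u) \<longleftrightarrow>
     (\<exists>u\<in>ternary_strings n. Q (u @ [0]) \<or> Q (u @ [1]) \<or> Q (u @ [2]))" (is "?L \<longleftrightarrow> ?R")
proof
  assume ?L
  then obtain u where u: "length u = Suc n" "set u \<subseteq> {0, 1, 2}" "Q u"
    unfolding ternary_strings_def by blast
  then obtain v b where "u = v @ [b]" by (cases u rule: rev_cases) auto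
  with u show ?R unfolding ternary_strings_def by auto
next
  assume ?R
  then obtain u b where u: "u \<in> ternary_strings n" "b \<in> {0, 1, 2}" "Q (u @ [b])" by blast
  then have "u @ [b] \<in> ternary_strings (Suc n)" unfolding ternary_strings_def by auto
  with u(3) show ?L by blast
qed

text \<open>A depth-first search with three calls per node has only \<open>3 ^ n x\<close> leaves.
  With base 6 half of the budget remains at each node, so that its overhead is absorbed in the
  induction instead of being summed over the tree.\<close>

lemma exhaustive_search:
  fixes n :: "'a::encodable \<Rightarrow> nat" and Q :: "'a \<Rightarrow> nat list \<Rightarrow> bool"
  assumes "ptime n" "ptime (\<lambda>z. Q (fst z) (snd z))"
  shows "\<exists>P c k. \<forall>x. outputs_within P (enc x) (enc (\<exists>u\<in>ternary_strings (n x). Q x u))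
           (c * 6 ^ n x * size_of x ^ k)"
proof -
  obtain P p r where P: "computes P p n" "computes P r (\<lambda>z. Q (fst z) (snd z))"
    using ptime_link2[OF assms] by blast
  let ?n = "length P"
  let ?call = "\<lambda>s. Call ?n [Var 0, Cons_e (quote_expr s) (Var 1), Tl (Var 2)]"
  \<comment> \<open>\<open>Var 1\<close> is the guess made so far and \<open>Var 2\<close> the number of symbols still to be guessed.\<close>
  define body where "body = If_e (Var 2)
     (If_e (?call (enc (0::nat))) (quote_expr (enc True))
       (If_e (?call (enc (1::nat))) (quote_expr (enc True)) (?call (enc (2::nat)))))
     (Let_e (Cons_e (Var 0) (Var 1)) r)"
  define main where "main = Call ?n [Var 0, Nil_e, p]"
  define R0 where "R0 = P @ [body]"
  have R0: "computes R0 p n" "computes R0 r (\<lambda>z. Q (fst z) (snd z))"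
    unfolding R0_def using P by (auto intro: computes_append)
  obtain S where S: "poly_bounded S" "\<And>x. runs R0 [enc x] p (enc (n x)) (S x)"
    using computesE[OF R0(1)] by blast
  obtain T where T: "poly_bounded T" "\<And>z. runs R0 [enc z] r (enc (Q (fst z) (snd z))) (T z)"
    using computesE[OF R0(2)] by blast
  obtain c k where ck: "\<And>z. T z \<le> c * size_of z ^ k"
    using T(1) unfolding poly_bounded_def by blast
  have nth: "R0 ! ?n = body" and n: "?n < length R0"
    unfolding R0_def by auto
  \<comment> \<open>A symbol is at most 2, hence of size at most 5, and takes one more list cell:
    this is the factor 6 in the size of a complete guess. The 60 pays for the overhead of a
    node.\<close>
  define W where "W x = c * (2 + size_of x + n x * 6) ^ k + 60" for x
  have "poly_bounded n"
    by (rule poly_bounded_mono[OF ptime_size[OF assms(1)]]) simp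
  then have W: "poly_bounded W"
    unfolding W_def by (intro poly_bounded_intros)
  have step: "runs R0 [enc x, enc w, enc m] body (enc (\<exists>u\<in>ternary_strings m. Q x (u @ w))) (W x * 6 ^ m)"
    if "m + length w = n x" "set w \<subseteq> {0, 1, 2}" for x w m
    using that
  proof (induction m arbitrary: w)
    case 0
    let ?env = "[enc x, enc w, SNil]"
    have v: "runs R0 ?env (Var 0) (enc x) 1" "runs R0 ?env (Var 1) (enc w) 1"
        "runs R0 ?env (Var 2) SNil 1"
      using runs_Var[of 0 ?env R0] runs_Var[of 1 ?env R0] runs_Var[of 2 ?env R0]
      by (simp_all add: numeral_2_eq_2)
    have "size_of w \<le> 1 + length w * (1 + 5)"
      using 0 by (intro size_of_list_le) auto
    then have "size_of (x, w) \<le> 2 + size_of x + n x * 6"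
      using 0 by simp
    then have "T (x, w) \<le> c * (2 + size_of x + n x * 6) ^ k"
      by (intro order_trans[OF ck] mult_left_mono power_mono) auto
    then have "runs R0 ([enc (x, w)] @ ?env) r (enc (Q x w)) (c * (2 + size_of x + n x * 6) ^ k)"
      using runs_mono[OF T(2)[of "(x, w)"]] by (intro runs_append_env) simp
    then have "runs R0 ?env (Let_e (Cons_e (Var 0) (Var 1)) r) (enc (Q x w))
        (1 + (1 + 1 + 1) + c * (2 + size_of x + n x * 6) ^ k)"
      using runs_Cons[OF v(1,2)] by (intro runs_Let[where u = "enc (x, w)"]) simp_all
    then have "runs R0 ?env body (enc (Q x w))
        (1 + 1 + (1 + (1 + 1 + 1) + c * (2 + size_of x + n x * 6) ^ k))"
      unfolding body_def by (intro runs_If_false[OF v(3)])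
    then have "runs R0 ?env body (enc (Q x w)) (W x)"
      by (rule runs_mono) (simp add: W_def)
    then show ?case by (simp add: ternary_strings_def)
  next
    case (Suc m)
    let ?env = "[enc x, enc w, enc (Suc m)]"
    let ?ex = "\<lambda>b. \<exists>u\<in>ternary_strings m. Q x (u @ b # w)"
    have v: "runs R0 ?env (Var 0) (enc x) 1" "runs R0 ?env (Var 1) (enc w) 1"
        "runs R0 ?env (Var 2) (enc (Suc m)) 1"
      using runs_Var[of 0 ?env R0] runs_Var[of 1 ?env R0] runs_Var[of 2 ?env R0]
      by (simp_all add: numeral_2_eq_2)
    \<comment> \<open>The 11 consists of at most 5 steps for quoting the symbol and six single
      steps.\<close>
    have call: "runs R0 ?env (?call (enc b)) (enc (?ex b)) (11 + W x * 6 ^ m)"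
      if b: "b \<in> {0, 1, 2}" for b :: nat
    proof -
      have "runs R0 [enc x, enc (b # w), enc m] (R0 ! ?n) (enc (?ex b)) (W x * 6 ^ m)"
        unfolding nth using Suc.prems b by (intro Suc.IH) auto
      then have "runs R0 ?env (?call (enc b)) (enc (?ex b))
         (1 + 1 + (1 + size_of b + 1) + (1 + 1) + W x * 6 ^ m)"
        using runs_Tl[OF v(3)] runs_Cons[OF runs_quote v(2), of "enc b"]
        by (intro runs_Call3[OF n v(1)]) auto
      then show ?thesis by (rule runs_mono) (use b in auto)
    qed
    have t: "runs R0 ?env (quote_expr (enc True)) (enc True) 3"
      by (rule runs_mono[OF runs_quote]) simp
    let ?V = "11 + W x * 6 ^ m"
    have If: "runs R0 ?env (If_e a (quote_expr (enc True)) b) (enc (A \<or> B)) (4 + X + Y)"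
      if "runs R0 ?env a (enc A) X" "runs R0 ?env b (enc B) Y" for a b A B X Y
    proof (cases A)
      case True
      then have "runs R0 ?env (If_e a (quote_expr (enc True)) b) (enc True) (1 + X + 3)"
        using that by (intro runs_If_true[OF _ _ t]) auto
      then show ?thesis using True by (auto elim: runs_mono)
    next
      case False
      then have "runs R0 ?env (If_e a (quote_expr (enc True)) b) (enc B) (1 + X + Y)"
        using that by (intro runs_If_false) auto
      then show ?thesis using False by (auto elim: runs_mono)
    qed
    have "runs R0 ?env body (enc (?ex 0 \<or> ?ex 1 \<or> ?ex 2)) (1 + 1 + (4 + ?V + (4 + ?V + ?V)))"
      unfolding body_def by (intro runs_If_true[OF v(3)] If call) auto
    then have "runs R0 ?env body (enc (?ex 0 \<or> ?ex 1 \<or> ?ex 2)) (W x * 6 ^ Suc m)"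
    proof (rule runs_mono)
      \<comment> \<open>A node costs \<open>43 + 3 * (W x * 6 ^ m)\<close>. As
        \<open>W x * 6 ^ m\<close> is at least 60, the 43 fits into the three remaining
        shares.\<close>
      have "60 * 1 \<le> W x * 6 ^ m" by (rule mult_mono) (auto simp: W_def)
      then show "1 + 1 + (4 + ?V + (4 + ?V + ?V)) \<le> W x * 6 ^ Suc m" by simp
    qed
    moreover have "(?ex 0 \<or> ?ex 1 \<or> ?ex 2) = (\<exists>u\<in>ternary_strings (Suc m). Q x (u @ w))"
      unfolding ternary_strings_append_Suc by auto
    ultimately show ?case by simp
  qed
  have main: "runs R0 [enc x] main (enc (\<exists>u\<in>ternary_strings (n x). Q x u)) ((3 + S x + W x) * 6 ^ n x)" for x
  proof -
    have "runs R0 [enc x] main (enc (\<exists>u\<in>ternary_strings (n x). Q x u)) (1 + 1 + 1 + S x + W x * 6 ^ n x)"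
      unfolding main_def using step[where w = "[]" and m = "n x" and x = x]
      by (intro runs_Call3[OF n runs_Var0 runs_Nil S(2)]) (simp add: nth)
    moreover have "(3 + S x) * 1 \<le> (3 + S x) * 6 ^ n x"
      by (intro mult_left_mono) auto
    ultimately show ?thesis by (auto elim: runs_mono simp: algebra_simps)
  qed
  \<comment> \<open>Execution enters at function 0, so \<open>main\<close> is put in front and all
    calls move up by one.\<close>
  let ?P = "[relocate 1 main] @ map (relocate (length [relocate 1 main])) R0"
  have out: "outputs_within ?P (enc x) (enc (\<exists>u\<in>ternary_strings (n x). Q x u))
      (2 + (3 + S x + W x) * 6 ^ n x)" for x
  proof -
    have "runs ?P [enc x] (relocate 1 main) (enc (\<exists>u\<in>ternary_strings (n x). Q x u)) ((3 + S x + W x) * 6 ^ n x)"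
      using main[of x] eval_relocate(1)[of R0 _ main _ _ "[relocate 1 main]"] unfolding runs_def by auto
    then have "runs ?P [enc x] (Call 0 [Var 0]) (enc (\<exists>u\<in>ternary_strings (n x). Q x u))
        (1 + 1 + (3 + S x + W x) * 6 ^ n x)"
      by (intro runs_Call1[OF _ runs_Var0]) simp_all
    then show ?thesis unfolding outputs_within_def runs_def by simp
  qed
  have "poly_bounded (\<lambda>x. 5 + S x + W x)"
    by (intro poly_bounded_intros S W)
  then obtain c k where ck: "\<And>x. 5 + S x + W x \<le> c * size_of x ^ k"
    unfolding poly_bounded_def by blast
  have "2 + (3 + S x + W x) * 6 ^ n x \<le> c * 6 ^ n x * size_of x ^ k" for x
  proof -
    have "2 + (3 + S x + W x) * 6 ^ n x \<le> 2 * 6 ^ n x + (3 + S x + W x) * 6 ^ n x" by simp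
    also have "\<dots> = (5 + S x + W x) * 6 ^ n x" by (simp add: algebra_simps)
    also have "\<dots> \<le> c * size_of x ^ k * 6 ^ n x" using ck by (rule mult_right_mono) simp
    finally show ?thesis by (simp add: mult_ac)
  qed
  then show ?thesis using out unfolding outputs_within_def by (meson order_trans)
qed

lemma ptime_outputs_within:
  assumes "ptime f"
  shows "\<exists>P c k. \<forall>x. outputs_within P (enc x) (enc (f x)) (c * size_of x ^ k)"
proof -
  obtain R0 main where R0: "computes R0 main f" using assms by (rule ptimeE)
  obtain S where S: "poly_bounded S" "\<And>x. runs R0 [enc x] main (enc (f x)) (S x)"
    using computesE[OF R0] by blast
  let ?P = "[relocate 1 main] @ map (relocate (length [relocate 1 main])) R0"
  have out: "outputs_within ?P (enc x) (enc (f x)) (2 + S x)" for x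
  proof -
    have "runs ?P [enc x] (relocate 1 main) (enc (f x)) (S x)"
      using S(2)[of x] eval_relocate(1)[of R0 _ main _ _ "[relocate 1 main]"] unfolding runs_def by auto
    then have "runs ?P [enc x] (Call 0 [Var 0]) (enc (f x)) (1 + 1 + S x)"
      by (intro runs_Call1[OF _ runs_Var0]) simp_all
    then show ?thesis unfolding outputs_within_def runs_def by simp
  qed
  have "poly_bounded (\<lambda>x. 2 + S x)"
    by (intro poly_bounded_intros S)
  then show ?thesis using out unfolding outputs_within_def poly_bounded_def by (meson order_trans)
qed


section \<open>Linear layouts of graphs\<close>

type_synonym edge = "nat \<times> nat"

definition joined :: "edge set \<Rightarrow> nat \<Rightarrow> nat \<Rightarrow> bool" where
  "joined S u v \<longleftrightarrow> (u, v) \<in> S \<or> (v, u) \<in> S"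

definition degree_le_2 :: "edge set \<Rightarrow> bool" where
  "degree_le_2 S \<longleftrightarrow> (\<forall>x a b c. joined S x a \<and> joined S x b \<and> joined S x c \<longrightarrow> a = b \<or> a = c \<or> b = c)"

text \<open>For a finite graph this says that it is a disjoint union of paths, placed side by side
  on a line. It is the form in which the consecutive ones property yields it: the two columns of an
  edge become neighbours. Loops are excluded, and integers leave room for mirroring.\<close>

definition linear_layout :: "edge set \<Rightarrow> bool" where
  "linear_layout S \<longleftrightarrow> (\<exists>p :: nat \<Rightarrow> int. inj p \<and> (\<forall>(u, v) \<in> S. \<bar>p u - p v\<bar> = 1))"

lemma joined_commute: "joined S u v \<longleftrightarrow> joined S v u"
  by (auto simp: joined_def)

lemma joined_mono: "joined S u v \<Longrightarrow> S \<subseteq> T \<Longrightarrow> joined T u v"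
  by (auto simp: joined_def)

lemma linear_layout_mono: "linear_layout T \<Longrightarrow> S \<subseteq> T \<Longrightarrow> linear_layout S"
  unfolding linear_layout_def by blast

text \<open>A neighbour of \<open>x\<close> can only be placed at \<open>p x - 1\<close> or
  \<open>p x + 1\<close>.\<close>

lemma linear_layout_degree_le_2:
  assumes "linear_layout S" shows "degree_le_2 S"
  unfolding degree_le_2_def
proof (intro allI impI)
  fix x a b c assume *: "joined S x a \<and> joined S x b \<and> joined S x c"
  obtain p :: "nat \<Rightarrow> int" where p: "inj p" "\<And>u v. (u, v) \<in> S \<Longrightarrow> \<bar>p u - p v\<bar> = 1"
    using assms unfolding linear_layout_def by blast
  have d: "\<bar>p x - p y\<bar> = 1" if "joined S x y" for y
    using that p(2)[of x y] p(2)[of y x] unfolding joined_def by linarith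
  have "p a = p b \<or> p a = p c \<or> p b = p c"
    using d[of a] d[of b] d[of c] * by linarith
  then show "a = b \<or> a = c \<or> b = c"
    using p(1) by (auto dest: injD)
qed

text \<open>
  A disjoint union of paths: \<open>lab\<close> names the path of a vertex and \<open>p\<close> its position on that path.
  Positions are only injective within a path, so that paths can be moved and reversed
  independently of each other.
\<close>

definition path_layout :: "edge set \<Rightarrow> (nat \<Rightarrow> nat) \<Rightarrow> (nat \<Rightarrow> int) \<Rightarrow> bool" where
  "path_layout S lab p \<longleftrightarrow> finite (range p) \<and>
     (\<forall>x y. lab x = lab y \<and> p x = p y \<longrightarrow> x = y) \<and>
     (\<forall>x y. lab x = lab y \<and> p x < p y \<longrightarrow>
        (\<exists>z. lab z = lab x \<and> p z = p x + 1 \<and> joined S x z) \<and>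
        (\<exists>z. lab z = lab x \<and> p z = p y - 1 \<and> joined S y z)) \<and>
     (\<forall>(x, y) \<in> S. lab x = lab y \<and> \<bar>p x - p y\<bar> = 1)"

lemma path_layoutD:
  assumes "path_layout S lab p"
  shows "finite (range p)"
    and "lab x = lab y \<Longrightarrow> p x = p y \<Longrightarrow> x = y"
    and "lab x = lab y \<Longrightarrow> p x < p y \<Longrightarrow> \<exists>z. lab z = lab x \<and> p z = p x + 1 \<and> joined S x z"
    and "lab x = lab y \<Longrightarrow> p x < p y \<Longrightarrow> \<exists>z. lab z = lab x \<and> p z = p y - 1 \<and> joined S y z"
    and "joined S x y \<Longrightarrow> lab x = lab y"
    and "joined S x y \<Longrightarrow> \<bar>p x - p y\<bar> = 1"
proof -
  note a = assms[unfolded path_layout_def]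
  have *: "lab x = lab y \<and> \<bar>p x - p y\<bar> = 1" if "(x, y) \<in> S" for x y
    using a[THEN conjunct2, THEN conjunct2, THEN conjunct2, rule_format, OF that] by simp
  show "finite (range p)"
    by (rule a[THEN conjunct1])
  show "x = y" if "lab x = lab y" "p x = p y"
    by (rule a[THEN conjunct2, THEN conjunct1, rule_format, OF conjI[OF that]])
  show "\<exists>z. lab z = lab x \<and> p z = p x + 1 \<and> joined S x z"
    "\<exists>z. lab z = lab x \<and> p z = p y - 1 \<and> joined S y z" if "lab x = lab y" "p x < p y"
    by (rule a[THEN conjunct2, THEN conjunct2, THEN conjunct1, THEN spec, THEN spec, THEN mp,
          OF conjI[OF that], THEN conjunct1] a[THEN conjunct2, THEN conjunct2, THEN conjunct1,
          THEN spec, THEN spec, THEN mp, OF conjI[OF that], THEN conjunct2])+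
  assume "joined S x y"
  then have "lab x = lab y \<and> \<bar>p x - p y\<bar> = 1"
    using *[of x y] *[of y x] unfolding joined_def by (metis abs_minus_commute)
  then show "lab x = lab y" "\<bar>p x - p y\<bar> = 1" by auto
qed

lemma path_layoutI:
  assumes "finite (range p)" "\<And>x y. lab x = lab y \<Longrightarrow> p x = p y \<Longrightarrow> x = y"
    "\<And>x y. lab x = lab y \<Longrightarrow> p x < p y \<Longrightarrow> \<exists>z. lab z = lab x \<and> p z = p x + 1 \<and> joined S x z"
    "\<And>x y. lab x = lab y \<Longrightarrow> p x < p y \<Longrightarrow> \<exists>z. lab z = lab x \<and> p z = p y - 1 \<and> joined S y z"
    "\<And>x y. joined S x y \<Longrightarrow> lab x = lab y \<and> \<bar>p x - p y\<bar> = 1"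
  shows "path_layout S lab p"
proof -
  have "case e of (x, y) \<Rightarrow> lab x = lab y \<and> \<bar>p x - p y\<bar> = 1" if "e \<in> S" for e
    using that assms(5)[of "fst e" "snd e"] by (cases e) (simp add: joined_def)
  moreover have "\<forall>x y. lab x = lab y \<and> p x = p y \<longrightarrow> x = y"
    by (intro allI impI, elim conjE, rule assms(2))
  moreover have "\<forall>x y. lab x = lab y \<and> p x < p y \<longrightarrow>
        (\<exists>z. lab z = lab x \<and> p z = p x + 1 \<and> joined S x z) \<and>
        (\<exists>z. lab z = lab x \<and> p z = p y - 1 \<and> joined S y z)"
    by (intro allI impI conjI; elim conjE; rule assms(3,4); assumption)
  ultimately show ?thesis
    unfolding path_layout_def using assms(1) by (intro conjI ballI)
qed

text \<open>Each path gets its own block of \<open>2 * B + 1\<close> integers, where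
  \<open>B\<close> bounds all positions. If two vertices coincided across blocks, a nonzero multiple
  of \<open>2 * B + 1\<close> would equal a difference of two positions, which is too small.\<close>

lemma path_layout_linear:
  assumes "path_layout S lab p" shows "linear_layout S"
proof -
  note D = path_layoutD[OF assms]
  obtain B where B: "\<And>x. \<bar>p x\<bar> \<le> B"
  proof -
    have "finite ((\<lambda>i. \<bar>i\<bar>) ` range p)" using D(1) by simp
    then have "\<bar>p x\<bar> \<le> Max ((\<lambda>i. \<bar>i\<bar>) ` range p)" for x by (intro Max_ge) auto
    then show ?thesis by (rule that)
  qed
  define q where "q x = (2 * B + 1) * int (lab x) + p x" for x
  have "inj q"
  proof (rule injI)
    fix x y assume eq: "q x = q y"
    have "(2 * B + 1) * (int (lab x) - int (lab y)) = p y - p x"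
      using eq by (simp add: q_def algebra_simps)
    moreover have "\<bar>p y - p x\<bar> < 2 * B + 1"
      using B[of x] B[of y] by linarith
    ultimately have "int (lab x) - int (lab y) = 0"
      using zdvd_not_zless[of "\<bar>p y - p x\<bar>" "2 * B + 1"]
      by (metis abs_ge_zero dvd_abs_iff dvd_triv_left abs_0_eq mult_eq_0_iff order_le_less not_less_iff_gr_or_eq)
    then show "x = y" using eq D(2)[of x y] by (simp add: q_def)
  qed
  moreover have "\<bar>q x - q y\<bar> = 1" if "(x, y) \<in> S" for x y
    using that D(5)[of x y] D(6)[of x y] by (simp add: q_def joined_def)
  ultimately show ?thesis unfolding linear_layout_def by blast
qed

text \<open>Negating the positions on one path exchanges the successor and the predecessor clause
  there and leaves the other paths alone.\<close>

lemma path_layout_reverse: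
  assumes "path_layout S lab p"
  shows "path_layout S lab (\<lambda>x. if lab x = c then - p x else p x)" (is "path_layout S lab ?p")
proof (rule path_layoutI)
  note D = path_layoutD[OF assms]
  have "range ?p \<subseteq> range p \<union> uminus ` range p" by auto
  then show "finite (range ?p)" using D(1) by (meson finite_Un finite_imageI finite_subset)
  show "\<exists>z. lab z = lab x \<and> ?p z = ?p x + 1 \<and> joined S x z"
    if xy: "lab x = lab y" "?p x < ?p y" for x y
  proof (cases "lab x = c")
    case True
    have "p y < p x" using xy True by simp
    then obtain z where "lab z = lab y" "p z = p x - 1" "joined S x z"
      using D(4)[OF xy(1)[symmetric]] by blast
    then show ?thesis using xy(1) True by (intro exI[of _ z]) simp
  next
    case False
    have "p x < p y" using xy False by simp
    then obtain z where "lab z = lab x" "p z = p x + 1" "joined S x z"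
      using D(3)[OF xy(1)] by blast
    then show ?thesis using False by (intro exI[of _ z]) simp
  qed
  show "\<exists>z. lab z = lab x \<and> ?p z = ?p y - 1 \<and> joined S y z"
    if xy: "lab x = lab y" "?p x < ?p y" for x y
  proof (cases "lab x = c")
    case True
    have "p y < p x" using xy True by simp
    then obtain z where "lab z = lab y" "p z = p y + 1" "joined S y z"
      using D(3)[OF xy(1)[symmetric]] by blast
    then show ?thesis using xy(1) True by (intro exI[of _ z]) simp
  next
    case False
    have "p x < p y" using xy False by simp
    then obtain z where "lab z = lab x" "p z = p y - 1" "joined S y z"
      using D(4)[OF xy(1)] by blast
    then show ?thesis using xy(1) False by (intro exI[of _ z]) simp
  qed
  show "x = y" if xy: "lab x = lab y" "?p x = ?p y" for x y
  proof (rule D(2)[OF xy(1)])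
    show "p x = p y" using xy by (cases "lab x = c") simp_all
  qed
  show "lab x = lab y \<and> \<bar>?p x - ?p y\<bar> = 1" if "joined S x y" for x y
    using D(5)[OF that] D(6)[OF that] by (cases "lab x = c") simp_all
qed

section \<open>Joining two paths by a new edge\<close>

definition path_end :: "(nat \<Rightarrow> nat) \<Rightarrow> (nat \<Rightarrow> int) \<Rightarrow> nat \<Rightarrow> bool" where
  "path_end lab p u \<longleftrightarrow>
     (\<forall>y. lab y = lab u \<longrightarrow> p y \<le> p u) \<or> (\<forall>y. lab y = lab u \<longrightarrow> p u \<le> p y)"

lemma two_neighbours:
  assumes "path_layout S lab p" "\<not> path_end lab p u"
  obtains y z where "y \<noteq> z" "joined S u y" "joined S u z"
proof -
  note D = path_layoutD[OF assms(1)]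
  obtain a b where ab: "lab a = lab u" "lab b = lab u" "p a < p u" "p u < p b"
    using assms(2) unfolding path_end_def by force
  obtain y where "p y = p u + 1" "joined S u y" using D(3)[of u b] ab by auto
  moreover obtain z where "p z = p u - 1" "joined S u z" using D(4)[of a u] ab by auto
  ultimately show ?thesis using that[of y z] by force
qed

text \<open>An inner vertex of a path already has the two neighbours that the degree bound of
  \<open>G\<close> allows.\<close>

lemma path_end_if_new_neighbour:
  assumes "path_layout S lab p" "S \<subseteq> G" "degree_le_2 G" "joined G u v" "\<not> joined S u v"
  shows "path_end lab p u"
proof (rule ccontr)
  assume "\<not> path_end lab p u"
  then obtain y z where "y \<noteq> z" "joined S u y" "joined S u z"
    using two_neighbours[OF assms(1)] by blast
  moreover from this have "joined G u y" "joined G u z"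
    using assms(2) joined_mono by blast+
  ultimately have "v = y \<or> v = z"
    using assms(3,4) unfolding degree_le_2_def by blast
  then show False using \<open>joined S u y\<close> \<open>joined S u z\<close> assms(5) by blast
qed

text \<open>The edge is new at both of its vertices, so each is an end of its path. Reversing paths
  where necessary makes \<open>u\<close> the last vertex of one and \<open>v\<close> the first
  vertex of the other.\<close>

lemma path_layout_merge:
  assumes P: "path_layout S lab p" and S: "S \<subseteq> G" "degree_le_2 G" "(u, v) \<in> G"
    and ne: "lab u \<noteq> lab v"
  shows "\<exists>p'. path_layout (insert (u, v) S) (\<lambda>x. if lab x = lab u then lab v else lab x) p'"
proof -
  have uv: "joined G u v" "joined G v u" "\<not> joined S u v" "\<not> joined S v u"
    using path_layoutD(5)[OF P] S ne by (auto simp: joined_def)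
  obtain p1 where p1: "path_layout S lab p1" "\<And>y. lab y = lab u \<Longrightarrow> p1 y \<le> p1 u"
  proof (cases "\<forall>y. lab y = lab u \<longrightarrow> p y \<le> p u")
    case False
    then have "\<forall>y. lab y = lab u \<longrightarrow> p u \<le> p y"
      using path_end_if_new_neighbour[OF P S(1,2) uv(1,3)] unfolding path_end_def by blast
    then show ?thesis using that[OF path_layout_reverse[OF P, of "lab u"]] by simp
  qed (use that P in blast)
  obtain p2 where p2: "path_layout S lab p2" "\<And>y. lab y = lab u \<Longrightarrow> p2 y \<le> p2 u"
    "\<And>y. lab y = lab v \<Longrightarrow> p2 v \<le> p2 y"
  proof (cases "\<forall>y. lab y = lab v \<longrightarrow> p1 v \<le> p1 y")
    case False
    then have "\<forall>y. lab y = lab v \<longrightarrow> p1 y \<le> p1 v"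
      using path_end_if_new_neighbour[OF p1(1) S(1,2) uv(2,4)] unfolding path_end_def by blast
    then show ?thesis
      using that[OF path_layout_reverse[OF p1(1), of "lab v"]] p1(2) ne by simp
  qed (use that p1 in blast)
  note D = path_layoutD[OF p2(1)]
  let ?S = "insert (u, v) S"
  let ?c = "\<lambda>x. if lab x = lab u then lab v else lab x"
  \<comment> \<open>The path of \<open>v\<close> is moved so that \<open>v\<close> lands directly
    behind \<open>u\<close>.\<close>
  let ?p = "\<lambda>x. if lab x = lab v then p2 x - p2 v + p2 u + 1 else p2 x"
  have uv': "joined ?S u v" "joined ?S v u" by (auto simp: joined_def)
  have mono: "joined S x y \<Longrightarrow> joined ?S x y" for x y by (auto simp: joined_def)
  have "path_layout ?S ?c ?p"
  proof (rule path_layoutI)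
    have "range ?p \<subseteq> range p2 \<union> (\<lambda>i. i - p2 v + p2 u + 1) ` range p2" by auto
    then show "finite (range ?p)" using D(1) by (meson finite_Un finite_imageI finite_subset)
    have two: "(lab x = lab u \<and> lab y = lab v) \<or> (lab x = lab v \<and> lab y = lab u) \<or> lab x = lab y"
      if "?c x = ?c y" for x y
      using that by (simp split: if_splits)
    have pu: "?p x \<le> p2 u" if "lab x = lab u" for x
      using p2(2)[OF that] that ne by simp
    have pv: "p2 u < ?p x" if "lab x = lab v" for x
      using p2(3)[OF that] that by simp
    have same: "?p x - ?p y = p2 x - p2 y" if "lab x = lab y" for x y
      using that by (cases "lab y = lab v") simp_all
    have apart: "lab x = lab u \<and> lab y = lab v" if "?c x = ?c y" "?p x < ?p y" "lab x \<noteq> lab y" for x y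
      using two[OF that(1)] pu[of y] pv[of x] that(2,3) by linarith
    show "x = y" if "?c x = ?c y" "?p x = ?p y" for x y
    proof -
      have xy: "lab x = lab y"
        using two[OF that(1)] pu[of x] pv[of x] pu[of y] pv[of y] that(2) by linarith
      show ?thesis using D(2)[OF xy] same[OF xy] that(2) by linarith
    qed
    show "?c x = ?c y \<and> \<bar>?p x - ?p y\<bar> = 1" if "joined ?S x y" for x y
    proof (cases "joined S x y")
      case True
      show ?thesis using D(6)[OF True] same[OF D(5)[OF True]] D(5)[OF True] by simp
    next
      case False
      then have "(x = u \<and> y = v) \<or> (x = v \<and> y = u)" using that by (auto simp: joined_def)
      then show ?thesis using ne by (elim disjE) simp_all
    qed
    show "\<exists>z. ?c z = ?c x \<and> ?p z = ?p x + 1 \<and> joined ?S x z"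
      if xy: "?c x = ?c y" "?p x < ?p y" for x y
    proof -
      have inside: ?thesis if y: "lab x = lab y'" "p2 x < p2 y'" for y'
      proof -
        obtain z where z: "lab z = lab x" "p2 z = p2 x + 1" "joined S x z" using D(3)[OF y] by blast
        have "?c z = ?c x" unfolding z(1) ..
        moreover have "?p z = ?p x + 1" using same[OF z(1)] z(2) by linarith
        ultimately show ?thesis using mono[OF z(3)] by (intro exI[of _ z] conjI)
      qed
      show ?thesis
      proof (cases "lab x = lab y")
        case True
        show ?thesis by (rule inside[OF True]) (use same[OF True] xy(2) in linarith)
      next
        case False
        then have c: "lab x = lab u" "lab y = lab v" using apart[OF xy] by simp_all
        show ?thesis
        proof (cases "x = u")
          case True
          then show ?thesis using uv' ne by (intro exI[of _ v]) simp
        next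
          case False
          then have "p2 x \<noteq> p2 u" using D(2)[OF c(1)] by blast
          then show ?thesis using p2(2)[OF c(1)] by (intro inside[OF c(1)]) linarith
        qed
      qed
    qed
    show "\<exists>z. ?c z = ?c x \<and> ?p z = ?p y - 1 \<and> joined ?S y z"
      if xy: "?c x = ?c y" "?p x < ?p y" for x y
    proof -
      have inside: ?thesis if y: "lab x' = lab y" "p2 x' < p2 y" for x'
      proof -
        obtain z where z: "lab z = lab x'" "p2 z = p2 y - 1" "joined S y z" using D(4)[OF y] by blast
        have zy: "lab z = lab y" using z(1) y(1) by (rule trans)
        have "?c z = ?c x" unfolding zy xy(1) ..
        moreover have "?p z = ?p y - 1" using same[OF zy] z(2) by linarith
        ultimately show ?thesis using mono[OF z(3)] by (intro exI[of _ z] conjI)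
      qed
      show ?thesis
      proof (cases "lab x = lab y")
        case True
        show ?thesis by (rule inside[OF True]) (use same[OF True] xy(2) in linarith)
      next
        case False
        then have c: "lab x = lab u" "lab y = lab v" using apart[OF xy] by simp_all
        show ?thesis
        proof (cases "y = v")
          case True
          then show ?thesis using uv' ne c by (intro exI[of _ u]) simp
        next
          case False
          then have "p2 y \<noteq> p2 v" using D(2)[OF c(2)] by blast
          then show ?thesis using p2(3)[OF c(2)] by (intro inside[OF c(2)[symmetric]]) linarith
        qed
      qed
    qed
  qed
  then show ?thesis by blast
qed

text \<open>Both \<open>u\<close> and \<open>v\<close> gain a neighbour outside \<open>S\<close>, so
  both are path ends; \<open>p u < p v\<close> decides which end is which.\<close>

lemma closing_edge_extremes:
  assumes P: "path_layout S lab p" and S: "S \<subseteq> G" "degree_le_2 G"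
    and uv: "joined G u v" "\<not> joined S u v" "lab u = lab v" "p u < p v"
    and x: "lab x = lab u"
  shows "p u \<le> p x" "p x \<le> p v"
proof -
  have "path_end lab p u" "path_end lab p v"
    using path_end_if_new_neighbour[OF P S, of u v] path_end_if_new_neighbour[OF P S, of v u] uv
    by (auto simp: joined_commute)
  then show "p u \<le> p x" "p x \<le> p v"
    using uv(3,4) x unfolding path_end_def by (metis linorder_not_le)+
qed

text \<open>With the left-out edge, every vertex of the path has two neighbours on it, so no edge leaves it.\<close>

lemma closed_component:
  assumes P: "path_layout S lab p" and S: "S \<subseteq> G" "degree_le_2 G"
    and uv: "joined G u v" "\<not> joined S u v" "lab u = lab v" "u \<noteq> v"
    and x: "lab x = lab u" "joined G x y"
  shows "lab y = lab u"
proof -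
  note D = path_layoutD[OF P]
  have main: "lab y = lab u"
    if uv: "joined G u v" "\<not> joined S u v" "lab u = lab v" "p u < p v" and x: "lab x = lab u"
    for u v
  proof (cases "joined S x y")
    case True
    then show ?thesis using D(5) x by metis
  next
    case False
    then have "path_end lab p x"
      using path_end_if_new_neighbour[OF P S \<open>joined G x y\<close>] by blast
    then have "p x = p u \<or> p x = p v"
      using closing_edge_extremes[OF P S uv x] uv(3) x unfolding path_end_def by (metis order.antisym)
    then have "x = u \<or> x = v" using D(2) x uv(3) by metis
    \<comment> \<open>\<open>w\<close> is the opposite end of the left-out edge. Together with the
      path neighbour \<open>z\<close> it exhausts the degree of \<open>x\<close>, so
      \<open>y\<close>, which differs from \<open>z\<close>, must be \<open>w\<close>.\<close>
    then obtain w where w: "lab w = lab u" "joined G x w" "\<not> joined S x w"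
    proof
      assume "x = u" then show thesis using that[of v] uv by simp
    next
      assume "x = v" then show thesis using that[of u] uv joined_commute by blast
    qed
    obtain z where z: "joined S x z"
      using \<open>x = u \<or> x = v\<close> D(3)[OF uv(3,4)] D(4)[OF uv(3,4)] by blast
    then have "joined G x z" using S(1) joined_mono by blast
    then have "y = w"
      using S(2) \<open>joined G x y\<close> w z False unfolding degree_le_2_def by metis
    then show ?thesis using w(1) by simp
  qed
  have "p u \<noteq> p v" using D(2) uv by blast
  then consider "p u < p v" | "p v < p u" by linarith
  then show ?thesis
  proof cases
    case 1 then show ?thesis using main uv x by blast
  next
    case 2 then show ?thesis using main[of v u] uv x by (auto simp: joined_commute)
  qed
qed

text \<open>A layout of a path is monotone along the path, so its ends cannot be placed next to each other.\<close>

lemma cycle_not_linear: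
  assumes P: "path_layout S lab p" and uv: "\<not> joined S u v" "lab u = lab v" "p u < p v"
    and q: "inj q" "\<And>x y. joined S x y \<Longrightarrow> lab x = lab u \<Longrightarrow> \<bar>q x - q y\<bar> = (1::int)"
  shows "\<bar>q u - q v\<bar> \<noteq> 1"
proof -
  note D = path_layoutD[OF P]
  obtain x1 where x1: "lab x1 = lab u" "p x1 = p u + 1" "joined S u x1"
    using D(3)[OF uv(2,3)] by blast
  \<comment> \<open>The first step of the walk fixes its direction.\<close>
  define s where "s = q x1 - q u"
  have s: "s = 1 \<or> s = -1" using q(2)[OF x1(3)] unfolding s_def by linarith
  have walk: "q y = q u + s * int n"
    if "lab y = lab u" "p y = p u + int n" for n y
    using that
  proof (induction n arbitrary: y rule: less_induct)
    case (less n)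
    consider "n = 0" | "n = 1" | m where "n = Suc (Suc m)" by (metis One_nat_def not0_implies_Suc)
    then show ?case
    proof cases
      case 1 then show ?thesis using less.prems D(2)[of y u] by simp
    next
      case 2 then show ?thesis using less.prems D(2)[of y x1] x1 by (simp add: s_def)
    next
      case 3
      obtain z where z: "lab z = lab u" "p z = p y - 1" "joined S y z"
        using D(4)[of u y] less.prems 3 by auto
      obtain w where w: "lab w = lab u" "p w = p z - 1" "joined S z w"
        using D(4)[of u z] less.prems 3 z by auto
      have qz: "q z = q u + s * int (Suc m)" using less.IH[of "Suc m" z] less.prems z 3 by simp
      have qw: "q w = q u + s * int m" using less.IH[of m w] less.prems z w 3 by simp
      \<comment> \<open>Injectivity forbids turning back: one of the two places next to
        \<open>q z\<close> is taken by \<open>w\<close>, so the walk keeps its direction.\<close>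
      have "q y \<noteq> q w" using q(1) z(2) w(2) by (auto dest: injD)
      moreover have "\<bar>q y - q z\<bar> = 1" using q(2) z less.prems by auto
      ultimately show ?thesis using s qz qw 3 by (auto simp: algebra_simps)
    qed
  qed
  define n where "n = nat (p v - p u)"
  \<comment> \<open>Otherwise \<open>v\<close> would be the path neighbour \<open>x1\<close> of
    \<open>u\<close>, although \<open>S\<close> does not join \<open>u\<close> and \<open>v\<close>.
    So the walk ends at distance at least 2.\<close>
  have "n \<noteq> 1"
  proof
    assume "n = 1"
    then have "p v = p x1" using x1(2) uv(3) unfolding n_def by linarith
    then show False using D(2)[of v x1] x1 uv by auto
  qed
  moreover have "n \<noteq> 0" "p v = p u + int n" using uv(3) unfolding n_def by auto
  moreover have "q v = q u + s * int n" using walk[of v n] calculation uv(2) by auto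
  ultimately show ?thesis using s by auto
qed


section \<open>Optimal deletion in graphs of maximum degree two\<close>

text \<open>
  An item is a numbered edge; parallel edges are items with different numbers.  A matrix row with
  two ones becomes the item consisting of its row number and its two columns.
\<close>

type_synonym item = "nat \<times> edge"

text \<open>Vertices beyond the list are labelled by themselves. This makes the labelling total, as
  \<open>path_layout\<close> requires, and gives each of them a path of its own.\<close>

definition label :: "nat list \<Rightarrow> nat \<Rightarrow> nat" where
  "label l u = nth_default u l u"

text \<open>A copy of a kept edge is kept as well, although it would close a cycle of length two: it
  imposes no new adjacency. Thus either all copies of an edge are kept or none.\<close>

definition kruskal_step :: "nat list \<times> item list \<Rightarrow> item \<Rightarrow> nat list \<times> item list" where
  "kruskal_step s z =
     (if \<exists>y\<in>set (snd s). snd y = snd z then (fst s, z # snd s)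
      else if label (fst s) (fst (snd z)) = label (fst s) (snd (snd z)) then s
      else (map (\<lambda>c. if c = label (fst s) (fst (snd z)) then label (fst s) (snd (snd z)) else c) (fst s),
            z # snd s))"

text \<open>A bucket sort by decreasing multiplicity; the buckets for the multiplicities
  \<open>length A\<close> down to 1 cover all items. It needs only operations already known to be
  polynomial.\<close>

definition by_multiplicity :: "item list \<Rightarrow> item list" where
  "by_multiplicity A = concat (map (\<lambda>k. filter (\<lambda>z. length (filter (\<lambda>y. snd y = snd z) A) = length A - k) A)
     [0..<length A])"

definition kruskal :: "nat \<Rightarrow> item list \<Rightarrow> item list" where
  "kruskal n A = snd (foldl kruskal_step ([0..<n], []) (by_multiplicity A))"

lemma label_upt: "label [0..<n] u = u"
  by (auto simp: label_def nth_default_def)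

lemma label_less: "set l \<subseteq> {..<length l} \<Longrightarrow> u < length l \<Longrightarrow> label l u < length l"
  by (auto simp: label_def nth_default_def dest: nth_mem)

text \<open>Listed vertices have labels below \<open>length l\<close>, the others at least
  \<open>length l\<close>, so renaming the class of \<open>u\<close> never affects an unlisted
  vertex.\<close>

lemma label_map:
  assumes "set l \<subseteq> {..<length l}" "u < length l"
  shows "label (map (\<lambda>c. if c = label l u then b else c) l) x = (if label l x = label l u then b else label l x)"
  using label_less[OF assms] by (auto simp: label_def nth_default_def)

definition kruskal_inv :: "(edge \<Rightarrow> nat) \<Rightarrow> nat \<Rightarrow> item set \<Rightarrow> nat list \<times> item list \<Rightarrow> bool" where
  "kruskal_inv w n D s \<longleftrightarrow> length (fst s) = n \<and> set (fst s) \<subseteq> {..<n} \<and> set (snd s) \<subseteq> D \<and>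
     (\<exists>p. path_layout (snd ` set (snd s)) (label (fst s)) p) \<and>
     (\<forall>z\<in>D - set (snd s). label (fst s) (fst (snd z)) = label (fst s) (snd (snd z)) \<and>
        snd z \<notin> snd ` set (snd s) \<and>
        (\<forall>e\<in>snd ` set (snd s). label (fst s) (fst e) = label (fst s) (fst (snd z)) \<longrightarrow> w (snd z) \<le> w e))"

lemma kruskal_invI:
  assumes "length l = n" "set l \<subseteq> {..<n}" "set K \<subseteq> D" "path_layout (snd ` set K) (label l) p"
    "\<And>z. z \<in> D \<Longrightarrow> z \<notin> set K \<Longrightarrow> label l (fst (snd z)) = label l (snd (snd z)) \<and>
        snd z \<notin> snd ` set K \<and>
        (\<forall>e\<in>snd ` set K. label l (fst e) = label l (fst (snd z)) \<longrightarrow> w (snd z) \<le> w e)"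
  shows "kruskal_inv w n D (l, K)"
  unfolding kruskal_inv_def fst_conv snd_conv
  using assms(1-4) by (intro conjI exI[of _ p] ballI) (use assms(5) in blast)+

lemma kruskal_invD:
  assumes "kruskal_inv w n D (l, K)"
  shows "length l = n" "set l \<subseteq> {..<n}" "set K \<subseteq> D" "\<exists>p. path_layout (snd ` set K) (label l) p"
    "\<And>z. z \<in> D \<Longrightarrow> z \<notin> set K \<Longrightarrow> label l (fst (snd z)) = label l (snd (snd z)) \<and>
        snd z \<notin> snd ` set K \<and>
        (\<forall>e\<in>snd ` set K. label l (fst e) = label l (fst (snd z)) \<longrightarrow> w (snd z) \<le> w e)"
  using assms[unfolded kruskal_inv_def fst_conv snd_conv] by blast+

text \<open>\<open>joined\<close> ignores orientation, but all edges are stored with the smaller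
  vertex first, so a reversed pair cannot occur.\<close>

lemma not_joined_if_ordered:
  assumes "\<And>z. z \<in> A \<Longrightarrow> fst (snd z) < (snd (snd z) :: nat)" "K \<subseteq> A" "z \<in> A" "snd z \<notin> snd ` K"
  shows "\<not> joined (snd ` K) (fst (snd z)) (snd (snd z))"
proof
  assume "joined (snd ` K) (fst (snd z)) (snd (snd z))"
  then obtain y where "y \<in> K" "snd y = (snd (snd z), fst (snd z))"
    using assms(4) unfolding joined_def by force
  then show False using assms(1)[of y] assms(1)[of z] assms(2,3) by force
qed

text \<open>When \<open>z\<close> is rejected, it is minimal because heavier edges came first. When
  two paths merge, earlier rejected edges are unaffected: each has closed its component, so the
  merge happens elsewhere.\<close>

lemma kruskal_step_inv:
  assumes deg: "degree_le_2 (snd ` A)" and ord: "\<And>z. z \<in> A \<Longrightarrow> fst (snd z) < snd (snd z) \<and> snd (snd z) < n"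
    and inv: "kruskal_inv w n D s" and D: "D \<subseteq> A" "z \<in> A" "\<And>y. y \<in> D \<Longrightarrow> w (snd z) \<le> w (snd y)"
  shows "kruskal_inv w n (insert z D) (kruskal_step s z)"
proof -
  obtain l K where s: "s = (l, K)" by fastforce
  obtain i u v where z: "z = (i, u, v)" by (cases z)
  have uv: "u < v" "v < n" using ord[OF D(2)] z by auto
  note I = kruskal_invD[OF inv[unfolded s]]
  have l: "length l = n" "set l \<subseteq> {..<length l}" using I(1,2) by simp_all
  note K = I(3) and rej = I(5)
  obtain p where p: "path_layout (snd ` set K) (label l) p" using I(4) by blast
  have KG: "snd ` set K \<subseteq> snd ` A" using K D(1) by blast
  have zG: "(u, v) \<in> snd ` A" using D(2) z by force
  consider (copy) "\<exists>y\<in>set K. snd y = (u, v)"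
    | (reject) "\<not> (\<exists>y\<in>set K. snd y = (u, v))" "label l u = label l v"
    | (merge) "\<not> (\<exists>y\<in>set K. snd y = (u, v))" "label l u \<noteq> label l v" by blast
  then show ?thesis
  proof cases
    case copy
    then have step: "kruskal_step s z = (l, z # K)" by (simp add: kruskal_step_def s z)
    have eq: "snd ` set (z # K) = snd ` set K" using copy z by force
    show ?thesis unfolding step
    proof (rule kruskal_invI[where p = p], unfold eq)
      fix y assume "y \<in> insert z D" "y \<notin> set (z # K)"
      then have "y \<in> D" "y \<notin> set K" by simp_all
      then show "label l (fst (snd y)) = label l (snd (snd y)) \<and> snd y \<notin> snd ` set K \<and>
          (\<forall>e\<in>snd ` set K. label l (fst e) = label l (fst (snd y)) \<longrightarrow> w (snd y) \<le> w e)"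
        by (rule rej)
    qed (use I(3) in \<open>simp_all add: I(1,2) p subset_insertI2\<close>)
  next
    case reject
    then have step: "kruskal_step s z = (l, K)" by (simp add: kruskal_step_def s z)
    have we: "w (u, v) \<le> w e" if e: "e \<in> snd ` set K" for e
    proof -
      obtain y where y: "y \<in> set K" "e = snd y" using e by blast
      have "y \<in> D" using K y(1) by (rule subsetD)
      then have "w (snd z) \<le> w (snd y)" by (rule D(3))
      then show ?thesis unfolding y(2) z snd_conv .
    qed
    have new: "(u, v) \<notin> snd ` set K"
    proof
      assume "(u, v) \<in> snd ` set K"
      then obtain y where "y \<in> set K" "(u, v) = snd y" by (rule imageE)
      then show False using reject(1) by metis
    qed
    show ?thesis unfolding step
    proof (rule kruskal_invI[OF I(1,2) _ p])
      show "set K \<subseteq> insert z D" using K by (rule subset_insertI2)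
      fix y assume y: "y \<in> insert z D" "y \<notin> set K"
      show "label l (fst (snd y)) = label l (snd (snd y)) \<and> snd y \<notin> snd ` set K \<and>
          (\<forall>e\<in>snd ` set K. label l (fst e) = label l (fst (snd y)) \<longrightarrow> w (snd y) \<le> w e)"
      proof (cases "y = z")
        case True
        show ?thesis unfolding True z fst_conv snd_conv using reject(2) new we by (intro conjI ballI impI)
      next
        case False
        then have "y \<in> D" using y(1) by simp
        then show ?thesis using y(2) by (rule rej)
      qed
    qed
  next
    case merge
    let ?l = "map (\<lambda>c. if c = label l u then label l v else c) l"
    from merge have step: "kruskal_step s z = (?l, z # K)" by (simp add: kruskal_step_def s z)
    have lab: "label ?l = (\<lambda>x. if label l x = label l u then label l v else label l x)"
      by (rule ext, rule label_map[OF l(2)]) (use uv l(1) in simp)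
    have "label l v < n" using label_less[OF l(2)] l(1) uv by simp
    then have l': "length ?l = n" "set ?l \<subseteq> {..<n}" using I(1,2) by auto
    obtain p' where p': "path_layout (insert (u, v) (snd ` set K)) (label ?l) p'"
      using path_layout_merge[OF p KG deg zG merge(2)] unfolding lab by blast
    have rej': "label ?l (fst (snd y)) = label ?l (snd (snd y)) \<and> snd y \<notin> insert (u, v) (snd ` set K) \<and>
        (\<forall>e\<in>insert (u, v) (snd ` set K). label ?l (fst e) = label ?l (fst (snd y)) \<longrightarrow> w (snd y) \<le> w e)"
      if y: "y \<in> D" "y \<notin> set K" for y
    proof -
      obtain j a b where ab: "y = (j, a, b)" by (cases y)
      note r = rej[OF y, unfolded ab, simplified]
      have yA: "y \<in> A" using y D(1) by blast
      have nj: "\<not> joined (snd ` set K) a b"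
        using not_joined_if_ordered[of A "set K" y] ord K D(1) yA r ab by auto
      have G: "joined (snd ` A) a b" using yA ab by (force simp: joined_def)
      have "a \<noteq> b" using ord[OF yA] ab by simp
      \<comment> \<open>The component of the rejected edge \<open>(a, b)\<close> is closed. If it
        contained \<open>u\<close> or \<open>v\<close>, the edge between them would put both into
        it, against their different labels.\<close>
      note cl = closed_component[OF p KG deg G nj _ this]
      have "label l a \<noteq> label l u" "label l a \<noteq> label l v"
        using cl[of u v] cl[of v u] r merge(2) zG by (auto simp: joined_def)
      then have n: "label l a \<noteq> label l u" "label l a \<noteq> label l v" "label l b = label l a" using r by auto
      then have 1: "label ?l a = label l a" "label ?l b = label l a" unfolding lab by simp_all
      have 2: "(a, b) \<noteq> (u, v)" using n merge(2) by auto
      have 3: "w (a, b) \<le> w e" if "e \<in> insert (u, v) (snd ` set K)" "label ?l (fst e) = label l a" for e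
      proof -
        have "label l (fst e) \<noteq> label l u" using that(2) n(2) unfolding lab by auto
        then have "label l (fst e) = label l a" "e \<noteq> (u, v)" using that(2) unfolding lab by auto
        then show ?thesis using r that(1) by auto
      qed
      show ?thesis unfolding ab fst_conv snd_conv 1 using r 2 3 by blast
    qed
    have eq: "snd ` set (z # K) = insert (u, v) (snd ` set K)" using z by simp
    show ?thesis unfolding step
    proof (rule kruskal_invI[where p = p'], unfold eq)
      fix y assume "y \<in> insert z D" "y \<notin> set (z # K)"
      then have "y \<in> D" "y \<notin> set K" by simp_all
      then show "label ?l (fst (snd y)) = label ?l (snd (snd y)) \<and> snd y \<notin> insert (u, v) (snd ` set K) \<and>
          (\<forall>e\<in>insert (u, v) (snd ` set K). label ?l (fst e) = label ?l (fst (snd y)) \<longrightarrow> w (snd y) \<le> w e)"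
        by (rule rej')
    qed (fact | use I(3) in \<open>simp add: subset_insertI2\<close>)+
  qed
qed

lemma kruskal_foldl_inv:
  assumes deg: "degree_le_2 (snd ` A)" and ord: "\<And>z. z \<in> A \<Longrightarrow> fst (snd z) < snd (snd z) \<and> snd (snd z) < n"
    and "set L \<subseteq> A" "sorted_wrt (\<lambda>y z. w (snd z) \<le> w (snd y)) L"
  shows "kruskal_inv w n (set L) (foldl kruskal_step ([0..<n], []) L)"
  using assms(3,4)
proof (induction L rule: rev_induct)
  case Nil
  have "path_layout {} (label [0..<n]) (\<lambda>_. 0)"
    by (rule path_layoutI) (auto simp: label_upt joined_def)
  then show ?case by (auto simp: kruskal_inv_def)
next
  case (snoc z L)
  then show ?case
    using kruskal_step_inv[OF deg ord, where D = "set L" and z = z and w = w]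
    by (auto simp: sorted_wrt_append)
qed

lemma set_by_multiplicity:
  assumes "distinct A" shows "set (by_multiplicity A) = set A"
proof -
  have "z \<in> set (by_multiplicity A)" if z: "z \<in> set A" for z
  proof -
    let ?m = "length (filter (\<lambda>y. snd y = snd z) A)"
    have "?m > 0" "?m \<le> length A" using z by (auto simp: filter_empty_conv)
    then have "length A - ?m < length A" "?m = length A - (length A - ?m)"
      by linarith+
    then show ?thesis using z unfolding by_multiplicity_def by force
  qed
  then show ?thesis by (auto simp: by_multiplicity_def)
qed

lemma sorted_by_multiplicity:
  "sorted_wrt (\<lambda>y z. length (filter (\<lambda>x. snd x = snd z) A) \<le> length (filter (\<lambda>x. snd x = snd y) A))
     (by_multiplicity A)"
proof -
  let ?m = "\<lambda>z. length (filter (\<lambda>x. snd x = snd z) A)"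
  have "sorted_wrt (\<lambda>y z. ?m z \<le> ?m y) (concat (map (\<lambda>k. filter (\<lambda>z. ?m z = N - k) A) [0..<j]))" for N j
  proof (induction j)
    case (Suc j)
    have "sorted_wrt (\<lambda>y z. ?m z \<le> ?m y) (filter (\<lambda>z. ?m z = N - j) B)" for B
      by (induction B) auto
    then show ?case using Suc by (auto simp: sorted_wrt_append)
  qed simp
  then show ?thesis unfolding by_multiplicity_def .
qed

text \<open>
  Every rejected edge closes a cycle, on which it has minimal multiplicity.  Different rejected
  edges close disjoint cycles, and from each of these cycles some edge has to be deleted with all
  its copies.
\<close>

lemma kruskal_optimal:
  assumes A: "distinct A" "\<And>z. z \<in> set A \<Longrightarrow> fst (snd z) < snd (snd z) \<and> snd (snd z) < n"
    and deg: "degree_le_2 (snd ` set A)"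
  shows "set (kruskal n A) \<subseteq> set A" "linear_layout (snd ` set (kruskal n A))"
    "X \<subseteq> set A \<Longrightarrow> linear_layout (snd ` (set A - X)) \<Longrightarrow> card (set A - set (kruskal n A)) \<le> card X"
proof -
  define w where "w e = length (filter (\<lambda>y. snd y = e) A)" for e
  have w: "w e = card {z \<in> set A. snd z = e}" for e
    unfolding w_def using A(1) by (metis distinct_card distinct_filter set_filter)
  obtain l K where lK: "foldl kruskal_step ([0..<n], []) (by_multiplicity A) = (l, K)" by fastforce
  have kr: "kruskal n A = K" by (simp add: kruskal_def lK)
  have "kruskal_inv w n (set A) (l, K)"
    using kruskal_foldl_inv[OF deg A(2), of "by_multiplicity A" w] sorted_by_multiplicity[of A]
    unfolding set_by_multiplicity[OF A(1)] lK w_def by simp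
  note I = kruskal_invD[OF this]
  note K = I(3) and rej = I(5)
  obtain p where p: "path_layout (snd ` set K) (label l) p" using I(4) by blast
  show "set (kruskal n A) \<subseteq> set A" "linear_layout (snd ` set (kruskal n A))"
    unfolding kr using K path_layout_linear[OF p] by auto
  note D = path_layoutD[OF p]
  have KG: "snd ` set K \<subseteq> snd ` set A" using K by blast
  assume X: "X \<subseteq> set A" "linear_layout (snd ` (set A - X))"
  then obtain q :: "nat \<Rightarrow> int" where q: "inj q" "\<And>u v. (u, v) \<in> snd ` (set A - X) \<Longrightarrow> \<bar>q u - q v\<bar> = 1"
    unfolding linear_layout_def by blast
  define R where "R = snd ` (set A - set K)"
  have R: "u < v" "(u, v) \<in> snd ` set A" "joined (snd ` set A) u v" "\<not> joined (snd ` set K) u v"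
      "label l u = label l v" "p u \<noteq> p v"
      "\<And>e. e \<in> snd ` set K \<Longrightarrow> label l (fst e) = label l u \<Longrightarrow> w (u, v) \<le> w e"
    if uvR: "(u, v) \<in> R" for u v
  proof -
    obtain y where y: "y \<in> set A" "y \<notin> set K" "snd y = (u, v)"
      using uvR unfolding R_def by force
    show "u < v" using A(2)[OF y(1)] y(3) by simp
    show "(u, v) \<in> snd ` set A" using y by force
    then show "joined (snd ` set A) u v" by (auto simp: joined_def)
    show "\<not> joined (snd ` set K) u v"
      using not_joined_if_ordered[of "set A" "set K" y] A(2) K y rej[OF y(1,2)] by auto
    show l: "label l u = label l v" using rej[OF y(1,2)] y(3) by simp
    then show "p u \<noteq> p v" using D(2)[OF l] \<open>u < v\<close> by blast
    show "w (u, v) \<le> w e" if "e \<in> snd ` set K" "label l (fst e) = label l u" for e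
      using rej[OF y(1,2), unfolded y(3) fst_conv snd_conv] that by blast
  qed
  \<comment> \<open>Rejected edges of the same component join the same two extreme vertices of its
    path.\<close>
  have inj: "e = e'" if e: "e \<in> R" "e' \<in> R" "label l (fst e) = label l (fst e')" for e e'
  proof -
    obtain u v u' v' where uv: "e = (u, v)" "e' = (u', v')" by (cases e, cases e')
    note r = R[OF e(1)[unfolded uv]] and r' = R[OF e(2)[unfolded uv]]
    have ends: "\<exists>a b. {u, v} = {a, b} \<and> (\<forall>x. label l x = label l u \<longrightarrow> p a \<le> p x \<and> p x \<le> p b)"
      if "(u, v) \<in> R" for u v
    proof (cases "p u < p v")
      case True
      then show ?thesis
        using closing_edge_extremes[OF p KG deg R(3,4,5)[OF that]] by blast
    next
      case False
      then have "p v < p u" using R(6)[OF that] by simp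
      moreover have "joined (snd ` set A) v u" "\<not> joined (snd ` set K) v u"
        using R(3,4)[OF that] joined_commute by blast+
      ultimately have "\<forall>x. label l x = label l v \<longrightarrow> p v \<le> p x \<and> p x \<le> p u"
        using closing_edge_extremes[OF p KG deg, of v u] R(5)[OF that] by simp
      then show ?thesis using R(5)[OF that] by (intro exI[of _ v] exI[of _ u]) auto
    qed
    obtain a b where ab: "{u, v} = {a, b}" "\<And>x. label l x = label l u \<Longrightarrow> p a \<le> p x \<and> p x \<le> p b"
      using ends[of u v] e(1) uv by blast
    obtain a' b' where ab': "{u', v'} = {a', b'}" "\<And>x. label l x = label l u' \<Longrightarrow> p a' \<le> p x \<and> p x \<le> p b'"
      using ends[of u' v'] e(2) uv by blast
    have ll: "label l u = label l u'" using e(3) uv by simp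
    have l: "label l a = label l u" "label l b = label l u" "label l a' = label l u" "label l b' = label l u"
      using ab(1) ab'(1) r(5) r'(5) ll by (auto simp: doubleton_eq_iff)
    have "p a = p a'" "p b = p b'"
      using ab(2)[OF l(3)] ab(2)[OF l(4)] ab'(2)[of a] ab'(2)[of b] l ll by fastforce+
    then have "a = a'" "b = b'" using D(2)[of a a'] D(2)[of b b'] l by auto
    then have "{u, v} = {u', v'}" using ab(1) ab'(1) by simp
    then show ?thesis using r(1) r'(1) uv by (auto simp: doubleton_eq_iff)
  qed
  \<comment> \<open>Otherwise the layout \<open>q\<close> respects the whole cycle: the path edges
    of this component weigh at least as much as \<open>e\<close>, so each of them, and
    \<open>e\<close> itself, would have a surviving copy. This contradicts
    \<open>cycle_not_linear\<close>.\<close>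
  have ex: "\<exists>f. f \<notin> snd ` (set A - X) \<and> label l (fst f) = label l (fst e) \<and> w e \<le> w f" if e: "e \<in> R" for e
  proof (rule ccontr)
    assume no: "\<not> ?thesis"
    obtain u v where uv: "e = (u, v)" by (cases e)
    note r = R[OF e[unfolded uv]]
    have kept: "f \<in> snd ` (set A - X)" if "f \<in> snd ` set K" "label l (fst f) = label l u" for f
      using no r(7)[OF that] that(2) unfolding uv fst_conv by blast
    have qK: "\<bar>q x - q y\<bar> = 1" if "joined (snd ` set K) x y" "label l x = label l u" for x y
      using that D(5)[OF that(1)] kept[of "(x, y)"] kept[of "(y, x)"] q(2)[of x y] q(2)[of y x]
      unfolding joined_def by (auto simp: abs_minus_commute)
    have "(u, v) \<in> snd ` (set A - X)" using no unfolding uv by blast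
    then have quv: "\<bar>q u - q v\<bar> = 1" by (rule q(2))
    consider "p u < p v" | "p v < p u" using r(6) by linarith
    then show False
    proof cases
      case 1
      then show ?thesis using cycle_not_linear[OF p r(4,5) _ q(1) qK] quv by blast
    next
      case 2
      have "\<not> joined (snd ` set K) v u" using r(4) joined_commute by blast
      then show ?thesis
        using cycle_not_linear[OF p _ r(5)[symmetric] 2 q(1) qK] quv r(5) by (simp add: abs_minus_commute)
    qed
  qed
  then obtain f where f: "\<And>e. e \<in> R \<Longrightarrow> f e \<notin> snd ` (set A - X)"
      "\<And>e. e \<in> R \<Longrightarrow> label l (fst (f e)) = label l (fst e)" "\<And>e. e \<in> R \<Longrightarrow> w e \<le> w (f e)"
    by metis
  have fin: "finite R" unfolding R_def by simp
  have inj_f: "inj_on f R"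
    using f(2) inj by (intro inj_onI) metis
  have "set A - set K = (\<Union>e\<in>R. {z \<in> set A. snd z = e})"
    using rej unfolding R_def by force
  then have "card (set A - set K) \<le> (\<Sum>e\<in>R. w e)"
    using card_UN_le[OF fin, of "\<lambda>e. {z \<in> set A. snd z = e}"] by (simp add: w)
  also have "\<dots> \<le> (\<Sum>e\<in>R. w (f e))" by (intro sum_mono f)
  also have "\<dots> = card (\<Union>e\<in>R. {z \<in> set A. snd z = f e})"
    unfolding w using fin inj_f by (subst card_UN_disjoint) (auto dest: inj_onD)
  \<comment> \<open>\<open>X\<close> contains every copy of each \<open>f e\<close>; these sets of
    copies are disjoint, since \<open>f e\<close> determines the component and thereby
    \<open>e\<close>.\<close>
  also have "\<dots> \<le> card X"
  proof (rule card_mono)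
    show "finite X" using X(1) finite_subset by blast
    show "(\<Union>e\<in>R. {z \<in> set A. snd z = f e}) \<subseteq> X" using f(1) by force
  qed
  finally show "card (set A - set (kruskal n A)) \<le> card X" unfolding kr .
qed


section \<open>Elimination of claws\<close>

definition meets :: "nat \<Rightarrow> edge \<Rightarrow> bool" where
  "meets u e \<longleftrightarrow> fst e = u \<or> snd e = u"

definition claw :: "edge \<Rightarrow> edge \<Rightarrow> edge \<Rightarrow> bool" where
  "claw e f g \<longleftrightarrow> e \<noteq> f \<and> e \<noteq> g \<and> f \<noteq> g \<and>
     (meets (fst e) f \<and> meets (fst e) g \<or> meets (snd e) f \<and> meets (snd e) g)"

definition claws :: "item list \<Rightarrow> (item \<times> item \<times> item) list" where
  "claws A = concat (map (\<lambda>x. concat (map (\<lambda>y. map (\<lambda>z. (x, y, z))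
     (filter (\<lambda>z. claw (snd x) (snd y) (snd z)) A)) A)) A)"

text \<open>Without claws the symbol is ignored, so guesses of one fixed length also cover
  branchings that end early.\<close>

definition branch :: "item list \<Rightarrow> nat \<Rightarrow> item list" where
  "branch A c = (case claws A of [] \<Rightarrow> A | t # _ \<Rightarrow>
     filter (\<lambda>z. z \<noteq> (if c = 0 then fst t else if c = 1 then fst (snd t) else snd (snd t))) A)"

definition prune :: "item list \<Rightarrow> item list" where
  "prune A = (case claws A of [] \<Rightarrow> A | t # _ \<Rightarrow>
     filter (\<lambda>z. z \<noteq> fst t \<and> z \<noteq> fst (snd t) \<and> z \<noteq> snd (snd t)) A)"

definition proper_items :: "nat \<Rightarrow> item list \<Rightarrow> bool" where
  "proper_items n A \<longleftrightarrow> distinct A \<and> (\<forall>z\<in>set A. fst (snd z) < snd (snd z) \<and> snd (snd z) < n)"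

definition deletable :: "item set \<Rightarrow> item set \<Rightarrow> bool" where
  "deletable A X \<longleftrightarrow> X \<subseteq> A \<and> linear_layout (snd ` (A - X))"

lemma in_claws: "(x, y, z) \<in> set (claws A) \<longleftrightarrow>
    x \<in> set A \<and> y \<in> set A \<and> z \<in> set A \<and> claw (snd x) (snd y) (snd z)"
  unfolding claws_def by auto

text \<open>Three distinct neighbours of a vertex belong to three distinct edges through it, which
  form a claw.\<close>

lemma degree_le_2_if_no_claws:
  assumes "claws A = []" shows "degree_le_2 (snd ` set A)"
proof -
  have no: "\<not> claw e f g" if efg: "e \<in> snd ` set A" "f \<in> snd ` set A" "g \<in> snd ` set A" for e f g
  proof
    assume c: "claw e f g"
    obtain x y z where "x \<in> set A" "y \<in> set A" "z \<in> set A" "e = snd x" "f = snd y" "g = snd z"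
      using efg by blast
    then have "(x, y, z) \<in> set (claws A)" using c in_claws by simp
    then show False using assms by simp
  qed
  show ?thesis unfolding degree_le_2_def
  proof (intro allI impI, rule ccontr)
    fix x a b c
    assume j: "joined (snd ` set A) x a \<and> joined (snd ` set A) x b \<and> joined (snd ` set A) x c"
      and ne: "\<not> (a = b \<or> a = c \<or> b = c)"
    obtain e where e: "e \<in> snd ` set A" "e = (x, a) \<or> e = (a, x)" using j unfolding joined_def by blast
    obtain f where f: "f \<in> snd ` set A" "f = (x, b) \<or> f = (b, x)" using j unfolding joined_def by blast
    obtain g where g: "g \<in> snd ` set A" "g = (x, c) \<or> g = (c, x)" using j unfolding joined_def by blast
    have "claw e f g" using e(2) f(2) g(2) ne unfolding claw_def meets_def by auto
    then show False using no e(1) f(1) g(1) by blast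
  qed
qed

text \<open>Because edges are stored with the smaller vertex first, three different edges through
  one vertex have three different other ends.\<close>

lemma claw_not_degree_le_2:
  assumes c: "claw e f g" and S: "e \<in> S" "f \<in> S" "g \<in> S" and ord: "\<And>e. e \<in> S \<Longrightarrow> fst e < snd e"
  shows "\<not> degree_le_2 S"
proof
  assume deg: "degree_le_2 S"
  have other: "\<exists>a. joined S u a \<and> (e = (u, a) \<or> e = (a, u))" if "meets u e" "e \<in> S" for u e
    using that unfolding meets_def joined_def by (cases e) auto
  have no: False if m: "meets u e" "meets u f" "meets u g" for u
  proof -
    obtain a where a: "joined S u a" "e = (u, a) \<or> e = (a, u)" using other[OF m(1) S(1)] by blast
    obtain b where b: "joined S u b" "f = (u, b) \<or> f = (b, u)" using other[OF m(2) S(2)] by blast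
    obtain c' where c': "joined S u c'" "g = (u, c') \<or> g = (c', u)" using other[OF m(3) S(3)] by blast
    have "a = b \<or> a = c' \<or> b = c'" using deg a(1) b(1) c'(1) unfolding degree_le_2_def by blast
    then show False
      using a(2) b(2) c'(2) ord[OF S(1)] ord[OF S(2)] ord[OF S(3)] c unfolding claw_def by auto
  qed
  show False using c no[of "fst e"] no[of "snd e"] unfolding claw_def meets_def by auto
qed

lemma claw_hits_deletable:
  assumes A: "proper_items n A" and X: "deletable (set A) X" and c: "(x, y, z) \<in> set (claws A)"
  shows "x \<in> X \<or> y \<in> X \<or> z \<in> X"
proof (rule ccontr)
  assume no: "\<not> ?thesis"
  have "degree_le_2 (snd ` (set A - X))"
    using X linear_layout_degree_le_2 unfolding deletable_def by blast
  moreover have "fst e < snd e" if "e \<in> snd ` (set A - X)" for e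
    using that A unfolding proper_items_def by auto
  ultimately show False
    using claw_not_degree_le_2[of "snd x" "snd y" "snd z" "snd ` (set A - X)"] c no unfolding in_claws by blast
qed

lemma proper_items_filter: "proper_items n A \<Longrightarrow> proper_items n (filter Q A)"
  unfolding proper_items_def by simp

lemma branch_filter: "\<exists>Q. branch A c = filter Q A"
proof (cases "claws A")
  case Nil
  then have "branch A c = filter (\<lambda>_. True) A" by (simp add: branch_def)
  then show ?thesis by blast
qed (auto simp: branch_def)

lemma prune_filter: "\<exists>Q. prune A = filter Q A"
proof (cases "claws A")
  case Nil
  then have "prune A = filter (\<lambda>_. True) A" by (simp add: prune_def)
  then show ?thesis by blast
qed (auto simp: prune_def)

text \<open>Being a filtered list serves twice: it preserves \<open>proper_items\<close>, and it
  bounds the accumulator in the running time analysis.\<close>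

lemma foldl_branch_filter: "\<exists>Q. foldl branch A w = filter Q A"
proof (induction w arbitrary: A)
  case Nil
  show ?case by (rule exI[of _ "\<lambda>_. True"]) simp
next
  case (Cons c w)
  obtain Q where "branch A c = filter Q A" using branch_filter by blast
  moreover obtain R where "foldl branch (filter Q A) w = filter R (filter Q A)" using Cons by blast
  ultimately show ?case by (auto simp: filter_filter)
qed

lemma funpow_prune_filter: "\<exists>Q. (prune ^^ m) A = filter Q A"
proof (induction m)
  case 0
  show ?case by (rule exI[of _ "\<lambda>_. True"]) simp
next
  case (Suc m)
  then obtain Q where "(prune ^^ m) A = filter Q A" by blast
  moreover obtain R where "prune (filter Q A) = filter R (filter Q A)" using prune_filter by blast
  ultimately show ?case by (auto simp: filter_filter)
qed

lemma kruskal_deletable: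
  assumes A: "proper_items n A" and c: "claws A = []"
  shows "set (kruskal n A) \<subseteq> set A" "linear_layout (snd ` set (kruskal n A))"
    "deletable (set A) X \<Longrightarrow> card (set A - set (kruskal n A)) \<le> card X"
proof -
  have A': "distinct A" "\<And>z. z \<in> set A \<Longrightarrow> fst (snd z) < snd (snd z) \<and> snd (snd z) < n"
    using A unfolding proper_items_def by blast+
  note K = kruskal_optimal[OF A' degree_le_2_if_no_claws[OF c]]
  show "set (kruskal n A) \<subseteq> set A" "linear_layout (snd ` set (kruskal n A))"
    using K(1,2) by blast+
  show "deletable (set A) X \<Longrightarrow> card (set A - set (kruskal n A)) \<le> card X"
    unfolding deletable_def using K(3) by blast
qed

text \<open>Soundness of both algorithms: however the items outside \<open>Q\<close> were chosen,
  once no claw is left, deleting them together with those rejected by \<open>kruskal\<close> is a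
  solution.\<close>

lemma deletable_of_kruskal:
  assumes A: "proper_items n A" and c: "claws (filter Q A) = []"
  shows "deletable (set A) (set A - set (kruskal n (filter Q A)))"
proof -
  note K = kruskal_deletable[OF proper_items_filter[OF A] c]
  have "set A - (set A - set (kruskal n (filter Q A))) = set (kruskal n (filter Q A))"
    using K(1) by auto
  then show ?thesis using K(2) unfolding deletable_def by simp
qed

lemma foldl_branch_fixed: "claws A = [] \<Longrightarrow> foldl branch A w = A"
  by (induction w) (auto simp: branch_def)

lemma funpow_prune_fixed: "claws A = [] \<Longrightarrow> (prune ^^ m) A = A"
  by (induction m) (auto simp: prune_def)

text \<open>Guided by \<open>X\<close>: every claw contains some \<open>r\<close> of
  \<open>X\<close>, and the symbol that deletes \<open>r\<close> leaves an instance solved by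
  \<open>X - {r}\<close>. With budget 0, \<open>X\<close> is empty and there is no claw.\<close>

lemma branching_complete:
  assumes "proper_items n A" "deletable (set A) X" "card X \<le> d"
  shows "\<exists>w\<in>ternary_strings d. claws (foldl branch A w) = [] \<and>
           card (set A - set (kruskal n (foldl branch A w))) \<le> d"
  using assms
proof (induction d arbitrary: A X)
  case 0
  have fin: "finite X" using 0 unfolding deletable_def by (meson finite_set finite_subset)
  then have X: "X = {}" using 0 by simp
  have c: "claws A = []"
  proof (rule ccontr)
    assume "claws A \<noteq> []"
    then obtain x y z where "(x, y, z) \<in> set (claws A)" by (metis list.set_intros(1) list.exhaust prod_cases3)
    then show False using claw_hits_deletable[OF 0(1,2)] X by blast
  qed
  have "card (set A - set (kruskal n A)) \<le> 0"
    using kruskal_deletable(3)[OF 0(1) c 0(2)] 0(3) by simp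
  then show ?case using c by (intro bexI[of _ "[]"]) (auto simp: ternary_strings_def)
next
  case (Suc d)
  show ?case
  proof (cases "claws A")
    case Nil
    have "replicate (Suc d) 0 \<in> ternary_strings (Suc d)"
      unfolding ternary_strings_def by (simp add: set_replicate_conv_if)
    moreover have "card (set A - set (kruskal n A)) \<le> Suc d"
      using kruskal_deletable(3)[OF Suc.prems(1) Nil Suc.prems(2)] Suc.prems(3) by simp
    ultimately show ?thesis
      using Nil by (intro bexI[of _ "replicate (Suc d) 0"]) (simp_all only: foldl_branch_fixed[OF Nil] simp_thms)
  next
    case (Cons t ts)
    obtain x y z where t: "t = (x, y, z)" by (cases t)
    have "x \<in> X \<or> y \<in> X \<or> z \<in> X"
      using claw_hits_deletable[OF Suc.prems(1,2), of x y z] Cons t by simp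
    then obtain c r where c: "c \<in> {0, 1, 2}" "r \<in> X" "branch A c = filter (\<lambda>z. z \<noteq> r) A"
    proof (elim disjE)
      assume "x \<in> X" then show thesis using that[of 0 x] Cons t by (simp add: branch_def)
    next
      assume "y \<in> X" then show thesis using that[of 1 y] Cons t by (simp add: branch_def)
    next
      assume "z \<in> X" then show thesis using that[of 2 z] Cons t by (simp add: branch_def)
    qed
    have fin: "finite X" using Suc.prems(2) unfolding deletable_def by (meson finite_set finite_subset)
    have "set (branch A c) - (X - {r}) = set A - X" using c by auto
    then have "deletable (set (branch A c)) (X - {r})"
      using Suc.prems(2) c unfolding deletable_def by auto
    moreover have "card (X - {r}) \<le> d" using Suc.prems(3) c(2) fin by simp
    moreover have "proper_items n (branch A c)" using proper_items_filter[OF Suc.prems(1)] c(3) by simp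
    ultimately obtain w where w: "w \<in> ternary_strings d" "claws (foldl branch (branch A c) w) = []"
        "card (set (branch A c) - set (kruskal n (foldl branch (branch A c) w))) \<le> d"
      using Suc.IH by blast
    let ?K = "set (kruskal n (foldl branch A (c # w)))"
    have "set A - ?K \<subseteq> insert r (set (branch A c) - ?K)" using c(3) by auto
    then have "card (set A - ?K) \<le> card (insert r (set (branch A c) - ?K))" by (intro card_mono) auto
    also have "\<dots> \<le> Suc d" using w(3) by (simp add: card_insert_if)
    finally have "card (set A - ?K) \<le> Suc d" .
    moreover have "c # w \<in> ternary_strings (Suc d)" using w(1) c(1) unfolding ternary_strings_def by auto
    ultimately show ?thesis using w(2) by (intro bexI[of _ "c # w"]) simp_all
  qed
qed

lemma branching_correct:
  assumes A: "proper_items n A"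
  shows "(\<exists>w\<in>ternary_strings d. claws (foldl branch A w) = [] \<and>
            card (set A - set (kruskal n (foldl branch A w))) \<le> d) \<longleftrightarrow>
         (\<exists>X. deletable (set A) X \<and> card X \<le> d)" (is "?L \<longleftrightarrow> ?R")
proof
  assume ?L
  then obtain w where w: "claws (foldl branch A w) = []"
      "card (set A - set (kruskal n (foldl branch A w))) \<le> d" by blast
  obtain Q where Q: "foldl branch A w = filter Q A" using foldl_branch_filter by blast
  show ?R using deletable_of_kruskal[OF A, of Q] w unfolding Q by blast
qed (use branching_complete[OF A] in blast)

text \<open>Each round that finds a claw deletes at most three items, at least one of which lies in
  \<open>X\<close> and pays for all. It also shortens the list, so \<open>length A\<close> rounds
  suffice.\<close>

lemma pruning_correct:
  assumes "proper_items n A" "deletable (set A) X" "length A \<le> m"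
  shows "claws ((prune ^^ m) A) = [] \<and> card (set A - set (kruskal n ((prune ^^ m) A))) \<le> 3 * card X"
  using assms
proof (induction m arbitrary: A X)
  case 0
  then have c: "claws A = []" by (simp add: claws_def)
  show ?case using c kruskal_deletable(3)[OF 0(1) c 0(2)] by simp
next
  case (Suc m)
  show ?case
  proof (cases "claws A")
    case Nil
    show ?thesis unfolding funpow_prune_fixed[OF Nil]
      using Nil kruskal_deletable(3)[OF Suc.prems(1) Nil Suc.prems(2)] by simp
  next
    case (Cons t ts)
    obtain x y z where t: "t = (x, y, z)" by (cases t)
    have claw: "(x, y, z) \<in> set (claws A)" using Cons t by simp
    have hit: "x \<in> X \<or> y \<in> X \<or> z \<in> X"
      by (rule claw_hits_deletable[OF Suc.prems(1,2) claw])
    let ?B = "filter (\<lambda>v. v \<noteq> x \<and> v \<noteq> y \<and> v \<noteq> z) A" and ?X = "X - {x, y, z}"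
    have B: "prune A = ?B" unfolding prune_def Cons t by simp
    have fin: "finite X" using Suc.prems(2) unfolding deletable_def by (meson finite_set finite_subset)
    have "snd ` (set ?B - ?X) \<subseteq> snd ` (set A - X)" by auto
    then have "deletable (set ?B) ?X"
      using Suc.prems(2) linear_layout_mono unfolding deletable_def by auto
    moreover have "length ?B \<le> m"
    proof -
      have "length ?B < length A"
        using claw unfolding in_claws by (intro length_filter_less[of x]) auto
      then show ?thesis using Suc.prems(3) by simp
    qed
    ultimately have IH: "claws ((prune ^^ m) ?B) = []"
        "card (set ?B - set (kruskal n ((prune ^^ m) ?B))) \<le> 3 * card ?X"
      using Suc.IH[OF proper_items_filter[OF Suc.prems(1)]] by blast+
    have step: "(prune ^^ Suc m) A = (prune ^^ m) ?B" unfolding funpow_Suc_right o_apply B ..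
    let ?K = "set (kruskal n ((prune ^^ m) ?B))"
    have "card ?X < card X"
      using fin hit by (intro psubset_card_mono) auto
    have "set A - ?K \<subseteq> {x, y, z} \<union> (set ?B - ?K)" by auto
    then have "card (set A - ?K) \<le> card ({x, y, z} \<union> (set ?B - ?K))" by (intro card_mono) auto
    also have "\<dots> \<le> card {x, y, z} + card (set ?B - ?K)" by (rule card_Un_le)
    also have "card {x, y, z} \<le> 3" using card_length[of "[x, y, z]"] by simp
    also have "3 + card (set ?B - ?K) \<le> 3 * card X" using IH(2) \<open>card ?X < card X\<close> by simp
    finally show ?thesis unfolding step using IH(1) by simp
  qed
qed


section \<open>Running time of the algorithms\<close>

lemma ptime_label:
  assumes "ptime l" "ptime n" shows "ptime (\<lambda>x. label (l x) (n x))"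
proof -
  have *: "(case drop n ys of [] \<Rightarrow> n | y # _ \<Rightarrow> y) = label ys n" for n ys
    by (auto simp: label_def nth_default_def split: list.split)
       (metis Cons_nth_drop_Suc list.inject)
  have "ptime (\<lambda>x. case drop (n x) (l x) of [] \<Rightarrow> n x | y # _ \<Rightarrow> y)"
    by (intro ptime_case_list ptime_drop assms ptime_const ptime_fst ptime_snd ptime_id)
  then show ?thesis by (simp add: *)
qed

lemma ptime_eq_prod:
  "ptime (\<lambda>x. fst (f x) = fst (g x)) \<Longrightarrow> ptime (\<lambda>x. snd (f x) = snd (g x)) \<Longrightarrow> ptime (\<lambda>x. f x = g x)"
  unfolding prod_eq_iff by (rule ptime_conj)

lemmas ptime_intros' = ptime_intros ptime_label ptime_eq_prod

lemma ptime_mem_item: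
  assumes "ptime f" "ptime l" shows "ptime (\<lambda>x. f x \<in> set (l x :: item list))"
proof -
  have "ptime (\<lambda>x. \<exists>y\<in>set (l x). y = f x)"
    by (intro ptime_intros' assms(2) ptime_comp[OF assms(1)])
  then show ?thesis by simp
qed

lemma ptime_claws: "ptime f \<Longrightarrow> ptime (\<lambda>x. claws (f x))"
  by (rule ptime_comp[of claws f]) (unfold claws_def claw_def meets_def, intro ptime_intros')

lemma ptime_branch: "ptime f \<Longrightarrow> ptime g \<Longrightarrow> ptime (\<lambda>x. branch (f x) (g x))"
  by (rule ptime_comp2[of branch f g]) (unfold branch_def, intro ptime_intros' ptime_claws)

lemma ptime_prune: "ptime f \<Longrightarrow> ptime (\<lambda>x. prune (f x))"
  by (rule ptime_comp[of prune f]) (unfold prune_def, intro ptime_intros' ptime_claws)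

lemma ptime_by_multiplicity: "ptime f \<Longrightarrow> ptime (\<lambda>x. by_multiplicity (f x))"
  by (rule ptime_comp[of by_multiplicity f]) (unfold by_multiplicity_def, intro ptime_intros')

lemma ptime_foldl_branch:
  assumes "ptime f" "ptime g" shows "ptime (\<lambda>x. foldl branch (f x) (g x))"
proof (rule ptime_foldl[where B = "\<lambda>x. size_of (f x)"])
  show "size_of (foldl branch (f x) (take n (g x))) \<le> size_of (f x)" for x n
    using foldl_branch_filter[of "f x" "take n (g x)"] size_of_filter by metis
qed (intro assms ptime_branch ptime_intros ptime_size)+

lemma ptime_funpow_prune:
  assumes "ptime f" "ptime g" shows "ptime (\<lambda>x. (prune ^^ f x) (g x))"
proof (rule ptime_funpow[where B = "\<lambda>x. size_of (g x)"])
  show "size_of ((prune ^^ m) (g x)) \<le> size_of (g x)" for x m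
    using funpow_prune_filter[of m "g x"] size_of_filter by metis
qed (intro assms ptime_prune ptime_intros ptime_size)+

text \<open>Polynomial bounds must hold for all encodable inputs, also for item lists with vertices
  beyond \<open>n\<close>. Such a vertex may become a label, hence the bound \<open>b\<close>
  instead of \<open>n\<close>.\<close>

lemma kruskal_state_bounds:
  assumes "\<And>z. z \<in> set L \<Longrightarrow> fst (snd z) \<le> b \<and> snd (snd z) \<le> b" "n \<le> b"
  shows "let s = foldl kruskal_step ([0..<n], []) L in
    length (fst s) = n \<and> (\<forall>c\<in>set (fst s). c \<le> b) \<and> set (snd s) \<subseteq> set L \<and> length (snd s) \<le> length L"
  using assms(1)
proof (induction L rule: rev_induct)
  case Nil
  then show ?case using assms(2) by auto
next
  case (snoc z L)
  obtain l K where lK: "foldl kruskal_step ([0..<n], []) L = (l, K)" by fastforce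
  have IH: "length l = n" "\<And>c. c \<in> set l \<Longrightarrow> c \<le> b" "set K \<subseteq> set L" "length K \<le> length L"
    using snoc.IH[OF snoc.prems] unfolding lK Let_def by simp_all
  have "label l (snd (snd z)) \<le> b"
    using snoc.prems[of z] IH(2)[of "l ! snd (snd z)"] by (auto simp: label_def nth_default_def)
  then have bound: "c \<le> b" if "c \<in> set (map (\<lambda>c. if c = a then label l (snd (snd z)) else c) l)" for a c
    using that IH(2) by (simp only: set_map) (elim imageE, simp split: if_splits)
  obtain l' K' where step: "kruskal_step (l, K) z = (l', K')" "length l' = n" "\<And>c. c \<in> set l' \<Longrightarrow> c \<le> b"
      "set K' \<subseteq> insert z (set K)" "length K' \<le> Suc (length K)"
  proof (cases "\<exists>y\<in>set K. snd y = snd z")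
    case True
    then have "kruskal_step (l, K) z = (l, z # K)" by (simp add: kruskal_step_def)
    then show ?thesis using IH(1,2) by (rule that) simp_all
  next
    case new: False
    show ?thesis
    proof (cases "label l (fst (snd z)) = label l (snd (snd z))")
      case True
      then have "kruskal_step (l, K) z = (l, K)" using new by (simp add: kruskal_step_def)
      then show ?thesis using IH(1,2) by (rule that) (simp_all add: subset_insertI)
    next
      case False
      then have "kruskal_step (l, K) z =
          (map (\<lambda>c. if c = label l (fst (snd z)) then label l (snd (snd z)) else c) l, z # K)"
        using new by (simp add: kruskal_step_def)
      then show ?thesis by (rule that) (simp add: IH(1), rule bound, simp_all)
    qed
  qed
  have "set K' \<subseteq> set (L @ [z])" using step(4) IH(3) by (simp, blast)
  then show ?case unfolding foldl_append foldl.simps lK step(1) Let_def fst_conv snd_conv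
    using step(2,3,5) IH(4) by (intro conjI ballI) simp_all
qed

lemma ptime_kruskal:
  assumes "ptime f" "ptime g" shows "ptime (\<lambda>x. kruskal (f x) (g x))"
proof -
  let ?L = "\<lambda>x. by_multiplicity (g x)"
  let ?b = "\<lambda>x. size_of (f x) + size_of (?L x)"
  let ?B = "\<lambda>x. 1 + (1 + size_of (f x) * (1 + (2 * ?b x + 1))) + (1 + size_of (?L x) * (1 + size_of (?L x)))"
  have L: "ptime ?L" by (intro ptime_by_multiplicity assms)
  have "ptime (\<lambda>x. foldl kruskal_step ([0..<f x], []) (?L x))"
  proof (rule ptime_foldl[where B = ?B])
    show "ptime (\<lambda>z. kruskal_step (fst (snd z)) (snd (snd z)))"
      unfolding kruskal_step_def by (intro ptime_intros')
    show "poly_bounded ?B"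
      by (intro poly_bounded_intros ptime_size assms L)
    fix x n
    let ?T = "take n (?L x)"
    have "fst (snd z) \<le> ?b x \<and> snd (snd z) \<le> ?b x" if "z \<in> set ?T" for z
    proof -
      have "size_of z < size_of (?L x)" using in_set_takeD[OF that] by (rule size_of_mem)
      then show ?thesis by (cases z) simp
    qed
    then have "let s = foldl kruskal_step ([0..<f x], []) ?T in
        length (fst s) = f x \<and> (\<forall>c\<in>set (fst s). c \<le> ?b x) \<and> set (snd s) \<subseteq> set ?T \<and> length (snd s) \<le> length ?T"
      by (rule kruskal_state_bounds) simp_all
    moreover obtain l K where lK: "foldl kruskal_step ([0..<f x], []) ?T = (l, K)" by fastforce
    ultimately have s: "length l = f x" "\<And>c. c \<in> set l \<Longrightarrow> c \<le> ?b x" "set K \<subseteq> set ?T" "length K \<le> length ?T"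
      by (simp_all add: Let_def)
    have "size_of l \<le> 1 + length l * (1 + (2 * ?b x + 1))"
    proof (rule size_of_list_le)
      fix c assume "c \<in> set l"
      then have "c \<le> ?b x" by (rule s(2))
      then show "size_of c \<le> 2 * ?b x + 1" 
        unfolding size_of_nat[of c] by (intro add_right_mono mult_le_mono2)
    qed
    also have "\<dots> \<le> 1 + size_of (f x) * (1 + (2 * ?b x + 1))"
      unfolding s(1) by (intro add_mono mult_right_mono) simp_all
    finally have l: "size_of l \<le> 1 + size_of (f x) * (1 + (2 * ?b x + 1))" .
    have "size_of K \<le> 1 + length K * (1 + size_of (?L x))"
    proof (rule size_of_list_le)
      fix z assume "z \<in> set K"
      then have "z \<in> set (?L x)" using s(3) in_set_takeD by fast
      then show "size_of z \<le> size_of (?L x)" using size_of_mem less_imp_le by blast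
    qed
    also have "\<dots> \<le> 1 + size_of (?L x) * (1 + size_of (?L x))"
      using s(4) length_less_size_of[of "?L x"] by (intro add_mono mult_right_mono) simp_all
    finally have K: "size_of K \<le> 1 + size_of (?L x) * (1 + size_of (?L x))" .
    show "size_of (foldl kruskal_step ([0..<f x], []) ?T) \<le> ?B x"
      unfolding lK enc_Pair nodes.simps using add_mono[OF add_mono[OF order_refl l] K] .
  qed (intro assms ptime_intros L)+
  then show ?thesis unfolding kruskal_def by (intro ptime_snd)
qed


section \<open>Matrices with at most two ones per row\<close>

lemma sorting_permutation:
  fixes key :: "nat \<Rightarrow> int"
  obtains \<pi> where "\<pi> permutes {..<m}" "\<And>i j. i \<le> j \<Longrightarrow> j < m \<Longrightarrow> key (\<pi> i) \<le> key (\<pi> j)"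
proof -
  define xs where "xs = sort_key key [0..<m]"
  have xs: "length xs = m" "distinct xs" "set xs = {..<m}" "sorted (map key xs)"
    unfolding xs_def by auto
  define \<pi> where "\<pi> i = (if i < m then xs ! i else i)" for i
  have "\<pi> permutes {..<m}"
  proof (rule inj_imp_permutes)
    show "inj_on \<pi> {..<m}"
      using xs(1,2) by (auto simp: \<pi>_def inj_on_def nth_eq_iff_index_eq)
    show "\<pi> x \<in> {..<m}" if "x \<in> {..<m}" for x
      using that xs(1,3) nth_mem[of x xs] by (auto simp: \<pi>_def)
  qed (auto simp: \<pi>_def)
  moreover have "key (\<pi> i) \<le> key (\<pi> j)" if "i \<le> j" "j < m" for i j
    using sorted_nth_mono[OF xs(4), of i j] that xs(1) by (simp add: \<pi>_def)
  ultimately show ?thesis by (rule that)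
qed

text \<open>Sorting the columns by \<open>key\<close> turns an interval of keys into a block of
  columns. Keys may repeat, and a row without ones is given by an empty interval.\<close>

lemma C1P_rowsI:
  fixes key lo hi :: "nat \<Rightarrow> int"
  assumes "\<And>i j. i < dim_row M \<Longrightarrow> j < dim_col M \<Longrightarrow> M $$ (i, j) \<longleftrightarrow> lo i \<le> key j \<and> key j \<le> hi i"
  shows "C1P_rows M"
proof -
  obtain \<pi> where \<pi>: "\<pi> permutes {..<dim_col M}"
      "\<And>i j. i \<le> j \<Longrightarrow> j < dim_col M \<Longrightarrow> key (\<pi> i) \<le> key (\<pi> j)"
    using sorting_permutation[of "dim_col M" key] by blast
  have "consecutive_ones (row (permute_cols \<pi> M) i)" if i: "i < dim_row M" for i
    unfolding consecutive_ones_def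
  proof (intro allI impI)
    fix a b c
    assume *: "a < b \<and> b < c \<and> c < dim_vec (row (permute_cols \<pi> M) i) \<and>
      row (permute_cols \<pi> M) i $ a \<and> row (permute_cols \<pi> M) i $ c"
    then have abc: "a < b" "b < c" "c < dim_col M" by (auto simp: permute_cols_def)
    have val: "row (permute_cols \<pi> M) i $ j \<longleftrightarrow> lo i \<le> key (\<pi> j) \<and> key (\<pi> j) \<le> hi i"
      if "j < dim_col M" for j
      using that i assms[OF i, of "\<pi> j"] permutes_in_image[OF \<pi>(1), of j] by (simp add: permute_cols_def)
    show "row (permute_cols \<pi> M) i $ b"
      using * val[of a] val[of b] val[of c] abc \<pi>(2)[of a b] \<pi>(2)[of b c] by auto
  qed
  then show ?thesis unfolding C1P_rows_def using \<pi>(1) by blast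
qed

section \<open>Exchanging rows and columns\<close>

lemma C1P_cols_transpose: "C1P_cols M \<longleftrightarrow> C1P_rows (transpose_mat M)"
proof -
  have "col (permute_rows \<pi> M) j = row (permute_cols \<pi> (transpose_mat M)) j"
    if "\<pi> permutes {..<dim_row M}" "j < dim_col M" for \<pi> j
  proof (rule eq_vecI)
    fix i assume "i < dim_vec (row (permute_cols \<pi> (transpose_mat M)) j)"
    then have "i < dim_row M" by (simp add: permute_cols_def)
    then show "col (permute_rows \<pi> M) j $ i = row (permute_cols \<pi> (transpose_mat M)) j $ i"
      using that permutes_in_image[OF that(1), of i] by (simp add: permute_cols_def permute_rows_def)
  qed (simp add: permute_cols_def permute_rows_def)
  then show ?thesis unfolding C1P_cols_def C1P_rows_def by auto
qed

lemma SC1P_transpose: "SC1P (transpose_mat M) \<longleftrightarrow> SC1P M"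
  unfolding SC1P_def C1P_cols_transpose by auto

lemma SC1P_solution_transpose:
  "SC1P_solution (transpose_mat M) (prod.swap ` F) \<longleftrightarrow> SC1P_solution M F"
proof -
  have ones: "ones (transpose_mat M) = prod.swap ` ones M"
    by (force simp: ones_def)
  have "flip_to_zero (transpose_mat M) (prod.swap ` F) = transpose_mat (flip_to_zero M F)"
    by (rule eq_matI) (auto simp: flip_to_zero_def)
  then show ?thesis
    unfolding SC1P_solution_def ones using SC1P_transpose inj_image_subset_iff[OF inj_swap] by metis
qed

lemma star_two_transpose: "star_two (transpose_mat M) \<longleftrightarrow> two_star M"
proof -
  have "{j. j < dim_row M \<and> transpose_mat M $$ (i, j)} = {j. j < dim_row M \<and> M $$ (j, i)}"
    if "i < dim_col M" for i
    using that by auto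
  then show ?thesis unfolding star_two_def two_star_def by simp
qed

definition edge_rows :: "bool mat \<Rightarrow> item set" where
  "edge_rows M = {(i, u, v). i < dim_row M \<and> u < v \<and> {j. j < dim_col M \<and> M $$ (i, j)} = {u, v}}"

lemma card_le_2_cases:
  assumes "finite S" "card S \<le> 2"
  obtains "S = {}" | u where "S = {u}" | u v where "u < (v :: nat)" "S = {u, v}"
proof -
  consider "card S = 0" | "card S = 1" | "card S = 2" using assms(2) by linarith
  then show thesis
  proof cases
    case 1 then show ?thesis using assms(1) that(1) by simp
  next
    case 2 then show ?thesis using that(2) by (auto simp: card_1_singleton_iff)
  next
    case 3
    then obtain u v where uv: "S = {u, v}" "u \<noteq> v" by (auto simp: card_2_iff)
    show ?thesis
    proof (cases "u < v")
      case False
      then show ?thesis using that(3)[of v u] uv by (simp add: insert_commute)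
    qed (use that(3) uv in blast)
  qed
qed

text \<open>
  Columns are sorted by their position \<open>p\<close>.  Rows are sorted by the sum of the positions of their
  two ones (by twice the position of their only one): the rows with a one in column \<open>j\<close> are exactly
  those with a key in \<open>[2 * p j - 1, 2 * p j + 1]\<close>.
\<close>

lemma midpoint_iff:
  fixes a b c :: int
  assumes "\<bar>a - b\<bar> = 1"
  shows "2 * c - 1 \<le> a + b \<and> a + b \<le> 2 * c + 1 \<longleftrightarrow> c = a \<or> c = b"
  using assms by presburger

lemma SC1P_if_linear_layout:
  assumes "star_two M" "linear_layout (snd ` edge_rows M)"
  shows "SC1P M"
proof -
  obtain p :: "nat \<Rightarrow> int" where p: "inj p" "\<And>u v. (u, v) \<in> snd ` edge_rows M \<Longrightarrow> \<bar>p u - p v\<bar> = 1"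
    using assms(2) unfolding linear_layout_def by blast
  have p_eq: "p x = p y \<longleftrightarrow> x = y" for x y using p(1) by (auto dest: injD)
  define S where "S i = {j. j < dim_col M \<and> M $$ (i, j)}" for i
  have S: "finite (S i)" for i unfolding S_def by simp
  have S2: "card (S i) \<le> 2" if "i < dim_row M" for i
    using assms(1) that unfolding star_two_def S_def by simp
  have adj: "\<bar>p u - p v\<bar> = 1" if "i < dim_row M" "u < v" "S i = {u, v}" for i u v
  proof -
    have "(i, u, v) \<in> edge_rows M" using that unfolding edge_rows_def S_def by simp
    then show ?thesis using p(2)[of u v] by force
  qed
  have "\<exists>r. i < dim_row M \<longrightarrow> (\<forall>j. j \<in> S i \<longleftrightarrow> fst r \<le> p j \<and> p j \<le> snd r)" for i
  proof (cases "i < dim_row M")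
    case i: True
    show ?thesis
    proof (cases rule: card_le_2_cases[OF S S2[OF i]])
      case 1
      show ?thesis unfolding 1 by (rule exI[of _ "(1, 0)"]) simp
    next
      case (2 u)
      have "j \<in> {u} \<longleftrightarrow> p u \<le> p j \<and> p j \<le> p u" for j
        unfolding singleton_iff p_eq[symmetric] by linarith
      then show ?thesis unfolding 2 by (intro exI[of _ "(p u, p u)"]) simp
    next
      case (3 u v)
      have "j \<in> {u, v} \<longleftrightarrow> min (p u) (p v) \<le> p j \<and> p j \<le> max (p u) (p v)" for j
        unfolding insert_iff empty_iff p_eq[symmetric] using adj[OF i 3]
        by (cases "p u \<le> p v"; simp add: min_def max_def; linarith)
      then show ?thesis unfolding 3 by (intro exI[of _ "(min (p u) (p v), max (p u) (p v))"]) simp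
    qed
  qed simp
  then have "\<exists>r. \<forall>i. i < dim_row M \<longrightarrow> (\<forall>j. j \<in> S i \<longleftrightarrow> fst (r i) \<le> p j \<and> p j \<le> snd (r i))"
    by (intro choice allI)
  then obtain r where r: "\<And>i j. i < dim_row M \<Longrightarrow> j \<in> S i \<longleftrightarrow> fst (r i) \<le> p j \<and> p j \<le> snd (r i)"
    by (elim exE) (simp only: simp_thms)
  have "C1P_rows M"
  proof (rule C1P_rowsI)
    show "M $$ (i, j) \<longleftrightarrow> fst (r i) \<le> p j \<and> p j \<le> snd (r i)" if "i < dim_row M" "j < dim_col M" for i j
      unfolding r[OF that(1), symmetric] using that(2) unfolding S_def by simp
  qed
  have "\<exists>k. i < dim_row M \<longrightarrow> (\<forall>j<dim_col M. j \<in> S i \<longleftrightarrow> 2 * p j - 1 \<le> k \<and> k \<le> 2 * p j + 1)" for i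
  proof (cases "i < dim_row M")
    case i: True
    show ?thesis
    proof (cases rule: card_le_2_cases[OF S S2[OF i]])
      case 1
      \<comment> \<open>An empty row is placed behind the intervals of all columns.\<close>
      define k where "k = Max (insert 0 ((\<lambda>j. 2 * p j + 1) ` {..<dim_col M})) + 1"
      have "2 * p j + 1 < k" if "j < dim_col M" for j
      proof -
        have "2 * p j + 1 \<le> Max (insert 0 ((\<lambda>j. 2 * p j + 1) ` {..<dim_col M}))"
          using that by (intro Max_ge) auto
        then show ?thesis unfolding k_def by linarith
      qed
      then have "\<not> k \<le> 2 * p j + 1" if "j < dim_col M" for j using that by (simp add: not_le)
      then show ?thesis unfolding 1 by (intro exI[of _ k] impI allI) (simp only: empty_iff simp_thms)
    next
      case (2 u)
      have "j \<in> {u} \<longleftrightarrow> 2 * p j - 1 \<le> 2 * p u \<and> 2 * p u \<le> 2 * p j + 1" for j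
        unfolding singleton_iff p_eq[symmetric] by linarith
      then show ?thesis unfolding 2 by (intro exI[of _ "2 * p u"] impI allI)
    next
      case (3 u v)
      have "j \<in> {u, v} \<longleftrightarrow> 2 * p j - 1 \<le> p u + p v \<and> p u + p v \<le> 2 * p j + 1" for j
        unfolding insert_iff empty_iff p_eq[symmetric] midpoint_iff[OF adj[OF i 3]] by simp
      then show ?thesis unfolding 3 by (intro exI[of _ "p u + p v"] impI allI)
    qed
  qed simp
  then have "\<exists>k. \<forall>i. i < dim_row M \<longrightarrow>
      (\<forall>j<dim_col M. j \<in> S i \<longleftrightarrow> 2 * p j - 1 \<le> k i \<and> k i \<le> 2 * p j + 1)"
    by (intro choice allI)
  then obtain k where k: "\<And>i j. i < dim_row M \<Longrightarrow> j < dim_col M \<Longrightarrow>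
      j \<in> S i \<longleftrightarrow> 2 * p j - 1 \<le> k i \<and> k i \<le> 2 * p j + 1"
    by (elim exE) (simp only: simp_thms)
  have "C1P_rows (transpose_mat M)"
  proof (rule C1P_rowsI)
    fix j i assume "j < dim_row (transpose_mat M)" "i < dim_col (transpose_mat M)"
    then have ij: "i < dim_row M" "j < dim_col M" by simp_all
    then have "transpose_mat M $$ (j, i) \<longleftrightarrow> j \<in> S i" unfolding S_def by simp
    then show "transpose_mat M $$ (j, i) \<longleftrightarrow> 2 * p j - 1 \<le> k i \<and> k i \<le> 2 * p j + 1"
      unfolding k[OF ij] .
  qed
  then show ?thesis using \<open>C1P_rows M\<close> unfolding SC1P_def C1P_cols_transpose by blast
qed

text \<open>The inverse of the column permutation is the layout: a gap between the only two ones of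
  a row would have to be filled by a third. It is the identity beyond the columns, hence injective
  on all vertices.\<close>

lemma linear_layout_if_C1P_rows:
  assumes "C1P_rows M" shows "linear_layout (snd ` edge_rows M)"
proof -
  obtain \<pi> where \<pi>: "\<pi> permutes {..<dim_col M}"
      "\<And>i. i < dim_row M \<Longrightarrow> consecutive_ones (row (permute_cols \<pi> M) i)"
    using assms unfolding C1P_rows_def by blast
  define \<sigma> where "\<sigma> = inv_into UNIV \<pi>"
  have \<sigma>: "\<sigma> permutes {..<dim_col M}" unfolding \<sigma>_def using permutes_inv[OF \<pi>(1)] .
  have inverses: "\<pi> (\<sigma> z) = z" "\<sigma> (\<pi> z) = z" for z
    unfolding \<sigma>_def using permutes_inverses[OF \<pi>(1)] by blast+
  define p where "p u = int (\<sigma> u)" for u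
  have "inj \<sigma>" using \<sigma> by (rule permutes_inj)
  then have inj: "inj p" unfolding p_def by (simp add: inj_def)
  have less: "\<sigma> y = \<sigma> x + 1"
    if i: "i < dim_row M" and S: "{j. j < dim_col M \<and> M $$ (i, j)} = {x, y}" and xy: "\<sigma> x < \<sigma> y" for i x y
  proof (rule ccontr)
    assume "\<not> ?thesis"
    then have b: "\<sigma> x < \<sigma> x + 1" "\<sigma> x + 1 < \<sigma> y" using xy by simp_all
    have n: "x < dim_col M" "y < dim_col M" "M $$ (i, x)" "M $$ (i, y)" using S by blast+
    have ny: "\<sigma> y < dim_col M"
      using permutes_in_image[OF \<sigma>, of y] n by simp
    have val: "row (permute_cols \<pi> M) i $ j \<longleftrightarrow> M $$ (i, \<pi> j)" if "j < dim_col M" for j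
      using that i by (simp add: permute_cols_def)
    have "row (permute_cols \<pi> M) i $ (\<sigma> x + 1)"
      using \<pi>(2)[OF i, unfolded consecutive_ones_def, rule_format, of "\<sigma> x" "\<sigma> x + 1" "\<sigma> y"]
        b ny n val[of "\<sigma> x"] val[of "\<sigma> y"] inverses(1) by (simp add: permute_cols_def)
    then have "M $$ (i, \<pi> (\<sigma> x + 1))" using val b ny by simp
    moreover have "\<pi> (\<sigma> x + 1) < dim_col M"
      using permutes_in_image[OF \<pi>(1), of "\<sigma> x + 1"] b ny by simp
    ultimately have "\<pi> (\<sigma> x + 1) \<in> {x, y}" using S by blast
    then have "\<sigma> x + 1 = \<sigma> x \<or> \<sigma> x + 1 = \<sigma> y"
      using inverses(2)[of "\<sigma> x + 1"] by auto
    then show False using b by simp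
  qed
  have "\<bar>p u - p v\<bar> = 1" if uv: "(u, v) \<in> snd ` edge_rows M" for u v
  proof -
    obtain i where i: "i < dim_row M" "u < v" "{j. j < dim_col M \<and> M $$ (i, j)} = {u, v}"
      using uv unfolding edge_rows_def by auto
    have "\<sigma> u \<noteq> \<sigma> v" using \<open>inj \<sigma>\<close> i(2) by (auto dest: injD)
    then consider "\<sigma> u < \<sigma> v" | "\<sigma> v < \<sigma> u" by linarith
    then show ?thesis
    proof cases
      case 1
      then show ?thesis using less[OF i(1,3)] unfolding p_def by simp
    next
      case 2
      then show ?thesis using less[OF i(1), of v u] i(3) unfolding p_def by (simp add: insert_commute)
    qed
  qed
  then show ?thesis unfolding linear_layout_def using inj by blast
qed

section \<open>Flip sets and deleted edges\<close>

lemma flip_to_zero_simps: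
  "dim_row (flip_to_zero M F) = dim_row M" "dim_col (flip_to_zero M F) = dim_col M"
  "i < dim_row M \<Longrightarrow> j < dim_col M \<Longrightarrow> flip_to_zero M F $$ (i, j) \<longleftrightarrow> M $$ (i, j) \<and> (i, j) \<notin> F"
  unfolding flip_to_zero_def by simp_all

lemma finite_ones: "finite (ones M)"
  by (rule finite_subset[of _ "{..<dim_row M} \<times> {..<dim_col M}"]) (auto simp: ones_def)

lemma inj_on_fst_edge_rows: "inj_on fst (edge_rows M)"
proof (rule inj_onI)
  fix y z assume yz: "y \<in> edge_rows M" "z \<in> edge_rows M" "fst y = fst z"
  obtain i u v u' v' where z: "z = (i, u, v)" "y = (i, u', v')" using yz(3) by (cases y, cases z) simp
  have "u < v" "u' < v'" "{u, v} = {u', v'}" using yz(1,2) unfolding z edge_rows_def by simp_all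
  then show "y = z" unfolding z doubleton_eq_iff by auto
qed

text \<open>A flip can destroy only the edge of its own row, so the edge rows touched by
  \<open>F\<close> form the deletion, and untouched rows keep their edges.\<close>

lemma deletable_if_SC1P_solution:
  assumes "SC1P_solution M F"
  obtains X where "deletable (edge_rows M) X" "card X \<le> card F"
proof
  let ?X = "{z \<in> edge_rows M. fst z \<in> fst ` F}"
  have "F \<subseteq> ones M" "SC1P (flip_to_zero M F)" using assms unfolding SC1P_solution_def by simp_all
  have F: "finite F" using \<open>F \<subseteq> ones M\<close> finite_ones by (rule finite_subset)
  have "linear_layout (snd ` edge_rows (flip_to_zero M F))"
    using \<open>SC1P (flip_to_zero M F)\<close> unfolding SC1P_def by (intro linear_layout_if_C1P_rows) simp
  moreover have "edge_rows M - ?X \<subseteq> edge_rows (flip_to_zero M F)"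
  proof
    fix z assume z: "z \<in> edge_rows M - ?X"
    obtain i u v where iuv: "z = (i, u, v)" by (cases z)
    have i: "i < dim_row M" "i \<notin> fst ` F" "u < v" "{j. j < dim_col M \<and> M $$ (i, j)} = {u, v}"
      using z unfolding iuv edge_rows_def by simp_all
    have "(i, j) \<notin> F" for j using i(2) by (metis fst_conv imageI)
    then have "{j. j < dim_col M \<and> flip_to_zero M F $$ (i, j)} = {j. j < dim_col M \<and> M $$ (i, j)}"
      using i(1) by (intro Collect_cong conj_cong refl) (simp add: flip_to_zero_simps)
    then have "{j. j < dim_col M \<and> flip_to_zero M F $$ (i, j)} = {u, v}"
      using i(4) by (rule trans)
    then show "z \<in> edge_rows (flip_to_zero M F)"
      using i(1,3) unfolding iuv edge_rows_def flip_to_zero_def by simp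
  qed
  ultimately have "linear_layout (snd ` (edge_rows M - ?X))"
    by (rule linear_layout_mono[OF _ image_mono])
  then show "deletable (edge_rows M) ?X"
    unfolding deletable_def by simp
  have "card ?X = card (fst ` ?X)"
    by (rule card_image[symmetric], rule inj_on_subset[OF inj_on_fst_edge_rows[of M]]) simp
  also have "\<dots> \<le> card (fst ` F)"
    using F by (intro card_mono finite_imageI image_subsetI) simp_all
  also have "\<dots> \<le> card F" using F by (rule card_image_le)
  finally show "card ?X \<le> card F" .
qed

text \<open>Additional flips only remove further edges, so \<open>F\<close> merely has to hit every
  row of \<open>X\<close>. The decision needs one flip per deleted row, whereas the approximation
  flips all ones of such a row.\<close>

lemma SC1P_solution_if_deletable:
  assumes M: "star_two M" and X: "deletable (edge_rows M) X"
    and F: "F \<subseteq> ones M" "fst ` X \<subseteq> fst ` F"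
  shows "SC1P_solution M F"
proof -
  let ?N = "flip_to_zero M F"
  have sub: "{j. j < dim_col ?N \<and> ?N $$ (i, j)} \<subseteq> {j. j < dim_col M \<and> M $$ (i, j)}" if "i < dim_row M" for i
    using that by (auto simp: flip_to_zero_simps)
  have c2: "card {j. j < dim_col M \<and> M $$ (i, j)} \<le> 2" if "i < dim_row M" for i
    using M that unfolding star_two_def by simp
  have "star_two ?N"
    unfolding star_two_def
  proof (intro allI impI)
    fix i assume "i < dim_row ?N"
    then have i: "i < dim_row M" by (simp add: flip_to_zero_simps)
    show "card {j. j < dim_col ?N \<and> ?N $$ (i, j)} \<le> 2"
      by (rule order_trans[OF card_mono[OF _ sub[OF i]] c2[OF i]]) simp
  qed
  moreover have "edge_rows ?N \<subseteq> edge_rows M - X"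
  proof
    fix z assume z: "z \<in> edge_rows ?N"
    obtain i u v where iuv: "z = (i, u, v)" by (cases z)
    have i: "i < dim_row M" "u < v" and N: "{j. j < dim_col ?N \<and> ?N $$ (i, j)} = {u, v}"
      using z unfolding iuv edge_rows_def by (simp_all add: flip_to_zero_simps)
    \<comment> \<open>A row that still has two ones had no others before, so it is
      unchanged.\<close>
    have row: "{j. j < dim_col M \<and> M $$ (i, j)} = {u, v}"
      using card_seteq[OF _ sub[OF i(1), unfolded N]] c2[OF i(1)] i(2) by simp
    have "z \<notin> X"
    proof
      assume "z \<in> X"
      then have "i \<in> fst ` F" using F(2) iuv by force
      then obtain j where j: "(i, j) \<in> F" by force
      then have "j < dim_col M" "M $$ (i, j)" using F(1) unfolding ones_def by auto
      then have "j \<in> {j. j < dim_col ?N \<and> ?N $$ (i, j)}" unfolding N using row by blast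
      then have "flip_to_zero M F $$ (i, j)" by simp
      then show False using j i(1) \<open>j < dim_col M\<close> by (simp add: flip_to_zero_simps)
    qed
    then show "z \<in> edge_rows M - X" using i row unfolding iuv edge_rows_def by simp
  qed
  ultimately have "SC1P ?N"
    using X SC1P_if_linear_layout linear_layout_mono[OF _ image_mono] unfolding deletable_def by metis
  then show ?thesis unfolding SC1P_solution_def using F(1) by blast
qed

lemma SC1P_solution_iff_deletable:
  assumes "star_two M"
  shows "(\<exists>F. SC1P_solution M F \<and> card F \<le> d) \<longleftrightarrow> (\<exists>X. deletable (edge_rows M) X \<and> card X \<le> d)"
proof
  assume "\<exists>F. SC1P_solution M F \<and> card F \<le> d"
  then show "\<exists>X. deletable (edge_rows M) X \<and> card X \<le> d"
    using deletable_if_SC1P_solution order_trans by metis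
next
  assume "\<exists>X. deletable (edge_rows M) X \<and> card X \<le> d"
  then obtain X where X: "deletable (edge_rows M) X" "card X \<le> d" by blast
  have XM: "X \<subseteq> edge_rows M" using X(1) unfolding deletable_def by blast
  let ?F = "(\<lambda>(i, u, v). (i, u)) ` X"
  have "?F \<subseteq> ones M" using XM unfolding edge_rows_def ones_def by auto
  moreover have "fst ` X \<subseteq> fst ` ?F" by force
  ultimately have "SC1P_solution M ?F" by (rule SC1P_solution_if_deletable[OF assms X(1)])
  moreover have "finite X"
  proof (rule finite_imageD)
    show "finite (fst ` X)"
      by (rule finite_subset[of _ "{..<dim_row M}"]) (use XM in \<open>auto simp: edge_rows_def\<close>)
    show "inj_on fst X" using inj_on_subset[OF inj_on_fst_edge_rows XM] .
  qed
  then have "card ?F \<le> card X" by (rule card_image_le)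
  ultimately show "\<exists>F. SC1P_solution M F \<and> card F \<le> d" using X(2) by fastforce
qed


section \<open>The algorithms on encoded matrices\<close>

definition row_ones :: "bool list \<Rightarrow> nat list" where
  "row_ones r = filter (\<lambda>j. nth_default False r j) [0..<length r]"

definition items :: "bool list list \<Rightarrow> item list" where
  "items B = map (\<lambda>i. (i, nth_default 0 (row_ones (nth_default [] B i)) 0, nth_default 0 (row_ones (nth_default [] B i)) 1))
     (filter (\<lambda>i. length (row_ones (nth_default [] B i)) = 2) [0..<length B])"

text \<open>The first row is measured because the dimensions themselves are given in binary. Without
  rows the result is 0, which is harmless: there are no items then.\<close>

definition width :: "bool list list \<Rightarrow> nat" where
  "width B = length (nth_default [] B 0)"

definition transpose_list :: "bool list list \<Rightarrow> bool list list" where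
  "transpose_list B = map (\<lambda>j. map (\<lambda>r. nth_default False r j) B) [0..<width B]"

definition rows_le_2 :: "bool list list \<Rightarrow> bool" where
  "rows_le_2 B \<longleftrightarrow> (\<forall>r\<in>set B. length (row_ones r) \<le> 2)"

definition orient :: "bool list list \<Rightarrow> bool list list" where
  "orient B = (if rows_le_2 B then B else transpose_list B)"

lemma mat_to_list_simps:
  "length (mat_to_list M) = dim_row M"
  "i < dim_row M \<Longrightarrow> nth_default [] (mat_to_list M) i = map (\<lambda>j. M $$ (i, j)) [0..<dim_col M]"
  "set (mat_to_list M) = (\<lambda>i. map (\<lambda>j. M $$ (i, j)) [0..<dim_col M]) ` {..<dim_row M}"
  unfolding mat_to_list_def by (auto simp: nth_default_def)

lemma row_ones_map: "row_ones (map f [0..<n]) = filter f [0..<n]"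
  unfolding row_ones_def by (rule filter_cong) (auto simp: nth_default_def)

lemma length_filter_upt: "length (filter f [0..<n]) = card {j. j < n \<and> f j}"
proof -
  have "length (filter f [0..<n]) = card (set (filter f [0..<n]))"
    by (rule distinct_card[symmetric]) simp
  also have "set (filter f [0..<n]) = {j. j < n \<and> f j}" by auto
  finally show ?thesis .
qed

lemma rows_le_2_mat: "rows_le_2 (mat_to_list M) \<longleftrightarrow> star_two M"
  unfolding rows_le_2_def mat_to_list_simps star_two_def by (auto simp: row_ones_map length_filter_upt)

lemma filter_upt_eq_pair:
  "filter f [0..<n] = [u, v] \<longleftrightarrow> u < v \<and> {j. j < n \<and> f j} = {u, v}"
proof
  assume l: "filter f [0..<n] = [u, v]"
  have "sorted_wrt (<) (filter f [0..<n])" by (simp add: sorted_wrt_filter)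
  moreover have "set (filter f [0..<n]) = {j. j < n \<and> f j}" by auto
  ultimately show "u < v \<and> {j. j < n \<and> f j} = {u, v}" unfolding l by simp
next
  assume uv: "u < v \<and> {j. j < n \<and> f j} = {u, v}"
  have "filter f [0..<n] = sorted_list_of_set (set (filter f [0..<n]))"
    by (rule sorted_list_of_set.idem_if_sorted_distinct[symmetric]) (simp_all add: sorted_wrt_filter)
  also have "set (filter f [0..<n]) = {u, v}" using uv by auto
  also have "sorted_list_of_set {u, v} = [u, v]" using uv by auto
  finally show "filter f [0..<n] = [u, v]" .
qed

lemma list_eq_pair_iff: "l = [u, v] \<longleftrightarrow> length l = 2 \<and> u = nth_default 0 l 0 \<and> v = nth_default 0 l 1"
proof
  assume "length l = 2 \<and> u = nth_default 0 l 0 \<and> v = nth_default 0 l 1"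
  moreover from this obtain a b where "l = [a, b]"
    by (metis (no_types) length_0_conv length_Suc_conv numeral_2_eq_2)
  ultimately show "l = [u, v]" by (simp add: nth_default_def)
qed (simp add: nth_default_def)

lemma set_items: "set (items (mat_to_list M)) = edge_rows M"
proof -
  have *: "(i, u, v) \<in> set (items (mat_to_list M)) \<longleftrightarrow> i < dim_row M \<and> filter (\<lambda>j. M $$ (i, j)) [0..<dim_col M] = [u, v]"
    for i u v
  proof (cases "i < dim_row M")
    case True
    have "row_ones (nth_default [] (mat_to_list M) i) = filter (\<lambda>j. M $$ (i, j)) [0..<dim_col M]"
      unfolding mat_to_list_simps(2)[OF True] row_ones_map ..
    then have "(i, u, v) \<in> set (items (mat_to_list M)) \<longleftrightarrow>
        (let l = filter (\<lambda>j. M $$ (i, j)) [0..<dim_col M] in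
         length l = 2 \<and> u = nth_default 0 l 0 \<and> v = nth_default 0 l 1)"
      using True unfolding items_def Let_def set_map image_iff by (simp add: mat_to_list_simps(1))
    then show ?thesis using True unfolding list_eq_pair_iff Let_def by simp
  next
    case False
    then show ?thesis unfolding items_def set_map image_iff by (simp add: mat_to_list_simps(1))
  qed
  have "x \<in> set (items (mat_to_list M)) \<longleftrightarrow> x \<in> edge_rows M" for x
    by (cases x) (simp only: * filter_upt_eq_pair edge_rows_def mem_Collect_eq case_prod_conv)
  then show ?thesis by blast
qed

lemma proper_items_mat: "proper_items (width (mat_to_list M)) (items (mat_to_list M))"
  unfolding proper_items_def
proof
  show "distinct (items (mat_to_list M))"
    unfolding items_def by (simp add: distinct_map inj_on_def)
  show "\<forall>z\<in>set (items (mat_to_list M)). fst (snd z) < snd (snd z) \<and> snd (snd z) < width (mat_to_list M)"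
  proof
    fix z assume "z \<in> set (items (mat_to_list M))"
    moreover obtain i u v where z: "z = (i, u, v)" by (cases z)
    ultimately have *: "i < dim_row M" "u < v" "{j. j < dim_col M \<and> M $$ (i, j)} = {u, v}"
      unfolding set_items edge_rows_def by auto
    have "v < dim_col M" using *(3) by blast
    moreover have "width (mat_to_list M) = dim_col M"
      unfolding width_def using mat_to_list_simps(2)[of 0 M] *(1) by simp
    ultimately show "fst (snd z) < snd (snd z) \<and> snd (snd z) < width (mat_to_list M)"
      using *(2) z by simp
  qed
qed

lemma transpose_list_mat:
  assumes "0 < dim_row M"
  shows "transpose_list (mat_to_list M) = mat_to_list (transpose_mat M)"
proof -
  have "width (mat_to_list M) = dim_col M"
    unfolding width_def mat_to_list_simps(2)[OF assms] by simp
  then show ?thesis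
    unfolding transpose_list_def mat_to_list_def by (auto simp: nth_default_def)
qed

definition oriented_mat :: "bool mat \<Rightarrow> bool mat" where
  "oriented_mat M = (if star_two M then M else transpose_mat M)"

lemma orient_mat: "orient (mat_to_list M) = mat_to_list (oriented_mat M)"
proof (cases "star_two M")
  case False
  \<comment> \<open>Some row violates the bound on the ones, so a first row exists from which
    \<open>transpose_list\<close> can read the width.\<close>
  then have "0 < dim_row M" unfolding star_two_def by force
  then show ?thesis using False transpose_list_mat by (simp add: orient_def oriented_mat_def rows_le_2_mat)
qed (simp add: orient_def oriented_mat_def rows_le_2_mat)

lemma star_two_oriented: "two_star M \<or> star_two M \<Longrightarrow> star_two (oriented_mat M)"
  unfolding oriented_mat_def using star_two_transpose[of M] by auto

lemma SC1P_solution_oriented: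
  "(\<exists>F. SC1P_solution (oriented_mat M) F \<and> card F \<le> d) \<longleftrightarrow> (\<exists>F. SC1P_solution M F \<and> card F \<le> d)"
proof -
  have card: "card (prod.swap ` F) = card F" for F :: "(nat \<times> nat) set"
    by (rule card_image) simp
  have swap: "prod.swap ` prod.swap ` F = F" for F :: "(nat \<times> nat) set"
    by (simp add: image_image)
  show ?thesis
  proof (cases "star_two M")
    case False
    show ?thesis
    proof
      assume "\<exists>F. SC1P_solution (oriented_mat M) F \<and> card F \<le> d"
      then obtain F where F: "SC1P_solution (transpose_mat M) F" "card F \<le> d"
        using False unfolding oriented_mat_def by auto
      then have "SC1P_solution M (prod.swap ` F)"
        using SC1P_solution_transpose[of M "prod.swap ` F"] by (simp add: swap)
      then show "\<exists>F. SC1P_solution M F \<and> card F \<le> d" using F(2) card by metis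
    next
      assume "\<exists>F. SC1P_solution M F \<and> card F \<le> d"
      then obtain F where F: "SC1P_solution M F" "card F \<le> d" by blast
      then have "SC1P_solution (oriented_mat M) (prod.swap ` F)"
        using SC1P_solution_transpose[of M F] False unfolding oriented_mat_def by simp
      then show "\<exists>F. SC1P_solution (oriented_mat M) F \<and> card F \<le> d" using F(2) card by metis
    qed
  qed (simp add: oriented_mat_def)
qed

text \<open>Horner evaluation of a binary number, cut off at \<open>c\<close> in every step so that
  the unary intermediate results remain polynomial.\<close>

definition capped_value :: "nat \<Rightarrow> bool list \<Rightarrow> nat" where
  "capped_value c bs = foldl (\<lambda>a b. if c \<le> a + a + (if b then 1 else 0) then c else a + a + (if b then 1 else 0)) 0 (rev bs)"

text \<open>Doubling and adding a bit never decreases a number, so a value that has reached the cap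
  stays there.\<close>

lemma capped_value_bits: "capped_value c (bits n) = min c n"
proof (induction n rule: bits.induct)
  case (1 n)
  show ?case
  proof (cases "n = 0")
    case True
    then show ?thesis by (simp add: capped_value_def bits.simps)
  next
    case False
    have bits: "bits n = odd n # bits (n div 2)" using False by (subst bits.simps) simp
    have IH: "capped_value c (bits (n div 2)) = min c (n div 2)" using 1 False by simp
    define m b where "m = n div 2" and "b = (if odd n then 1 else 0 :: nat)"
    have n: "m + m + b = n" "b \<le> 1" unfolding m_def b_def by presburger+
    have "capped_value c (bits n) = (if c \<le> min c m + min c m + b then c else min c m + min c m + b)"
      using IH unfolding bits capped_value_def m_def b_def by simp
    also have "\<dots> = min c n" using n(2) unfolding n(1)[symmetric] min_def by simp
    finally show ?thesis .
  qed
qed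

text \<open>Connects the prescribed input format with the class encoding; the dimensions appear as
  lists of bits because numbers of the class are unary.\<close>

lemma enc_mat_eq: "enc_mat M = enc (bits (dim_row M), bits (dim_col M), mat_to_list M)"
  by (simp add: enc_mat_def Defs.enc_nat_def enc_list_def enc_bool_def)

lemma enc_instance_eq: "enc_instance M d = enc ((bits (dim_row M), bits (dim_col M), mat_to_list M), bits d)"
  by (simp add: enc_instance_def enc_mat_eq Defs.enc_nat_def enc_list_def enc_bool_def)

section \<open>Running time of the operations on matrices\<close>

lemma ptime_row_ones: "ptime f \<Longrightarrow> ptime (\<lambda>x. row_ones (f x))"
  by (rule ptime_comp[of row_ones f]) (unfold row_ones_def, intro ptime_intros')

lemma ptime_items: "ptime f \<Longrightarrow> ptime (\<lambda>x. items (f x))"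
  by (rule ptime_comp[of items f]) (unfold items_def, intro ptime_intros' ptime_row_ones)

lemma ptime_width: "ptime f \<Longrightarrow> ptime (\<lambda>x. width (f x))"
  unfolding width_def by (intro ptime_intros')

lemma ptime_transpose_list: "ptime f \<Longrightarrow> ptime (\<lambda>x. transpose_list (f x))"
  by (rule ptime_comp[of transpose_list f]) (unfold transpose_list_def, intro ptime_intros' ptime_width)

lemma ptime_rows_le_2: "ptime f \<Longrightarrow> ptime (\<lambda>x. rows_le_2 (f x))"
  by (rule ptime_comp[of rows_le_2 f]) (unfold rows_le_2_def, intro ptime_intros' ptime_row_ones)

lemma ptime_orient: "ptime f \<Longrightarrow> ptime (\<lambda>x. orient (f x))"
  by (rule ptime_comp[of orient f]) (unfold orient_def, intro ptime_intros' ptime_rows_le_2 ptime_transpose_list)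

lemma ptime_capped_value:
  assumes "ptime f" "ptime g" shows "ptime (\<lambda>x. capped_value (f x) (g x))"
proof -
  let ?g = "\<lambda>c a b. if c \<le> a + a + (if b then 1 else 0) then c else a + a + (if b then 1 else 0 :: nat)"
  have le: "foldl (?g c) 0 bs \<le> c" for c bs
    by (induction bs rule: rev_induct) auto
  have "ptime (\<lambda>x. foldl (?g (f x)) 0 (rev (g x)))"
  proof (rule ptime_foldl[where B = "\<lambda>x. size_of (f x)"])
    show "ptime (\<lambda>z. ?g (f (fst z)) (fst (snd z)) (snd (snd z)))"
      by (intro ptime_intros' ptime_comp[OF assms(1)])
    show "size_of (foldl (?g (f x)) 0 (take n (rev (g x)))) \<le> size_of (f x)" for x n
      using le[of "f x" "take n (rev (g x))"] unfolding size_of_nat by linarith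
  qed (intro assms ptime_intros ptime_size)+
  then show ?thesis unfolding capped_value_def .
qed

text \<open>The search uses the minimum of \<open>d\<close> and the number of items as its budget. A
  larger budget permits nothing new, this one is polynomial in unary, and being at most
  \<open>d\<close> it keeps the factor \<open>6 ^ d\<close>.\<close>

lemma decision_algorithm:
  "\<exists>P c k. \<forall>M d. two_star M \<or> star_two M \<longrightarrow>
     outputs_within P (enc_instance M d) (enc_bool (\<exists>F. SC1P_solution M F \<and> card F \<le> d))
       (c * 6 ^ d * nodes (enc_instance M d) ^ k)"
proof -
  define B :: "(bool list \<times> bool list \<times> bool list list) \<times> bool list \<Rightarrow> bool list list"
    where "B = (\<lambda>x. orient (snd (snd (fst x))))"
  define n where "n = (\<lambda>x. capped_value (length (items (B x))) (snd x))"
  define K where "K = (\<lambda>x w. kruskal (width (B x)) (foldl branch (items (B x)) w))"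
  define Q where "Q = (\<lambda>x w. claws (foldl branch (items (B x)) w) = [] \<and>
     length (filter (\<lambda>z. z \<notin> set (K x w)) (items (B x))) \<le> n x)"
  have B: "ptime B" unfolding B_def by (intro ptime_orient ptime_intros)
  have n: "ptime n" unfolding n_def by (intro ptime_capped_value ptime_items B ptime_intros)
  have Q: "ptime (\<lambda>z. Q (fst z) (snd z))"
    unfolding Q_def K_def
    by (intro ptime_intros ptime_claws ptime_foldl_branch ptime_mem_item ptime_kruskal ptime_width
        ptime_items ptime_comp[OF B] ptime_comp[OF n])
  obtain P c k where P: "\<And>x. outputs_within P (enc x) (enc (\<exists>w\<in>ternary_strings (n x). Q x w))
      (c * 6 ^ n x * size_of x ^ k)"
    using exhaustive_search[OF n Q] by blast
  have "outputs_within P (enc_instance M d) (enc_bool (\<exists>F. SC1P_solution M F \<and> card F \<le> d))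
       (c * 6 ^ d * nodes (enc_instance M d) ^ k)" if M: "two_star M \<or> star_two M" for M d
  proof -
    define x where "x = ((bits (dim_row M), bits (dim_col M), mat_to_list M), bits d)"
    let ?N = "oriented_mat M"
    let ?A = "items (mat_to_list ?N)"
    have Bx: "B x = mat_to_list ?N" by (simp add: B_def x_def orient_mat)
    have nx: "n x = min (length ?A) d" 
      unfolding n_def Bx by (simp add: x_def capped_value_bits)
    have dist: "distinct ?A" using proper_items_mat[of ?N] by (simp add: proper_items_def)
    have "length (filter (\<lambda>z. z \<notin> set (K x w)) ?A) = card (set ?A - set (K x w))" for w
      using distinct_card[OF distinct_filter[OF dist]] by (simp add: set_diff_eq)
    then have "(\<exists>w\<in>ternary_strings (n x). Q x w) \<longleftrightarrow>
        (\<exists>X. deletable (set ?A) X \<and> card X \<le> n x)"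
      unfolding branching_correct[OF proper_items_mat, symmetric] Q_def K_def Bx by simp
    also have "\<dots> \<longleftrightarrow> (\<exists>X. deletable (set ?A) X \<and> card X \<le> d)"
    proof -
      have "card X \<le> length ?A" if "deletable (set ?A) X" for X
        using that card_mono[of "set ?A" X] card_length[of ?A] unfolding deletable_def by simp
      then show ?thesis unfolding nx by auto
    qed
    also have "\<dots> \<longleftrightarrow> (\<exists>F. SC1P_solution M F \<and> card F \<le> d)"
      unfolding set_items using SC1P_solution_iff_deletable[OF star_two_oriented[OF M]]
        SC1P_solution_oriented by simp
    finally have eq: "(\<exists>w\<in>ternary_strings (n x). Q x w) \<longleftrightarrow> (\<exists>F. SC1P_solution M F \<and> card F \<le> d)" .
    have "c * 6 ^ n x * size_of x ^ k \<le> c * 6 ^ d * size_of x ^ k"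
      unfolding nx by (intro mult_right_mono mult_left_mono power_increasing) auto
    then show ?thesis
      using P[of x] unfolding eq enc_instance_eq x_def[symmetric] outputs_within_def enc_bool_def
      by (meson order_trans)
  qed
  then show ?thesis by blast
qed

text \<open>Every row whose item is not kept loses all its ones, regardless of whether a claw or
  \<open>kruskal\<close> removed it.\<close>

definition flips :: "bool list list \<Rightarrow> bool list list" where
  "flips B = (let A = items B; K = kruskal (width B) ((prune ^^ length A) A)
     in map (\<lambda>i. map (\<lambda>b. b \<and> (\<exists>z\<in>set A. z \<notin> set K \<and> fst z = i)) (nth_default [] B i)) [0..<length B])"

definition flips_mat :: "bool mat \<Rightarrow> (nat \<times> nat) set" where
  "flips_mat M = (let A = items (mat_to_list M)
     in {(i, j) \<in> ones M. i \<in> fst ` (set A - set (kruskal (width (mat_to_list M)) ((prune ^^ length A) A)))})"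

lemma flips_mat: "flips (mat_to_list M) = mat_to_list (mat (dim_row M) (dim_col M) (\<lambda>p. p \<in> flips_mat M))"
proof -
  let ?A = "items (mat_to_list M)"
  let ?K = "kruskal (width (mat_to_list M)) ((prune ^^ length ?A) ?A)"
  have "map (\<lambda>b. b \<and> (\<exists>z\<in>set ?A. z \<notin> set ?K \<and> fst z = i)) (nth_default [] (mat_to_list M) i) =
      map (\<lambda>j. (i, j) \<in> flips_mat M) [0..<dim_col M]" if "i < dim_row M" for i
    unfolding mat_to_list_simps(2)[OF that] using that
    by (auto simp: flips_mat_def Let_def ones_def image_iff)
  then show ?thesis unfolding flips_def Let_def mat_to_list_simps(1)
    by (auto simp: mat_to_list_def)
qed

text \<open>Six is three times two: at most three lost items per item of the compared deletion, with
  two ones in each row.\<close>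

lemma flips_mat_correct:
  assumes M: "star_two M"
  shows "SC1P_solution M (flips_mat M)" "SC1P_solution M F \<Longrightarrow> card (flips_mat M) \<le> 6 * card F"
proof -
  let ?A = "items (mat_to_list M)"
  let ?w = "width (mat_to_list M)"
  let ?K = "kruskal ?w ((prune ^^ length ?A) ?A)"
  let ?X = "edge_rows M - set ?K"
  have flips: "flips_mat M = {(i, j) \<in> ones M. i \<in> fst ` ?X}"
    unfolding flips_mat_def Let_def set_items ..
  \<comment> \<open>Deleting every edge is always possible; this supplies the deletion that
    \<open>pruning_correct\<close> asks for when only the absence of claws is wanted.\<close>
  have del: "deletable (edge_rows M) (edge_rows M)"
    unfolding deletable_def linear_layout_def by (auto intro: exI[of _ int])
  have claws: "claws ((prune ^^ length ?A) ?A) = []"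
    using pruning_correct[OF proper_items_mat _ order_refl] del unfolding set_items by blast
  obtain Q where Q: "(prune ^^ length ?A) ?A = filter Q ?A" using funpow_prune_filter by blast
  have X: "deletable (edge_rows M) ?X"
    using deletable_of_kruskal[OF proper_items_mat[of M] claws[unfolded Q]] unfolding Q set_items .
  show "SC1P_solution M (flips_mat M)"
  proof (rule SC1P_solution_if_deletable[OF M X])
    show "flips_mat M \<subseteq> ones M" unfolding flips by blast
    show "fst ` ?X \<subseteq> fst ` flips_mat M"
    proof
      fix i assume i: "i \<in> fst ` ?X"
      then obtain u v where "(i, u, v) \<in> edge_rows M" by auto
      then have "(i, u) \<in> ones M" unfolding edge_rows_def ones_def by auto
      then show "i \<in> fst ` flips_mat M" using i unfolding flips by force
    qed
  qed
  assume "SC1P_solution M F"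
  then obtain X' where X': "deletable (edge_rows M) X'" "card X' \<le> card F"
    by (rule deletable_if_SC1P_solution)
  have c: "card ?X \<le> 3 * card X'"
    using pruning_correct[OF proper_items_mat[of M] _ order_refl] X'(1) unfolding set_items by blast
  have fin: "finite (edge_rows M)" unfolding set_items[symmetric] by simp
  have "flips_mat M \<subseteq> (\<lambda>(i, u, v). (i, u)) ` ?X \<union> (\<lambda>(i, u, v). (i, v)) ` ?X"
  proof
    fix q assume q: "q \<in> flips_mat M"
    obtain i j where ij: "q = (i, j)" by (cases q)
    then obtain u v where uv: "(i, u, v) \<in> ?X" "(i, j) \<in> ones M" using q unfolding flips by auto
    then have "j \<in> {u, v}" unfolding edge_rows_def ones_def by blast
    then show "q \<in> (\<lambda>(i, u, v). (i, u)) ` ?X \<union> (\<lambda>(i, u, v). (i, v)) ` ?X"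
      using uv(1) ij by force
  qed
  then have "card (flips_mat M) \<le> card ((\<lambda>(i, u, v). (i, u)) ` ?X \<union> (\<lambda>(i, u, v). (i, v)) ` ?X)"
    using fin by (intro card_mono) auto
  also have "\<dots> \<le> card ((\<lambda>(i, u, v). (i, u)) ` ?X) + card ((\<lambda>(i, u, v). (i, v)) ` ?X)"
    by (rule card_Un_le)
  also have "\<dots> \<le> card ?X + card ?X"
    using fin by (intro add_mono card_image_le) auto
  also have "\<dots> \<le> 6 * card F" using c X'(2) by linarith
  finally show "card (flips_mat M) \<le> 6 * card F" .
qed

text \<open>Flipping all ones leaves the zero matrix, whose rows are empty intervals, so the minimum
  ranges over a nonempty set.\<close>

lemma SC1P_opt_attained:
  obtains F where "SC1P_solution M F" "card F = SC1P_opt M"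
proof -
  have "SC1P_solution M (ones M)"
  proof -
    have "\<not> flip_to_zero M (ones M) $$ (i, j)" if "i < dim_row M" "j < dim_col M" for i j
      using that unfolding flip_to_zero_def ones_def by simp
    then have "C1P_rows (flip_to_zero M (ones M))" "C1P_rows (transpose_mat (flip_to_zero M (ones M)))"
      by (intro C1P_rowsI[where key = "\<lambda>_. 0" and lo = "\<lambda>_. 1" and hi = "\<lambda>_. 0"];
          simp add: flip_to_zero_def ones_def)+
    then show ?thesis unfolding SC1P_solution_def SC1P_def C1P_cols_transpose by blast
  qed
  then have "\<exists>k F. SC1P_solution M F \<and> card F = k" by blast
  from LeastI_ex[OF this] show ?thesis using that unfolding SC1P_opt_def by blast
qed

lemma approximation_algorithm:
  "\<exists>P c k. \<forall>M. two_star M \<or> star_two M \<longrightarrow>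
     (\<exists>F. outputs_within P (enc_mat M) (enc_positions (dim_row M) (dim_col M) F) (c * nodes (enc_mat M) ^ k)
        \<and> SC1P_solution M F \<and> card F \<le> 6 * SC1P_opt M)"
proof -
  \<comment> \<open>The output is a matrix of the same shape, so the bits of its dimensions are
    copied from the input.\<close>
  define f :: "bool list \<times> bool list \<times> bool list list \<Rightarrow> bool list \<times> bool list \<times> bool list list"
    where "f = (\<lambda>x. (fst x, fst (snd x), if rows_le_2 (snd (snd x)) then flips (snd (snd x))
      else transpose_list (flips (transpose_list (snd (snd x))))))"
  have "ptime flips"
    unfolding flips_def Let_def
    by (intro ptime_intros ptime_eq_nat ptime_mem_item ptime_kruskal ptime_width ptime_items ptime_funpow_prune)
  note ptime_flips = ptime_comp[OF this]
  have "ptime f"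
    unfolding f_def by (intro ptime_intros ptime_rows_le_2 ptime_flips ptime_transpose_list)
  then obtain P c k where P: "\<And>x. outputs_within P (enc x) (enc (f x)) (c * size_of x ^ k)"
    using ptime_outputs_within by blast
  have "\<exists>F. outputs_within P (enc_mat M) (enc_positions (dim_row M) (dim_col M) F) (c * nodes (enc_mat M) ^ k)
        \<and> SC1P_solution M F \<and> card F \<le> 6 * SC1P_opt M" if M: "two_star M \<or> star_two M" for M
  proof -
    let ?x = "(bits (dim_row M), bits (dim_col M), mat_to_list M)"
    have "\<exists>F. f ?x = (bits (dim_row M), bits (dim_col M), mat_to_list (mat (dim_row M) (dim_col M) (\<lambda>p. p \<in> F)))
        \<and> SC1P_solution M F \<and> (\<forall>F'. SC1P_solution M F' \<longrightarrow> card F \<le> 6 * card F')"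
    proof (cases "star_two M")
      case True
      then show ?thesis
        using flips_mat_correct[OF True] by (intro exI[of _ "flips_mat M"]) (simp add: f_def rows_le_2_mat flips_mat)
    next
      case False
      let ?N = "transpose_mat M"
      let ?F = "prod.swap ` flips_mat ?N"
      have N: "star_two ?N" using False M star_two_transpose by blast
      \<comment> \<open>Both dimensions are needed: \<open>transpose_list\<close> reads the width
        off the first row and is applied once to each orientation.\<close>
      have dims: "0 < dim_row M" "0 < dim_col M" using False unfolding star_two_def by force+
      have card: "card (prod.swap ` G) = card G" for G :: "(nat \<times> nat) set"
        by (rule card_image) simp
      have "transpose_list (flips (transpose_list (mat_to_list M))) =
          mat_to_list (transpose_mat (mat (dim_col M) (dim_row M) (\<lambda>p. p \<in> flips_mat ?N)))"
        unfolding transpose_list_mat[OF dims(1)] flips_mat using dims by (subst transpose_list_mat) simp_all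
      also have "transpose_mat (mat (dim_col M) (dim_row M) (\<lambda>p. p \<in> flips_mat ?N)) =
          mat (dim_row M) (dim_col M) (\<lambda>p. p \<in> ?F)"
        by (rule eq_matI) (simp_all add: pair_in_swap_image)
      finally have "f ?x = (bits (dim_row M), bits (dim_col M), mat_to_list (mat (dim_row M) (dim_col M) (\<lambda>p. p \<in> ?F)))"
        using False by (simp add: f_def rows_le_2_mat)
      moreover have "SC1P_solution M ?F"
        using flips_mat_correct(1)[OF N] SC1P_solution_transpose[of M ?F] by (simp add: image_image)
      moreover have "card ?F \<le> 6 * card F'" if "SC1P_solution M F'" for F'
        using flips_mat_correct(2)[OF N, of "prod.swap ` F'"] that SC1P_solution_transpose[of M F']
        by (simp add: card)
      ultimately show ?thesis by blast
    qed
    then obtain F where F: "f ?x = (bits (dim_row M), bits (dim_col M), mat_to_list (mat (dim_row M) (dim_col M) (\<lambda>p. p \<in> F)))"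
        "SC1P_solution M F" "\<And>F'. SC1P_solution M F' \<Longrightarrow> card F \<le> 6 * card F'" by blast
    have "outputs_within P (enc_mat M) (enc_positions (dim_row M) (dim_col M) F) (c * nodes (enc_mat M) ^ k)"
      using P[of ?x] unfolding F(1) enc_mat_eq enc_positions_def by simp
    moreover have "card F \<le> 6 * SC1P_opt M" using F(3) SC1P_opt_attained by metis
    ultimately show ?thesis using F(2) by blast
  qed
  then show ?thesis by blast
qed

theorem theorem14:
  shows "(\<exists>P c k. \<forall>(M :: bool mat) (d :: nat). two_star M \<or> star_two M \<longrightarrow>
            outputs_within P (enc_instance M d)
              (enc_bool (\<exists>F. SC1P_solution M F \<and> card F \<le> d))
              (c * 6 ^ d * nodes (enc_instance M d) ^ k))
       \<and> (\<exists>P c k. \<forall>M :: bool mat. two_star M \<or> star_two M \<longrightarrow>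
            (\<exists>F. outputs_within P (enc_mat M) (enc_positions (dim_row M) (dim_col M) F)
                   (c * nodes (enc_mat M) ^ k)
               \<and> SC1P_solution M F \<and> card F \<le> 6 * SC1P_opt M))"
  by (intro conjI decision_algorithm approximation_algorithm)

end
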